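(* Let $\Gamma_0\subset\mathbb{C}$ be an analytic Jordan arc and let $z_0\in\Gamma_0$ be a point that is not an endpoint of $\Gamma_0$. Let $n_1(z_0)$ and $n_2(z_0)=-n_1(z_0)$ be the two unit normals to $\Gamma_0$ at $z_0$. Let $G:=\mathbb{C}_\infty\setminus\Gamma_0$ and let $Z\subset G$ be closed in $\mathbb{C}_\infty$. Then for every $\varepsilon>0$ there is $N=N(\varepsilon,\Gamma_0,z_0,Z)$ such that every rational function $f$ whose poles all lie in $Z$ and with $\deg f\ge N$ satisfies $$|f'(z_0)|\le(1+\varepsilon)\,\|f\|_{\Gamma_0}\cdot\max\Big(\sum_\beta\frac{\partial}{\partial n_1(z_0)}g_G(z_0,\beta),\ \sum_\beta\frac{\partial}{\partial n_2(z_0)}g_G(z_0,\beta)\Big),$$ where both sums run over all poles $\beta$ of $f$ in $G$, each repeated according to its order.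
   Context: $\mathbb{C}_\infty=\mathbb{C}\cup\{\infty\}$. An analytic Jordan arc is the image of $[-1,1]$ under a function that is analytic and injective on an open neighbourhood of $[-1,1]$. $\|f\|_{\Gamma_0}=\sup_{z\in\Gamma_0}|f(z)|$. The degree of a rational function is the total order of its poles in $\mathbb{C}_\infty$, counting multiplicities. $g_G(\cdot,\beta)$ is the Green function of $G$ with pole at $\beta$, extended by $0$ to $\Gamma_0$. For the interior point $z_0$ and a unit normal $n_j(z_0)$, $\frac{\partial}{\partial n_j(z_0)}g_G(z_0,\beta):=\lim_{t\to0^+}g_G(z_0+tn_j(z_0),\beta)/t$, the one-sided normal derivative from the side of $\Gamma_0$ into which $n_j(z_0)$ points. *)

theory Defs
  imports "HOL-Analysis.Analysis" "HOL-Computational_Algebra.Polynomial"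
begin

text \<open>The extended plane C_infinity is modelled as complex option: Some z is z, None is infinity.\<close>

definition closed_ext :: "complex option set \<Rightarrow> bool" where
  "closed_ext Z \<longleftrightarrow> closed {z. Some z \<in> Z} \<and> (\<not> bounded {z. Some z \<in> Z} \<longrightarrow> None \<in> Z)"

definition analytic_arc_param :: "(complex \<Rightarrow> complex) \<Rightarrow> complex set \<Rightarrow> bool" where
  "analytic_arc_param \<gamma> U \<longleftrightarrow> open U \<and> complex_of_real ` {-1..1} \<subseteq> U \<and>
      \<gamma> holomorphic_on U \<and> inj_on \<gamma> U"

definition arc_of :: "(complex \<Rightarrow> complex) \<Rightarrow> complex set" where
  "arc_of \<gamma> = \<gamma> ` (complex_of_real ` {-1..1})"

definition harmonic_on :: "(complex \<Rightarrow> real) \<Rightarrow> complex set \<Rightarrow> bool" where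
  "harmonic_on g S \<longleftrightarrow> (\<forall>z\<in>S. \<exists>r>0. \<exists>h. h holomorphic_on ball z r \<and> (\<forall>w\<in>ball z r. g w = Re (h w)))"

definition fin_part :: "complex option \<Rightarrow> complex set" where
  "fin_part \<beta> = (case \<beta> of None \<Rightarrow> {} | Some b \<Rightarrow> {b})"

text \<open>g is the Green function of G = C_infinity minus Gamma with pole at beta, restricted to the
  finite plane, extended by 0 on Gamma (and set to 0 at a finite pole, for definiteness).\<close>
definition is_green :: "complex set \<Rightarrow> complex option \<Rightarrow> (complex \<Rightarrow> real) \<Rightarrow> bool" where
  "is_green \<Gamma> \<beta> g \<longleftrightarrow>
     (\<forall>z\<in>\<Gamma>. g z = 0) \<and>
     continuous_on (UNIV - fin_part \<beta>) g \<and>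
     harmonic_on g (UNIV - \<Gamma> - fin_part \<beta>) \<and>
     (case \<beta> of
        Some b \<Rightarrow> g b = 0 \<and>
          (\<exists>r>0. \<exists>h. harmonic_on h (ball b r) \<and>
              (\<forall>z\<in>ball b r - {b}. g z = h z - ln (cmod (z - b)))) \<and>
          (\<exists>r>0. \<exists>h. harmonic_on h (ball 0 r) \<and>
              (\<forall>w\<in>ball 0 r - {0}. g (1 / w) = h w))
      | None \<Rightarrow>
          (\<exists>r>0. \<exists>h. harmonic_on h (ball 0 r) \<and>
              (\<forall>w\<in>ball 0 r - {0}. g (1 / w) = h w - ln (cmod w))))"

definition green :: "complex set \<Rightarrow> complex option \<Rightarrow> complex \<Rightarrow> real" where
  "green \<Gamma> \<beta> = (THE g. is_green \<Gamma> \<beta> g)"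

definition normal_deriv :: "(complex \<Rightarrow> real) \<Rightarrow> complex \<Rightarrow> complex \<Rightarrow> real" where
  "normal_deriv g z0 n = Lim (at_right 0) (\<lambda>t::real. g (z0 + complex_of_real t * n) / t)"

text \<open>Rational function p/q (coprime, q nonzero). Its degree (total order of poles in
  C_infinity) is max(deg p, deg q); it has a pole at infinity of order deg p - deg q.\<close>
definition rat_deg :: "complex poly \<Rightarrow> complex poly \<Rightarrow> nat" where
  "rat_deg p q = max (degree p) (degree q)"

definition poles_in :: "complex poly \<Rightarrow> complex poly \<Rightarrow> complex option set \<Rightarrow> bool" where
  "poles_in p q Z \<longleftrightarrow> (\<forall>b. poly q b = 0 \<longrightarrow> Some b \<in> Z) \<and> (degree q < degree p \<longrightarrow> None \<in> Z)"

definition pole_sum :: "complex poly \<Rightarrow> complex poly \<Rightarrow> (complex option \<Rightarrow> real) \<Rightarrow> real" where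
  "pole_sum p q D = (\<Sum>b\<in>{b. poly q b = 0}. real (order b q) * D (Some b))
                     + real (degree p - degree q) * D None"

definition sup_norm :: "(complex \<Rightarrow> complex) \<Rightarrow> complex set \<Rightarrow> real" where
  "sup_norm f S = (SUP z\<in>S. cmod (f z))"

end

theory Submission
  imports Defs "HOL-Complex_Analysis.Complex_Analysis"
    "HOL-Computational_Algebra.Fundamental_Theorem_Algebra"
begin

text \<open>
  The inversion \<open>w = 1 / (z - a)\<close> at an endpoint \<open>a\<close> of the arc turns the complement of the arc into a
  simply connected plane domain, and a Riemann map of it gives every Green function as minus the
  logarithm of a Blaschke factor. The maximum principle then yields the Bernstein--Walsh bound
  \<open>|f(z)| \<le> \<parallel>f\<parallel> exp (\<Sum> g(z, \<beta>))\<close>. Pulled back by the parametrization, each Green function is a positive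
  harmonic function on a half disc that vanishes on the diameter; it extends by reflection to the
  imaginary part of a typically real function, and so is at most
  \<open>A Im x (1 + C |x| / r)\<close>, where \<open>A\<close> is its normal derivative at the centre and \<open>C\<close> is universal. Hence
  \<open>f\<close> along the arc is bounded by \<open>\<parallel>f\<parallel> exp (s |Im x|)\<close> on a disc of fixed radius, with \<open>s\<close> close to the larger
  of the two sums. Normal derivatives are bounded below uniformly over the poles, so \<open>s\<close> grows
  with the degree, and after scaling by \<open>s\<close> the interpolation formula of M. Riesz, truncated to a large disc,
  gives \<open>|f'| \<le> (1 + o(1)) s \<parallel>f\<parallel>\<close>.
\<close>

text \<open>The number of poles is unbounded, so only a relative error that is the same for every
  pole survives the summation. This is the purpose of the typically real functions: they bound each
  Green function by its own normal derivative times a factor that does not mention the pole. The two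
  sides of the arc grow at different rates, whereas the interpolation formula accepts a single
  exponential type. Giving both sides the larger rate is the origin of the maximum. The nodes of the
  formula correspond to points of the arc, where the modulus of \<open>f\<close> is at most its
  norm; growth off the arc therefore enters only the remainder, and the main term keeps the sharp
  constant 1. The remainder is small once the scaled disc has radius above \<open>pi * N0\<close>
  with \<open>N0\<close> large, and this forces the degree to be large. An endpoint serves as the
  centre of inversion because the arc without it is still connected: the complement of the new
  domain is then connected and unbounded.\<close>

section \<open>Maximum principle and Schwarz estimates\<close>

text \<open>\<open>v\<close> is only locally the modulus of a holomorphic function, since the
  harmonic functions placed in an exponent later may have no global conjugate. The boundary
  condition is phrased through compact subsets of \<open>S\<close>, which covers unbounded domains
  and boundaries without any regularity.\<close>

lemma maximum_principle_local_norm: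
  fixes v :: "complex \<Rightarrow> real"
  assumes S: "open S" "connected S"
    and loc: "\<And>w. w \<in> S \<Longrightarrow> \<exists>r>0. \<exists>H. H holomorphic_on ball w r \<and> (\<forall>x\<in>ball w r. v x = cmod (H x))"
    and bd: "\<And>e. e > 0 \<Longrightarrow> \<exists>K. compact K \<and> K \<subseteq> S \<and> (\<forall>w\<in>S - K. v w \<le> M + e)"
    and w: "w \<in> S"
  shows "v w \<le> M"
proof (rule ccontr)
  assume "\<not> v w \<le> M"
  hence gt: "v w > M" by simp
  define e where "e = (v w - M) / 2"
  have e: "e > 0" "M + e < v w" using gt by (auto simp: e_def field_simps)
  obtain K where K: "compact K" "K \<subseteq> S" "\<And>w. w \<in> S - K \<Longrightarrow> v w \<le> M + e"
    using bd[OF e(1)] by blast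
  have cont: "continuous_on S v"
    unfolding continuous_on_eq_continuous_at[OF S(1)]
  proof
    fix x assume "x \<in> S"
    then obtain r H where r: "r > 0" and H: "H holomorphic_on ball x r"
      and eq: "\<And>y. y \<in> ball x r \<Longrightarrow> v y = cmod (H y)" using loc by blast
    have "continuous_on (ball x r) (\<lambda>y. cmod (H y))"
      using H by (intro continuous_intros holomorphic_on_imp_continuous_on)
    hence "continuous_on (ball x r) v" using eq by (metis continuous_on_cong)
    thus "isCont v x" using r by (simp add: continuous_on_eq_continuous_at)
  qed
  have "compact (insert w K)" "insert w K \<noteq> {}" using K by auto
  moreover have sub: "insert w K \<subseteq> S" using K w by auto
  ultimately obtain m where m: "m \<in> insert w K" "\<And>x. x \<in> insert w K \<Longrightarrow> v x \<le> v m"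
    using continuous_attains_sup continuous_on_subset[OF cont] by meson
  have mS: "m \<in> S" using m sub by blast
  have big: "v m > M + e" using m(2)[of w] e by auto
  have max: "v x \<le> v m" if "x \<in> S" for x
    using K(3)[of x] m(2)[of x] that big by fastforce
  define A where "A = {x\<in>S. v x = v m}"
  have "open A"
    unfolding open_contains_ball
  proof
    fix x assume x: "x \<in> A"
    hence xS: "x \<in> S" and vx: "v x = v m" by (auto simp: A_def)
    obtain r H where r: "r > 0" and H: "H holomorphic_on ball x r"
      and eq: "\<And>y. y \<in> ball x r \<Longrightarrow> v y = cmod (H y)" using loc xS by blast
    obtain r' where r': "r' > 0" "ball x r' \<subseteq> S" using S(1) xS openE by blast
    define s where "s = min r r'"
    have s: "s > 0" "ball x s \<subseteq> ball x r" "ball x s \<subseteq> S" using r r' by (auto simp: s_def)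
    have "H constant_on ball x s"
    proof (rule maximum_modulus_principle[of H "ball x s" "ball x s" x])
      show "H holomorphic_on ball x s" using H s by (meson holomorphic_on_subset)
      show "cmod (H z) \<le> cmod (H x)" if "z \<in> ball x s" for z
        using that s eq max vx by (metis centre_in_ball in_mono)
    qed (use s in auto)
    hence "v y = v m" if "y \<in> ball x s" for y
      using that s eq vx by (metis centre_in_ball constant_on_def in_mono)
    hence "ball x s \<subseteq> A" using s by (auto simp: A_def)
    thus "\<exists>e>0. ball x e \<subseteq> A" using s by blast
  qed
  moreover have "open (S - A)"
  proof -
    have "open (S \<inter> v -` (- {v m}))"
      by (rule continuous_open_preimage[OF cont S(1)]) auto
    moreover have "S \<inter> v -` (- {v m}) = S - A" by (auto simp: A_def)
    ultimately show ?thesis by simp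
  qed
  ultimately have "S - A = {}"
    using connectedD[OF S(2), of A "S - A"] mS by (auto simp: A_def)
  \<comment> \<open>\<open>A\<close> is all of \<open>S\<close>, and on \<open>A\<close> the value
    of \<open>v\<close> exceeds \<open>M + e\<close>, so nothing of \<open>S\<close> lies outside
    \<open>K\<close>. A nonempty open subset of the plane cannot be compact.\<close>
  hence "S \<subseteq> K" using K(3) big by (force simp: A_def)
  hence "compact S" using K by (metis subset_antisym)
  thus False using S(1) w clopen compact_imp_closed not_compact_UNIV by (metis empty_iff)
qed

text \<open>\<open>\<Psi>\<close> is \<open>Q\<close> followed by the Cayley map that takes the
  right half plane to the unit disc and \<open>Q 0\<close> to 0; both parts are Schwarz's lemma for
  \<open>\<Psi>\<close>.\<close>

lemma halfplane_schwarz: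
  assumes hol: "Q holomorphic_on ball 0 1" and pos: "\<And>z. z \<in> ball 0 1 \<Longrightarrow> Re (Q z) > 0"
  shows "norm (deriv Q 0) \<le> 2 * Re (Q 0)"
    and "z \<in> ball 0 1 \<Longrightarrow> cmod (Q z - Q 0) \<le> cmod z * cmod (Q z + cnj (Q 0))"
proof -
  define \<Psi> where "\<Psi> = (\<lambda>z. (Q z - Q 0) / (Q z + cnj (Q 0)))"
  have p0: "Re (Q 0) > 0" using pos by simp
  have nz: "Q z + cnj (Q 0) \<noteq> 0" if "z \<in> ball 0 1" for z
    using pos[OF that] p0 by (auto simp: complex_eq_iff)
  have hol\<Psi>: "\<Psi> holomorphic_on ball 0 1"
    unfolding \<Psi>_def using nz by (intro holomorphic_intros hol) auto
  have lt: "cmod (\<Psi> z) < 1" if "cmod z < 1" for z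
  proof -
    have "0 < Re (Q z) * Re (Q 0)" using pos p0 that by simp
    hence "(cmod (Q z - Q 0))\<^sup>2 < (cmod (Q z + cnj (Q 0)))\<^sup>2"
      unfolding cmod_power2 by (simp add: power2_eq_square algebra_simps)
    hence "cmod (Q z - Q 0) < cmod (Q z + cnj (Q 0))" by (rule power2_less_imp_less) simp
    thus ?thesis using nz[of z] that by (simp add: \<Psi>_def norm_divide divide_simps)
  qed
  have \<Psi>0: "\<Psi> 0 = 0" by (simp add: \<Psi>_def)
  note sch = Schwarz_Lemma[OF hol\<Psi> \<Psi>0 lt]
  have "(Q has_field_derivative deriv Q 0) (at 0)"
    by (rule holomorphic_derivI[OF hol]) auto
  hence "(\<Psi> has_field_derivative (deriv Q 0 * (Q 0 + cnj (Q 0)) - (Q 0 - Q 0) * deriv Q 0) / ((Q 0 + cnj (Q 0)) * (Q 0 + cnj (Q 0)))) (at 0)"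
    unfolding \<Psi>_def using nz[of 0]
    by (intro DERIV_divide) (auto intro!: derivative_eq_intros)
  hence "(\<Psi> has_field_derivative deriv Q 0 / (Q 0 + cnj (Q 0))) (at 0)"
    using nz[of 0] by simp
  hence "deriv \<Psi> 0 = deriv Q 0 / (Q 0 + cnj (Q 0))" by (rule DERIV_imp_deriv)
  also have "Q 0 + cnj (Q 0) = of_real (2 * Re (Q 0))" by (simp add: complex_eq_iff)
  finally have "cmod (deriv Q 0) / (2 * Re (Q 0)) \<le> 1"
    using sch(2)[of 0] p0 by (simp add: norm_divide)
  thus "norm (deriv Q 0) \<le> 2 * Re (Q 0)" using p0 by (simp add: divide_simps)
  show "cmod (Q z - Q 0) \<le> cmod z * cmod (Q z + cnj (Q 0))" if "z \<in> ball 0 1"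
    using sch(1)[of z] that nz[OF that] by (simp add: \<Psi>_def norm_divide divide_simps)
qed

lemma deriv_bound_Im_pos:
  assumes hol: "H holomorphic_on ball c y" and y: "y > 0"
    and pos: "\<And>z. z \<in> ball c y \<Longrightarrow> Im (H z) > 0"
  shows "cmod (deriv H c) \<le> 2 * Im (H c) / y"
proof -
  define Q where "Q = (\<lambda>z. - \<i> * H (c + of_real y * z))"
  have in_ball: "c + of_real y * z \<in> ball c y" if "z \<in> ball 0 1" for z
    using that y by (simp add: dist_norm norm_mult)
  have "(H \<circ> (\<lambda>z. c + of_real y * z)) holomorphic_on ball 0 1"
    by (rule holomorphic_on_compose_gen[OF _ hol]) (use in_ball in \<open>auto intro!: holomorphic_intros\<close>)
  hence "Q holomorphic_on ball 0 1" unfolding Q_def o_def by (intro holomorphic_intros)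
  moreover have "Re (Q z) > 0" if "z \<in> ball 0 1" for z
    using pos[OF in_ball[OF that]] by (simp add: Q_def)
  ultimately have 1: "norm (deriv Q 0) \<le> 2 * Re (Q 0)" by (rule halfplane_schwarz(1))
  have dH: "(H has_field_derivative deriv H c) (at c)"
    by (rule holomorphic_derivI[OF hol]) (use y in auto)
  have "(Q has_field_derivative - \<i> * (deriv H c * of_real y)) (at 0)"
    unfolding Q_def
    by (rule DERIV_cmult, rule DERIV_chain2[where f = H])
       (use dH in \<open>auto intro!: derivative_eq_intros\<close>)
  hence "deriv Q 0 = - \<i> * (deriv H c * of_real y)" by (rule DERIV_imp_deriv)
  thus ?thesis using 1 y by (simp add: norm_mult Q_def field_simps)
qed

text \<open>The shift by \<open>d > 0\<close> restores the strict positivity that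
  \<open>halfplane_schwarz\<close> asks for and is removed in the limit. The bound is proportional
  to \<open>A\<close>, which will be the derivative that governs everything else.\<close>

lemma Re_nonneg_growth:
  assumes hol: "P holomorphic_on ball 0 1" and pos: "\<And>z. z \<in> ball 0 1 \<Longrightarrow> Re (P z) \<ge> 0"
    and P0: "P 0 = of_real A" and z: "z \<in> ball 0 1"
  shows "cmod (P z - of_real A) \<le> 2 * cmod z * A / (1 - cmod z)"
proof -
  have A: "A \<ge> 0" using pos[of 0] P0 by simp
  have *: "cmod (P z - of_real A) \<le> 2 * cmod z * (A + d) / (1 - cmod z)" if d: "d > 0" for d :: real
  proof -
    define Q where "Q = (\<lambda>z. P z + of_real d)"
    have "cmod (Q z - Q 0) \<le> cmod z * cmod (Q z + cnj (Q 0))"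
      by (rule halfplane_schwarz(2)[OF _ _ z]) (use pos d in \<open>auto simp: Q_def add_nonneg_pos intro!: holomorphic_intros hol\<close>)
    also have "Q z + cnj (Q 0) = (Q z - Q 0) + of_real (2 * (A + d))"
      by (simp add: Q_def P0)
    also have "cmod \<dots> \<le> cmod (Q z - Q 0) + 2 * (A + d)"
      using A d norm_triangle_ineq[of "Q z - Q 0" "of_real (2 * (A + d))"] by (simp only: norm_of_real) simp
    finally have "cmod (Q z - Q 0) \<le> cmod z * (cmod (Q z - Q 0) + 2 * (A + d))"
      by (simp add: mult_left_mono)
    hence "cmod (P z - of_real A) \<le> cmod z * (cmod (P z - of_real A) + 2 * (A + d))"
      by (simp add: Q_def P0)
    thus ?thesis using z by (simp add: field_simps)
  qed
  have "((\<lambda>d. 2 * cmod z * (A + d) / (1 - cmod z)) \<longlongrightarrow> 2 * cmod z * (A + 0) / (1 - cmod z)) (at_right 0)"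
    using z by (intro tendsto_intros) auto
  hence "cmod (P z - of_real A) \<le> 2 * cmod z * (A + 0) / (1 - cmod z)"
    by (rule tendsto_lowerbound) (use * in \<open>auto simp: eventually_at_right_field intro!: exI[of _ 1]\<close>)
  thus ?thesis by simp
qed

section \<open>Reflection of positive harmonic functions in a half disc\<close>

text \<open>Turns boundedness into decay proportional to the distance from the diameter, by
  comparison with a multiple of the barrier \<open>B\<close>. An estimate on the vertical radius
  suffices, since the centre \<open>x0\<close> may be moved along the real axis.\<close>

lemma half_disc_barrier:
  fixes u :: "complex \<Rightarrow> real" and x0 :: real
  assumes \<rho>: "\<rho> > 0" and M: "M \<ge> 0"
    and cont: "continuous_on (cball (of_real x0) \<rho> \<inter> {z. 0 \<le> Im z}) u"
    and hol: "H holomorphic_on (ball (of_real x0) \<rho> \<inter> {z. 0 < Im z})"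
    and uH: "\<And>z. z \<in> ball (of_real x0) \<rho> \<Longrightarrow> 0 < Im z \<Longrightarrow> u z = Im (H z)"
    and uM: "\<And>z. z \<in> cball (of_real x0) \<rho> \<Longrightarrow> 0 \<le> Im z \<Longrightarrow> u z \<le> M"
    and u0: "\<And>z. z \<in> cball (of_real x0) \<rho> \<Longrightarrow> Im z = 0 \<Longrightarrow> u z \<le> 0"
    and y: "0 < y" "y < \<rho>"
  shows "u (Complex x0 y) \<le> 2 * M * y / \<rho>"
proof -
  define D where "D = ball (complex_of_real x0) \<rho> \<inter> {z. 0 < Im z}"
  define C where "C = cball (complex_of_real x0) \<rho> \<inter> {z. 0 \<le> Im z}"
  \<comment> \<open>Scaled so that \<open>c * B\<close> reaches \<open>M\<close> where
    \<open>B\<close> reaches \<open>\<rho>^2\<close>, that is, on the circular part.\<close>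
  define c where "c = M / \<rho>\<^sup>2"
  have c: "c \<ge> 0" using M by (simp add: c_def)
  \<comment> \<open>The harmonic barrier is nonnegative on the diameter and at least \<open>\<rho>\<^sup>2\<close> on the circular part of the boundary.\<close>
  define B where "B = (\<lambda>z::complex. 2 * \<rho> * Im z + (Re z - x0)\<^sup>2 - (Im z)\<^sup>2)"
  define v where "v = (\<lambda>z. exp (u z - c * B z))"
  have D: "open D" "connected D"
    unfolding D_def using open_halfspace_Im_gt convex_halfspace_Im_gt
    by (auto intro!: convex_connected convex_Int open_Int)
  have vcont: "continuous_on C v" unfolding v_def B_def C_def
    by (intro continuous_intros cont)
  have compC: "compact C" unfolding C_def
    by (intro compact_Int_closed compact_cball closed_halfspace_Im_ge)
  have DC: "D \<subseteq> C" by (auto simp: D_def C_def)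
  have CD: "v z \<le> 1" if "z \<in> C" "z \<notin> D" for z
  proof (cases "Im z = 0")
    case True
    have "u z \<le> 0" using u0 that True by (auto simp: C_def)
    moreover have "B z \<ge> 0" using True by (simp add: B_def)
    hence "c * B z \<ge> 0" using c by simp
    ultimately show ?thesis by (simp add: v_def)
  next
    case False
    hence Im: "Im z > 0" and d: "dist (of_real x0) z = \<rho>" using that by (auto simp: C_def D_def)
    have sq: "\<rho>\<^sup>2 = (Re z - x0)\<^sup>2 + (Im z)\<^sup>2"
      using d cmod_power2[of "z - of_real x0"] by (simp add: dist_norm norm_minus_commute)
    have "(Im z)\<^sup>2 \<le> \<rho>\<^sup>2" using sq by simp
    hence "Im z \<le> \<rho>" using \<rho> Im by (simp add: power2_le_iff_abs_le)
    hence "Im z * Im z \<le> \<rho> * Im z" using Im by (intro mult_right_mono) auto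
    hence "B z \<ge> \<rho>\<^sup>2" using sq by (simp add: B_def power2_eq_square)
    hence "c * B z \<ge> c * \<rho>\<^sup>2" using c by (intro mult_left_mono)
    hence "c * B z \<ge> M" using \<rho> by (simp add: c_def)
    moreover have "u z \<le> M" using uM that by (auto simp: C_def)
    ultimately show ?thesis by (simp add: v_def)
  qed
  have in_D: "Complex x0 y \<in> D" using y by (simp add: D_def dist_norm cmod_def complex_of_real_def)
  have "v (Complex x0 y) \<le> 1"
  proof (rule maximum_principle_local_norm[OF D _ _ in_D])
    fix w assume "w \<in> D"
    then obtain r where r: "r > 0" "ball w r \<subseteq> D" using D(1) openE by blast
    \<comment> \<open>\<open>B\<close> is the imaginary part of
      \<open>2 * \<rho> * z + \<i> * (z - x0)^2\<close>, and multiplication by \<open>-\<i>\<close>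
      turns imaginary parts into real parts.\<close>
    define K where "K = (\<lambda>z. exp (-\<i> * (H z - of_real c * (of_real (2*\<rho>) * z + \<i> * (z - of_real x0)^2))))"
    have "K holomorphic_on ball w r"
      unfolding K_def by (intro holomorphic_intros holomorphic_on_subset[OF hol]) (use r D_def in auto)
    moreover have "v z = cmod (K z)" if "z \<in> ball w r" for z
    proof -
      have "z \<in> D" using that r by auto
      hence "u z = Im (H z)" using uH by (simp add: D_def)
      thus ?thesis by (simp add: v_def K_def B_def power2_eq_square algebra_simps)
    qed
    ultimately show "\<exists>r>0. \<exists>H. H holomorphic_on ball w r \<and> (\<forall>x\<in>ball w r. v x = cmod (H x))"
      using r by blast
  next
    fix e :: real assume e: "e > 0"
    define K where "K = C \<inter> v -` {1+e..}"
    have "closed K" unfolding K_def using compC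
      by (intro continuous_closed_preimage vcont) (auto simp: compact_imp_closed)
    hence "compact K" using compC by (metis K_def compact_Int_closed inf.idem inf_assoc)
    moreover have "K \<subseteq> D" using CD e by (force simp: K_def)
    moreover have "\<forall>w\<in>D - K. v w \<le> 1 + e" using DC by (auto simp: K_def)
    ultimately show "\<exists>K. compact K \<and> K \<subseteq> D \<and> (\<forall>w\<in>D - K. v w \<le> 1 + e)" by blast
  qed
  hence "u (Complex x0 y) \<le> c * (2 * \<rho> * y - y\<^sup>2)" by (simp add: v_def B_def)
  also have "\<dots> \<le> c * (2 * \<rho> * y)" using c by (intro mult_left_mono) auto
  also have "\<dots> = 2 * M * y / \<rho>" using \<rho> by (simp add: c_def power2_eq_square field_simps)
  finally show ?thesis .
qed

text \<open>Schwarz reflection needs \<open>H\<close> itself to be continuous up to the diameter,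
  but continuity is known only for its imaginary part \<open>u\<close>. The barrier gives
  \<open>u\<close> at most a constant times \<open>Im z\<close>; positivity of \<open>u\<close> then
  bounds the derivative of \<open>H\<close> by \<open>2 * u z / Im z\<close>, so \<open>H\<close> is
  Lipschitz on the smaller half disc and extends to its closure.\<close>

lemma half_disc_reflection:
  fixes u :: "complex \<Rightarrow> real"
  assumes r: "r > 0"
    and cont: "continuous_on (cball 0 r \<inter> {z. 0 \<le> Im z}) u"
    and hol: "H holomorphic_on (ball 0 r \<inter> {z. 0 < Im z})"
    and uH: "\<And>z. z \<in> ball 0 r \<Longrightarrow> 0 < Im z \<Longrightarrow> u z = Im (H z)"
    and pos: "\<And>z. z \<in> ball 0 r \<Longrightarrow> 0 < Im z \<Longrightarrow> u z > 0"
    and u0: "\<And>z. z \<in> cball 0 r \<Longrightarrow> Im z = 0 \<Longrightarrow> u z = 0"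
  obtains F where "F holomorphic_on ball 0 (r/2)" "\<And>z. z \<in> ball 0 (r/2) \<Longrightarrow> F (cnj z) = cnj (F z)"
    "\<And>z. z \<in> ball 0 (r/2) \<Longrightarrow> 0 \<le> Im z \<Longrightarrow> Im (F z) = u z"
proof -
  define C where "C = cball (0::complex) r \<inter> {z. 0 \<le> Im z}"
  define D where "D = ball (0::complex) r \<inter> {z. 0 < Im z}"
  define D' where "D' = ball (0::complex) (r/2) \<inter> {z. 0 < Im z}"
  have compC: "compact C" unfolding C_def
    by (intro compact_Int_closed compact_cball closed_halfspace_Im_ge)
  obtain M where M: "M \<ge> 0" "\<And>z. z \<in> C \<Longrightarrow> u z \<le> M"
  proof -
    have "bounded (u ` C)" using compC cont by (simp add: C_def compact_continuous_image compact_imp_bounded)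
    then obtain M where "\<And>z. z \<in> C \<Longrightarrow> norm (u z) \<le> M" by (auto simp: bounded_iff)
    thus ?thesis by (intro that[of "max M 0"]) force+
  qed
  have opD: "open D" "open D'" and conv: "convex D'"
    unfolding D_def D'_def using open_halfspace_Im_gt convex_halfspace_Im_gt
    by (auto intro!: convex_Int open_Int)
  \<comment> \<open>The barrier is applied in the disc of radius \<open>r/2\<close> about the foot
    point \<open>Re z\<close>, and \<open>deriv_bound_Im_pos\<close> in the disc of radius
    \<open>Im z\<close> about \<open>z\<close>, which just touches the real axis. The factors 4 and
    2 multiply to 8.\<close>
  have lip: "cmod (deriv H z) \<le> 8 * M / r" if z: "z \<in> D'" for z
  proof -
    have Im: "Im z > 0" and nz: "cmod z < r/2" using z by (auto simp: D'_def)
    have Re: "\<bar>Re z\<bar> < r/2" and Im2: "Im z < r/2" using nz abs_Re_le_cmod[of z] abs_Im_le_cmod[of z] by auto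
    have sub: "cball (of_real (Re z)) (r/2) \<subseteq> cball (0::complex) r"
      using Re by (auto simp: cball_subset_cball_iff)
    have sub': "ball (of_real (Re z)) (r/2) \<subseteq> ball (0::complex) r"
      using Re by (auto simp: ball_subset_ball_iff)
    have uz: "u z \<le> 2 * M * Im z / (r/2)"
    proof -
      have "u (Complex (Re z) (Im z)) \<le> 2 * M * Im z / (r/2)"
      proof (rule half_disc_barrier[where H = H])
        show "continuous_on (cball (of_real (Re z)) (r / 2) \<inter> {z. 0 \<le> Im z}) u"
          by (rule continuous_on_subset[OF cont]) (use sub in auto)
        show "H holomorphic_on ball (of_real (Re z)) (r / 2) \<inter> {z. 0 < Im z}"
          by (rule holomorphic_on_subset[OF hol]) (use sub' in auto)
        show "u w = Im (H w)" if "w \<in> ball (of_real (Re z)) (r/2)" "0 < Im w" for w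
          using uH[of w] sub' that by blast
        show "u w \<le> M" if "w \<in> cball (of_real (Re z)) (r/2)" "0 \<le> Im w" for w
          using M(2)[of w] sub that by (auto simp: C_def)
        show "u w \<le> 0" if "w \<in> cball (of_real (Re z)) (r/2)" "Im w = 0" for w
          using u0[of w] sub that by auto
      qed (use r M Im Im2 in auto)
      thus ?thesis by simp
    qed
    have sub2: "ball z (Im z) \<subseteq> D"
    proof
      fix w assume w: "w \<in> ball z (Im z)"
      hence d: "cmod (w - z) < Im z" by (simp add: dist_norm norm_minus_commute)
      have "\<bar>Im w - Im z\<bar> < Im z" using d abs_Im_le_cmod[of "w - z"] by simp
      moreover have "cmod w < r" using norm_triangle_sub[of w z] d Im2 nz by linarith
      ultimately show "w \<in> D" by (auto simp: D_def)
    qed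
    have "cmod (deriv H z) \<le> 2 * Im (H z) / Im z"
    proof (rule deriv_bound_Im_pos)
      show "H holomorphic_on ball z (Im z)" using hol sub2 by (auto simp: D_def intro: holomorphic_on_subset)
      show "Im (H w) > 0" if "w \<in> ball z (Im z)" for w
      proof -
        have "w \<in> D" using sub2 that by blast
        thus ?thesis using uH[of w] pos[of w] by (simp add: D_def)
      qed
    qed (rule Im)
    also have "Im (H z) = u z" using uH nz Im r by simp
    also have "2 * u z / Im z \<le> 2 * (2 * M * Im z / (r/2)) / Im z"
      using uz Im by (intro divide_right_mono mult_left_mono) auto
    also have "\<dots> = 8 * M / r" using Im r by (simp add: field_simps)
    finally show ?thesis .
  qed
  have "D' \<subseteq> D" using r by (auto simp: D'_def D_def)
  hence dH: "(H has_field_derivative deriv H z) (at z within D')" if "z \<in> D'" for z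
    using that holomorphic_derivI[OF hol[folded D_def] opD(1)] by blast
  have "cmod (H x - H y) \<le> 8 * M / r * cmod (x - y)" if "x \<in> D'" "y \<in> D'" for x y
    by (rule field_differentiable_bound[OF conv dH lip]) (use that in auto)
  hence "(8 * M / r)-lipschitz_on D' H"
    using M r by (auto simp: lipschitz_on_def dist_norm)
  hence uc: "uniformly_continuous_on D' H" by (rule lipschitz_on_uniformly_continuous)
  obtain E where E: "uniformly_continuous_on (closure D') E" "\<And>x. x \<in> D' \<Longrightarrow> H x = E x"
    by (rule uniformly_continuous_on_extension_on_closure[OF uc]) (rule that, assumption+)
  define S where "S = ball (0::complex) (r/2)"
  have cl: "S \<inter> {z. 0 \<le> Im z} \<subseteq> closure D'"
  proof
    fix z assume z: "z \<in> S \<inter> {z. 0 \<le> Im z}"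
    have "S \<inter> closure {z. 0 < Im z} \<subseteq> closure (S \<inter> {z. 0 < Im z})"
      by (rule open_Int_closure_subset) (simp add: S_def)
    moreover have "z \<in> closure {z. 0 < Im z}"
    proof -
      have "((\<lambda>t. z + of_real t * \<i>) \<longlongrightarrow> z + of_real 0 * \<i>) (at_right 0)" by (intro tendsto_intros)
      moreover have "\<forall>\<^sub>F t in at_right (0::real). z + of_real t * \<i> \<in> closure {z. 0 < Im z}"
        unfolding eventually_at_right_field using z
        by (intro exI[of _ 1]) (auto intro!: subsetD[OF closure_subset])
      ultimately have "z + of_real 0 * \<i> \<in> closure {z. 0 < Im z}"
        by (intro Lim_in_closed_set[of "closure {z. 0 < Im z}" _ "at_right 0"]) auto
      thus ?thesis by simp
    qed
    ultimately show "z \<in> closure D'" using z by (auto simp: D'_def S_def)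
  qed
  have contE: "continuous_on (closure D') E" using E(1) by (rule uniformly_continuous_imp_continuous)
  have "closure D' \<subseteq> C"
    by (rule closure_minimal) (use r compC in \<open>auto simp: D'_def C_def compact_imp_closed\<close>)
  have ImE: "Im (E z) = u z" if "z \<in> closure D'" for z
  proof -
    have "Im (E z) - u z = 0"
    proof (rule continuous_constant_on_closure[of D' "\<lambda>z. Im (E z) - u z"])
      show "continuous_on (closure D') (\<lambda>z. Im (E z) - u z)"
        using \<open>closure D' \<subseteq> C\<close> cont by (intro continuous_intros contE) (auto simp: C_def intro: continuous_on_subset)
      show "Im (E x) - u x = 0" if "x \<in> D'" for x
        using that E(2)[OF that] uH[of x] subsetD[OF \<open>D' \<subseteq> D\<close> that] by (simp add: D_def)
    qed (use that in auto)
    thus ?thesis by simp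
  qed
  define F where "F = (\<lambda>z. if 0 \<le> Im z then E z else cnj (E (cnj z)))"
  have real: "E z \<in> \<real>" if "z \<in> S" "Im z = 0" for z
    using ImE[of z] cl that u0[of z] r by (auto simp: complex_is_Real_iff S_def)
  have "F holomorphic_on S" unfolding F_def
  proof (rule Schwarz_reflection)
    show "open S" "cnj ` S \<subseteq> S" by (auto simp: S_def)
    have "E holomorphic_on D' \<longleftrightarrow> H holomorphic_on D'" using E by (intro holomorphic_cong) auto
    thus "E holomorphic_on S \<inter> {z. 0 < Im z}" using hol \<open>D' \<subseteq> D\<close>
      by (auto simp: D'_def S_def D_def intro: holomorphic_on_subset)
    show "continuous_on (S \<inter> {z. 0 \<le> Im z}) E" using contE cl by (rule continuous_on_subset)
    show "E z \<in> \<real>" if "z \<in> S" "z \<in> \<real>" for z using real that by (auto simp: complex_is_Real_iff)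
  qed
  moreover have "F (cnj z) = cnj (F z)" if "z \<in> S" for z
  proof (cases "Im z = 0")
    case True
    hence "cnj z = z" by (simp add: complex_eq_iff)
    thus ?thesis using real[OF that True] True by (simp add: F_def Reals_cnj_iff)
  qed (auto simp: F_def)
  moreover have "Im (F z) = u z" if "z \<in> S" "0 \<le> Im z" for z
    using ImE[of z] cl that by (auto simp: F_def)
  ultimately show ?thesis using that by (simp add: S_def)
qed

section \<open>Growth of typically real functions\<close>

lemma deriv_real_of_symmetric:
  assumes hol: "F holomorphic_on ball 0 r" "r > 0" and sym: "\<And>z. z \<in> ball 0 r \<Longrightarrow> F (cnj z) = cnj (F z)"
  shows "Im (deriv F 0) = 0"
proof -
  have d: "(F has_field_derivative deriv F 0) (at 0)"
    by (rule holomorphic_derivI[OF hol(1)]) (use hol in auto)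
  have "((cnj \<circ> F \<circ> cnj) has_field_derivative cnj (deriv F 0)) (at (cnj 0))"
    by (rule has_field_derivative_cnj_cnj) (use d in simp)
  hence "(F has_field_derivative cnj (deriv F 0)) (at 0)"
    by (rule DERIV_cong_ev[THEN iffD1, rotated 3, OF _ ]) 
       (use sym hol in \<open>auto simp: eventually_nhds intro!: exI[of _ "ball 0 r"]\<close>)
  hence "deriv F 0 = cnj (deriv F 0)" using d DERIV_unique by blast
  thus ?thesis by (metis Im_complex_of_real Reals_cases Reals_cnj_iff)
qed

text \<open>Rogosinski's correspondence: a typically real \<open>F\<close> yields a function
  \<open>P\<close> of nonnegative real part with \<open>P 0 = A\<close>, the derivative of
  \<open>F\<close> at 0. Hence the deviation \<open>E\<close> of \<open>F\<close> from its linear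
  part is bounded relative to \<open>A\<close> alone. The factor \<open>Im z\<close> comes from
  comparing \<open>E\<close> at \<open>z\<close> and at \<open>Re z\<close>, where \<open>F\<close>
  is real. The disc of radius 2 leaves room for the unit circle.\<close>

lemma unit_typically_real_growth:
  assumes hol: "F holomorphic_on ball 0 2"
    and sym: "\<And>z. z \<in> ball 0 2 \<Longrightarrow> F (cnj z) = cnj (F z)"
    and pos: "\<And>z. z \<in> ball 0 2 \<Longrightarrow> Im z \<ge> 0 \<Longrightarrow> Im (F z) \<ge> 0"
    and z: "cmod z \<le> 3/8" "Im z \<ge> 0"
  shows "Im (F z) \<le> Re (deriv F 0) * Im z * (1 + 80 * cmod z)"
proof -
  define A where "A = Re (deriv F 0)"
  have dF0: "deriv F 0 = of_real A"
    using deriv_real_of_symmetric[OF hol _ sym] by (simp add: A_def complex_eq_iff)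
  have real: "Im (F w) = 0" if "w \<in> ball 0 2" "Im w = 0" for w
  proof -
    have "cnj w = w" using that by (simp add: complex_eq_iff)
    hence "cnj (F w) = F w" using sym[OF that(1)] by simp
    thus ?thesis by (metis Im_complex_of_real Reals_cases Reals_cnj_iff)
  qed
  define Q where "Q = (\<lambda>w. if w = 0 then deriv F 0 else (F w - F 0) / (w - 0))"
  have holQ: "Q holomorphic_on ball 0 2" unfolding Q_def
    by (rule pole_lemma_open[OF hol]) auto
  \<comment> \<open>On the unit circle \<open>(1 - w\<^sup>2) / w = - 2 \<i> Im w\<close>, which makes the real part of \<open>P\<close> nonnegative there.\<close>
  define P where "P = (\<lambda>w. (1 - w^2) * Q w)"
  have holP: "P holomorphic_on ball 0 2" unfolding P_def by (intro holomorphic_intros holQ)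
  have sphere: "Re (P w) \<ge> 0" if w: "cmod w = 1" for w
  proof -
    have w0: "w \<noteq> 0" using w by auto
    have "w * cnj w = 1" using w by (simp add: complex_norm_square[symmetric])
    hence "1 - w^2 = w * (cnj w - w)" by (simp add: power2_eq_square algebra_simps)
    also have "cnj w - w = - 2 * \<i> * of_real (Im w)" by (simp add: complex_eq_iff)
    finally have "P w = - 2 * \<i> * of_real (Im w) * (F w - F 0)"
      using w0 by (simp add: P_def Q_def)
    hence "Re (P w) = 2 * (Im w * Im (F w))" using real[of 0] by simp
    moreover have "Im w * Im (F w) \<ge> 0"
    proof (cases "Im w \<ge> 0")
      case True thus ?thesis using pos[of w] w by simp
    next
      case False
      hence "Im (F (cnj w)) \<ge> 0" using pos[of "cnj w"] w by simp
      hence "Im (F w) \<le> 0" using sym[of w] w by simp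
      thus ?thesis using False by (simp add: mult_nonpos_nonpos)
    qed
    ultimately show ?thesis by simp
  qed
  have RP: "Re (P w) \<ge> 0" if "w \<in> ball 0 1" for w
  proof -
    have "cmod (exp (- P w)) \<le> 1"
    proof (rule maximum_modulus_frontier[where S = "ball 0 1" and f = "\<lambda>w. exp (- P w)"])
      show "(\<lambda>w. exp (- P w)) holomorphic_on interior (ball 0 1)"
        by (intro holomorphic_intros holomorphic_on_subset[OF holP]) auto
      have "continuous_on (cball 0 1) P"
        by (rule continuous_on_subset[OF holomorphic_on_imp_continuous_on[OF holP]]) auto
      thus "continuous_on (closure (ball 0 1)) (\<lambda>w. exp (- P w))"
        by (auto intro!: continuous_intros)
      show "cmod (exp (- P w)) \<le> 1" if "w \<in> frontier (ball 0 1)" for w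
        using sphere[of w] that by simp
    qed (use that in auto)
    thus ?thesis by simp
  qed
  have P0: "P 0 = of_real A" by (simp add: P_def Q_def dF0)
  have A0: "A \<ge> 0" using RP[of 0] P0 by simp
  have growth: "cmod (P w - of_real A) \<le> 8 * cmod w * A" if "cmod w \<le> 3/4" for w
  proof -
    have "cmod (P w - of_real A) \<le> 2 * cmod w * A / (1 - cmod w)"
      by (rule Re_nonneg_growth[of P]) (use that RP P0 in \<open>auto intro: holomorphic_on_subset[OF holP]\<close>)
    also have "\<dots> \<le> 2 * cmod w * A / (1/4)"
      using that A0 by (intro divide_left_mono) auto
    finally show ?thesis by (simp add: field_simps)
  qed
  define E where "E = (\<lambda>w. F w - F 0 - of_real A * w)"
  \<comment> \<open>The radius 3/4 is twice the 3/8 allowed for \<open>z\<close>, as the Cauchy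
    estimate below requires. The constant is \<open>(8 + 3/4) / (7/16) = 20\<close>.\<close>
  have E: "cmod (E w) \<le> 20 * A * (cmod w)\<^sup>2" if "cmod w \<le> 3/4" for w
  proof (cases "w = 0")
    case False
    have "(cmod w)\<^sup>2 \<le> (3/4)\<^sup>2" using that by (intro power_mono) auto
    hence w2: "cmod (w^2) \<le> 9/16" by (simp add: norm_mult power2_eq_square)
    have low: "cmod (1 - w^2) \<ge> 7/16"
      using norm_triangle_ineq2[of 1 "w^2"] w2 by simp
    hence nz: "1 - w^2 \<noteq> 0" by auto
    have "P w / (1 - w^2) = (F w - F 0) / w" using nz False by (simp add: P_def Q_def)
    hence "E w = w * (P w / (1 - w^2) - of_real A)"
      using False by (simp add: E_def field_simps)
    also have "P w / (1 - w^2) - of_real A = (P w - of_real A + of_real A * w^2) / (1 - w^2)"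
      using nz by (simp add: field_simps)
    finally have "cmod (E w) = cmod w * (cmod (P w - of_real A + of_real A * w^2) / cmod (1 - w^2))"
      by (simp add: norm_mult norm_divide)
    also have "\<dots> \<le> cmod w * ((8 * cmod w * A + A * cmod w * (3/4)) / (7/16))"
    proof (intro mult_left_mono frac_le)
      have "cmod (P w - of_real A + of_real A * w^2) \<le> 8 * cmod w * A + A * (cmod w * cmod w)"
        using growth[OF that] A0
        by (intro order.trans[OF norm_triangle_ineq] add_mono) (auto simp: norm_mult norm_power power2_eq_square)
      also have "\<dots> \<le> 8 * cmod w * A + A * (cmod w * (3/4))"
        using A0 that by (intro add_mono mult_left_mono) auto
      finally show "cmod (P w - of_real A + of_real A * w^2) \<le> 8 * cmod w * A + A * cmod w * (3/4)" by simp
    qed (use low A0 in auto)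
    also have "\<dots> \<le> 20 * A * (cmod w)\<^sup>2" using A0 by (simp add: power2_eq_square field_simps)
    finally show ?thesis .
  qed (simp add: E_def)
  have holE: "E holomorphic_on ball 0 2" unfolding E_def by (intro holomorphic_intros hol)
  \<comment> \<open>Cauchy's estimate on the circle about \<open>w\<close> through the origin. It
    stays within modulus \<open>2 * cmod w\<close>, where \<open>E\<close> is at most
    \<open>80 * A * (cmod w)^2\<close>; division by the radius \<open>cmod w\<close> leaves the
    constant 80.\<close>
  have dE: "cmod (deriv E w) \<le> 80 * A * cmod z" if w: "cmod w \<le> cmod z" for w
  proof (cases "w = 0")
    case True
    have "(F has_field_derivative of_real A) (at 0)"
      using holomorphic_derivI[OF hol, of 0] dF0 by simp
    hence "(E has_field_derivative 0) (at 0)"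
      unfolding E_def by (auto intro!: derivative_eq_intros)
    hence "deriv E w = 0" using True by (simp add: DERIV_imp_deriv)
    thus ?thesis using A0 by simp
  next
    case False
    have "cmod ((deriv ^^ 1) E w) \<le> fact 1 * (20 * A * (2 * cmod w)\<^sup>2) / cmod w ^ 1"
    proof (rule Cauchy_inequality)
      have sub: "cball w (cmod w) \<subseteq> ball 0 2" using w z
        by (auto simp: cball_subset_ball_iff)
      thus "E holomorphic_on ball w (cmod w)"
        by (intro holomorphic_on_subset[OF holE]) (auto simp: subset_iff)
      show "continuous_on (cball w (cmod w)) E"
        by (rule continuous_on_subset[OF holomorphic_on_imp_continuous_on[OF holE] sub])
      show "cmod (E x) \<le> 20 * A * (2 * cmod w)\<^sup>2" if "cmod (w - x) = cmod w" for x
      proof -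
        have x: "cmod x \<le> 2 * cmod w" using norm_triangle_ineq4[of w "w - x"] that by simp
        hence "cmod (E x) \<le> 20 * A * (cmod x)\<^sup>2" using w z by (intro E) auto
        also have "\<dots> \<le> 20 * A * (2 * cmod w)\<^sup>2" using x A0 by (intro mult_left_mono power_mono) auto
        finally show ?thesis .
      qed
    qed (use False in auto)
    also have "\<dots> = 80 * A * cmod w" using False by (simp add: power2_eq_square field_simps)
    also have "\<dots> \<le> 80 * A * cmod z" using A0 w by (intro mult_left_mono) auto
    finally show ?thesis by simp
  qed
  have z2: "z \<in> ball 0 2" using z by simp
  have xz: "cmod (of_real (Re z)) \<le> cmod z" by (simp add: abs_Re_le_cmod)
  have "cmod (E z - E (of_real (Re z))) \<le> 80 * A * cmod z * cmod (z - of_real (Re z))"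
  proof (rule field_differentiable_bound[where S = "cball 0 (cmod z)"])
    show "(E has_field_derivative deriv E w) (at w within cball 0 (cmod z))" if "w \<in> cball 0 (cmod z)" for w
      by (rule has_field_derivative_at_within, rule holomorphic_derivI[OF holE]) (use that z in auto)
  qed (use dE xz in auto)
  also have "z - of_real (Re z) = \<i> * of_real (Im z)" by (simp add: complex_eq_iff)
  also have "cmod (\<i> * of_real (Im z)) = Im z" using z by (simp add: norm_mult)
  finally have 1: "cmod (E z - E (of_real (Re z))) \<le> 80 * A * cmod z * Im z" .
  have "Im (F (of_real (Re z))) = 0"
    by (rule real) (use xz z in auto)
  hence "Im (F z) = Im (E z - E (of_real (Re z))) + A * Im z"
    by (simp add: E_def)
  also have "\<dots> \<le> 80 * A * cmod z * Im z + A * Im z"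
    using 1 abs_Im_le_cmod[of "E z - E (of_real (Re z))"] by linarith
  finally show ?thesis by (simp add: A_def algebra_simps)
qed

text \<open>The unit case under the substitution \<open>z = (r/2) * w\<close>, which turns 3/8 into
  \<open>r * (3/16)\<close> and 80 into \<open>160 / r\<close>.\<close>

lemma typically_real_growth:
  assumes r: "r > 0" and hol: "F holomorphic_on ball 0 r"
    and sym: "\<And>z. z \<in> ball 0 r \<Longrightarrow> F (cnj z) = cnj (F z)"
    and pos: "\<And>z. z \<in> ball 0 r \<Longrightarrow> Im z \<ge> 0 \<Longrightarrow> Im (F z) \<ge> 0"
    and z: "cmod z \<le> r * (3/16)" "Im z \<ge> 0"
  shows "Im (F z) \<le> Re (deriv F 0) * Im z * (1 + 160 * cmod z / r)"
proof -
  define F1 where "F1 = (\<lambda>z. F (of_real (r/2) * z))"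
  define w where "w = z / of_real (r/2)"
  have zw: "z = of_real (r/2) * w" using r by (simp add: w_def)
  have inb: "of_real (r/2) * w \<in> ball 0 r" if "w \<in> ball 0 2" for w :: complex
  proof -
    have "r / 2 * cmod w < r / 2 * 2" using that r by (intro mult_strict_left_mono) auto
    thus ?thesis using r by (simp add: norm_mult norm_divide)
  qed
  have "(F \<circ> (\<lambda>z. of_real (r/2) * z)) holomorphic_on ball 0 2"
    by (rule holomorphic_on_compose_gen[OF _ hol]) (use inb in \<open>auto intro!: holomorphic_intros\<close>)
  hence hol1: "F1 holomorphic_on ball 0 2" by (simp add: F1_def o_def)
  have "(F has_field_derivative deriv F 0) (at 0)" by (rule holomorphic_derivI[OF hol]) (use r in auto)
  hence "(F1 has_field_derivative deriv F 0 * of_real (r/2)) (at 0)"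
    unfolding F1_def by (intro DERIV_chain2[where f = F]) (auto intro!: derivative_eq_intros)
  hence d: "deriv F1 0 = deriv F 0 * of_real (r/2)" by (rule DERIV_imp_deriv)
  have "Im (F1 w) \<le> Re (deriv F1 0) * Im w * (1 + 80 * cmod w)"
  proof (rule unit_typically_real_growth[OF hol1])
    show "F1 (cnj z) = cnj (F1 z)" if "z \<in> ball 0 2" for z
      using sym[OF inb[OF that]] by (simp add: F1_def)
    show "Im (F1 z) \<ge> 0" if "z \<in> ball 0 2" "Im z \<ge> 0" for z
      unfolding F1_def using that r by (intro pos inb) auto
  qed (use z r in \<open>auto simp: w_def norm_divide divide_simps\<close>)
  moreover have "Re (deriv F1 0) * Im w = Re (deriv F 0) * Im z"
    using r by (simp add: d w_def)
  moreover have "80 * cmod w = 160 * cmod z / r" using r by (simp add: w_def norm_divide)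
  moreover have "F1 w = F z" unfolding F1_def zw ..
  ultimately show ?thesis by simp
qed

section \<open>A local Bernstein inequality\<close>

text \<open>The circle meets the real axis at \<open>pi * N\<close> and \<open>- pi * N\<close>,
  midway between consecutive zeros of the cosine. Away from the axis the term \<open>sinh\<close> in
  the formula for the modulus is enough.\<close>

lemma cos_lower_bound_circle:
  fixes z :: complex
  assumes N: "N \<ge> 1" and z: "cmod z = pi * of_nat N"
  shows "exp \<bar>Im z\<bar> \<le> 6 * cmod (cos z)"
proof -
  have sq: "(cmod (cos z))\<^sup>2 = (cos (Re z))\<^sup>2 + (sinh (Im z))\<^sup>2"
  proof -
    have "(cmod (cos z))\<^sup>2 = (cos (Re z) * cosh (Im z))\<^sup>2 + (sin (Re z) * sinh (Im z))\<^sup>2"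
      unfolding cmod_power2
      by (simp add: Re_cos Im_cos cosh_def sinh_def power2_eq_square field_simps exp_minus scaleR_conv_of_real)
    also have "\<dots> = (cos (Re z))\<^sup>2 + (sinh (Im z))\<^sup>2"
      using cosh_square_eq[of "Im z"] sin_cos_squared_add[of "Re z"]
      unfolding power_mult_distrib by algebra
    finally show ?thesis .
  qed
  show ?thesis
  proof (cases "\<bar>Im z\<bar> \<ge> 1")
    case True
    have "(sinh \<bar>Im z\<bar>)\<^sup>2 \<le> (cmod (cos z))\<^sup>2" using sq by (simp add: sinh_real_abs)
    hence 1: "sinh \<bar>Im z\<bar> \<le> cmod (cos z)" by (rule power2_le_imp_le) simp
    have e2: "exp \<bar>Im z\<bar> \<ge> 2" using True exp_ge_add_one_self[of "\<bar>Im z\<bar>"] by linarith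
    have "exp (- \<bar>Im z\<bar>) \<le> 1/2" using e2 by (simp add: exp_minus field_simps)
    hence "sinh \<bar>Im z\<bar> \<ge> exp \<bar>Im z\<bar> / 4"
      using e2 unfolding sinh_def by simp
    thus ?thesis using 1 by (simp add: field_simps)
  next
    case False
    \<comment> \<open>With \<open>\<bar>Im z\<bar> < 1\<close> the real part is, up to sign, within
      \<open>1 < pi/3\<close> of \<open>pi * N\<close>, so the cosine there is at least 1/2.
      Together with \<open>exp 1 \<le> 3\<close> this is where the factor 6 arises.\<close>
    define x where "x = \<bar>Re z\<bar>"
    have x2: "x\<^sup>2 + (Im z)\<^sup>2 = (pi * N)\<^sup>2" using z cmod_power2[of z] by (simp add: x_def)
    have "(Im z)\<^sup>2 \<le> 1" using False by (simp add: abs_square_le_1)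
    have piN: "pi * N \<ge> 3" using pi_gt3 N
      by (metis dual_order.trans less_eq_real_def mult.right_neutral mult_left_mono of_nat_1 of_nat_le_iff pi_ge_zero)
    have "(pi * N - 1)\<^sup>2 \<le> x\<^sup>2"
      using x2 \<open>(Im z)\<^sup>2 \<le> 1\<close> piN by (simp add: power2_eq_square algebra_simps)
    hence xlow: "pi * N - 1 \<le> x" by (rule power2_le_imp_le) (simp add: x_def)
    have "x\<^sup>2 \<le> (pi * N)\<^sup>2" using x2 by (metis le_add_same_cancel1 zero_le_power2)
    hence xup: "x \<le> pi * N" by (rule power2_le_imp_le) (use piN in simp)
    have "cos (pi * N - x) \<ge> cos (pi/3)"
      using xlow xup pi_gt3 by (intro cos_monotone_0_pi_le) auto
    hence c: "cos (pi * N - x) \<ge> 1/2" by (simp add: cos_60)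
    have "cos (pi * N - x) = (-1) ^ N * cos x"
      by (simp add: cos_diff mult.commute[of pi])
    hence "\<bar>cos (pi * N - x)\<bar> = \<bar>cos x\<bar>" by (simp add: abs_mult power_abs)
    hence "\<bar>cos x\<bar> \<ge> 1/2" using c by linarith
    hence "\<bar>cos (Re z)\<bar> \<ge> 1/2" by (simp add: x_def)
    hence "(1/2)\<^sup>2 \<le> (cos (Re z))\<^sup>2" by (metis abs_le_square_iff abs_of_nonneg divide_nonneg_nonneg zero_le_one zero_le_numeral)
    hence "(1/2)\<^sup>2 \<le> (cmod (cos z))\<^sup>2" using sq by (metis add_increasing2 zero_le_power2)
    hence "1/2 \<le> cmod (cos z)" by (rule power2_le_imp_le) simp
    moreover have "exp \<bar>Im z\<bar> \<le> 3" using False exp_le by (meson exp_le_cancel_iff less_eq_real_def not_le order_trans)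
    ultimately show ?thesis by simp
  qed
qed

text \<open>The index range from \<open>-N\<close> to \<open>N - 1\<close> makes the set symmetric:
  these are the \<open>2 * N\<close> zeros inside the circle of radius
  \<open>pi * N\<close>.\<close>

definition cos_zeros :: "nat \<Rightarrow> complex set" where
  "cos_zeros N = (\<lambda>k::int. of_real (of_int k * pi + pi/2)) ` {- int N..<int N}"

text \<open>The residue theorem for \<open>G z / (z^2 * cos z)\<close> on the circle of radius
  \<open>pi * N\<close>. Dividing by the cosine cancels the growth
  \<open>exp \<bar>Im z\<bar>\<close> on the circle, so the integrand is at most
  \<open>6 * M / (pi * N)^2\<close> there; times the length and divided by \<open>2 * pi\<close>
  this is the remainder.\<close>

lemma interpolation_residues:
  assumes N: "N \<ge> 1" and R: "R > pi * N" and hol: "G holomorphic_on ball 0 R"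
    and bound: "\<And>z. cmod z = pi * N \<Longrightarrow> cmod (G z) \<le> M * exp \<bar>Im z\<bar>" and M: "M \<ge> 0"
  shows "cmod (deriv G 0 - (\<Sum>\<xi>\<in>cos_zeros N. G \<xi> / (\<xi>\<^sup>2 * sin \<xi>))) \<le> 6 * M / (pi * N)"
proof -
  \<comment> \<open>The margin 1 is less than \<open>pi/2\<close>, the distance from the circle to
    the next zeros, so the only zeros of the cosine in \<open>S\<close> are those in
    \<open>X\<close>.\<close>
  define R' where "R' = min R (pi * N + 1)"
  define S where "S = ball (0::complex) R'"
  define X where "X = cos_zeros N"
  have piN: "pi * N \<ge> 3" using pi_gt3 N
    by (metis dual_order.trans less_eq_real_def mult.right_neutral mult_left_mono of_nat_1 of_nat_le_iff pi_ge_zero)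
  have R': "R' > pi * N" "R' \<le> R" "R' \<le> pi * N + 1" using R by (auto simp: R'_def)
  have finX: "finite X" by (simp add: X_def cos_zeros_def)
  have Xin: "cmod \<xi> < pi * N" and X0: "\<xi> \<noteq> 0" and Xcos: "cos \<xi> = 0" if xX: "\<xi> \<in> X" for \<xi>
  proof -
    obtain k :: int where k: "- int N \<le> k" "k < int N" "\<xi> = of_real (of_int k * pi + pi/2)"
      using xX unfolding X_def cos_zeros_def by (auto simp del: of_real_add of_real_mult)
    have k1: "real_of_int k \<le> real N - 1" using k(2) by linarith
    have k2: "real_of_int k \<ge> - real N" using k(1) by linarith
    have "real_of_int k * pi \<le> (real N - 1) * pi" "real_of_int k * pi \<ge> (- real N) * pi" 
      using k1 k2 by (intro mult_right_mono; simp)+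
    hence "\<bar>of_int k * pi + pi/2\<bar> < pi * N"
      by (simp only: abs_less_iff algebra_simps) (intro conjI; use pi_gt_zero in linarith)
    thus "cmod \<xi> < pi * N" unfolding k(3) norm_of_real .
    have "sin (of_int k * pi) = 0" by (auto simp: sin_zero_iff_int2)
    hence "cos (of_int k * pi + pi/2) = 0" by (simp add: cos_add)
    thus "cos \<xi> = 0" unfolding k(3) cos_of_real by simp
    thus "\<xi> \<noteq> 0" by auto
  qed
  have zeros: "z \<in> X" if "z \<in> S" "cos z = 0" for z
  proof -
    obtain n :: int where n: "z = of_real (of_int n * pi + pi/2)"
      using \<open>cos z = 0\<close> unfolding cos_eq_0 by auto
    hence "\<bar>of_int n * pi + pi/2\<bar> < pi * N + 1"
      using that R' by (simp add: S_def del: of_real_add of_real_mult)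
    hence "pi * (of_int n + 1/2) < pi * N + 1" "- (pi * (of_int n + 1/2)) < pi * N + 1"
      by (auto simp: algebra_simps abs_less_iff)
    hence "pi * (of_int n + 1/2 - N) < pi * (1/2)" "pi * (- of_int n - 1/2 - N) < pi * (1/2)"
      by (simp_all only: algebra_simps) (use pi_gt3 in linarith)+
    hence "of_int n + 1/2 - real N < 1/2" "- of_int n - 1/2 - real N < 1/2"
      using mult_less_cancel_left_pos[OF pi_gt_zero] by blast+
    hence "n < int N" "- int N \<le> n" by linarith+
    thus ?thesis unfolding X_def cos_zeros_def n by auto
  qed
  define f where "f = (\<lambda>z. G z / (z\<^sup>2 * cos z))"
  have holG: "G holomorphic_on S" using R' by (intro holomorphic_on_subset[OF hol]) (auto simp: S_def)
  have holf: "f holomorphic_on S - insert 0 X"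
    unfolding f_def using zeros by (intro holomorphic_intros holomorphic_on_subset[OF holG]) auto
  have 0: "0 \<notin> X" using X0 by auto
  have "contour_integral (circlepath 0 (pi * N)) f
      = 2 * pi * \<i> * (\<Sum>p\<in>insert 0 X. winding_number (circlepath 0 (pi * N)) p * residue f p)"
  proof (rule Residue_theorem)
    show "open S" "connected S" "finite (insert 0 X)" using finX by (auto simp: S_def)
    show "f holomorphic_on S - insert 0 X" by (rule holf)
    show "path_image (circlepath 0 (pi * N)) \<subseteq> S - insert 0 X"
      using Xin R' piN by (fastforce simp: S_def)
    show "\<forall>z. z \<notin> S \<longrightarrow> winding_number (circlepath 0 (pi * real N)) z = 0"
      using R' by (auto intro!: winding_number_zero_outside[of _ "cball 0 (pi * N)"] simp: S_def piN)
  qed auto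
  also have "(\<Sum>p\<in>insert 0 X. winding_number (circlepath 0 (pi * N)) p * residue f p) = (\<Sum>p\<in>insert 0 X. residue f p)"
    using Xin piN by (intro sum.cong) (auto simp: winding_number_circlepath)
  also have "\<dots> = residue f 0 + (\<Sum>p\<in>X. residue f p)" using finX 0 by simp
  \<comment> \<open>A double pole: the residue is the derivative of \<open>G z / cos z\<close> at 0,
    and the cosine has value 1 and derivative 0 there.\<close>
  also have "residue f 0 = deriv G 0"
  proof -
    define B where "B = ball (0::complex) 1"
    have cosnz: "cos z \<noteq> 0" if "z \<in> B" for z
    proof
      assume "cos z = 0"
      moreover have "z \<in> S" using that R' piN by (simp add: S_def B_def)
      ultimately have "z \<in> X" by (rule zeros[rotated])
      then obtain k :: int where k: "z = of_real (of_int k * pi + pi/2)"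
        unfolding X_def cos_zeros_def by (auto simp del: of_real_add of_real_mult)
      have "\<bar>of_int k * pi + pi/2\<bar> < 1" using that unfolding B_def k by (simp del: of_real_add of_real_mult)
      hence "\<bar>(2 * of_int k + 1) * pi\<bar> < 2" by (simp add: abs_less_iff algebra_simps)
      moreover have "\<bar>2 * k + 1\<bar> \<ge> 1" by presburger
      hence "\<bar>2 * real_of_int k + 1\<bar> \<ge> 1" by linarith
      hence "\<bar>(2 * of_int k + 1) * pi\<bar> \<ge> 1 * pi" unfolding abs_mult by (intro mult_mono) auto
      ultimately show False using pi_gt3 by linarith
    qed
    have hB: "(\<lambda>z. G z / cos z) holomorphic_on B" using cosnz R' piN
      by (intro holomorphic_intros holomorphic_on_subset[OF holG]) (auto simp: S_def B_def)
    have "residue (\<lambda>z. (G z / cos z) / z ^ Suc 1) 0 = (deriv ^^ 1) (\<lambda>z. G z / cos z) 0 / fact 1"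
      by (rule residue_holomorphic_over_power'[of B]) (use hB in \<open>auto simp: B_def\<close>)
    also have "(\<lambda>z. (G z / cos z) / z ^ Suc 1) = f" by (simp add: f_def fun_eq_iff power2_eq_square mult_ac)
    also have "(deriv ^^ 1) (\<lambda>z. G z / cos z) 0 = deriv G 0"
    proof -
      have "(G has_field_derivative deriv G 0) (at 0)"
        by (rule holomorphic_derivI[OF holG]) (use R' piN in \<open>auto simp: S_def\<close>)
      hence "((\<lambda>z. G z / cos z) has_field_derivative deriv G 0) (at 0)"
        by (auto intro!: derivative_eq_intros)
      thus ?thesis by (simp add: DERIV_imp_deriv)
    qed
    finally show ?thesis by simp
  qed
  also have "(\<Sum>p\<in>X. residue f p) = (\<Sum>\<xi>\<in>X. - (G \<xi> / (\<xi>\<^sup>2 * sin \<xi>)))"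
  proof (rule sum.cong[OF refl])
    fix \<xi> assume x: "\<xi> \<in> X"
    have sinnz: "sin \<xi> \<noteq> 0" using Xcos[OF x] sin_cos_squared_add[of \<xi>] by auto
    have xS: "\<xi> \<in> S" using Xin[OF x] R' by (simp add: S_def)
    have opn: "open (S - (insert 0 X - {\<xi>}))" using finX by (intro open_Diff) (auto simp: S_def finite_imp_closed)
    show "residue f \<xi> = - (G \<xi> / (\<xi>\<^sup>2 * sin \<xi>))"
    proof (rule residue_simple'[OF opn])
      show "\<xi> \<in> S - (insert 0 X - {\<xi>})" using xS by auto
      show "f holomorphic_on S - (insert 0 X - {\<xi>}) - {\<xi>}" by (rule holomorphic_on_subset[OF holf]) auto
      have "((\<lambda>w. (cos w - cos \<xi>) / (w - \<xi>)) \<longlongrightarrow> - sin \<xi>) (at \<xi>)"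
        using DERIV_cos[of \<xi>] by (simp add: has_field_derivative_iff)
      hence c: "((\<lambda>w. cos w / (w - \<xi>)) \<longlongrightarrow> - sin \<xi>) (at \<xi>)" using Xcos[OF x] by simp
      have "isCont G \<xi>" using holG xS by (metis S_def continuous_on_interior holomorphic_on_imp_continuous_on interior_open open_ball)
      hence g: "(G \<longlongrightarrow> G \<xi>) (at \<xi>)" by (simp add: isCont_def)
      have "((\<lambda>w. G w / (w\<^sup>2 * (cos w / (w - \<xi>)))) \<longlongrightarrow> G \<xi> / (\<xi>\<^sup>2 * (- sin \<xi>))) (at \<xi>)"
        using sinnz X0[OF x] by (intro tendsto_intros g c) auto
      thus "((\<lambda>w. f w * (w - \<xi>)) \<longlongrightarrow> - (G \<xi> / (\<xi>\<^sup>2 * sin \<xi>))) (at \<xi>)"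
        by (simp add: f_def)
    qed
  qed
  finally have CI: "contour_integral (circlepath 0 (pi * N)) f = 2 * pi * \<i> * (deriv G 0 - (\<Sum>\<xi>\<in>X. G \<xi> / (\<xi>\<^sup>2 * sin \<xi>)))"
    by (simp add: sum_negf)
  have "f contour_integrable_on circlepath 0 (pi * N)"
    by (rule contour_integrable_holomorphic_simple[OF holf])
       (use finX Xin R' piN in \<open>force simp: S_def finite_imp_closed intro!: open_Diff\<close>)+
  hence "(f has_contour_integral contour_integral (circlepath 0 (pi * N)) f) (circlepath 0 (pi * N))"
    by (rule has_contour_integral_integral)
  hence "cmod (contour_integral (circlepath 0 (pi * N)) f) \<le> (6 * M / (pi * N)\<^sup>2) * (2 * pi * (pi * N))"
  proof (rule has_contour_integral_bound_circlepath)
    show "cmod (f z) \<le> 6 * M / (pi * N)\<^sup>2" if "cmod (z - 0) = pi * N" for z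
    proof -
      have zn: "cmod z = pi * N" using that by simp
      have low: "exp \<bar>Im z\<bar> \<le> 6 * cmod (cos z)" by (rule cos_lower_bound_circle[OF N zn])
      have cpos: "cmod (cos z) > 0" using low by (smt (verit) exp_gt_zero norm_ge_zero)
      have "cmod (G z) \<le> M * exp \<bar>Im z\<bar>" by (rule bound[OF zn])
      also have "\<dots> \<le> M * (6 * cmod (cos z))" using low M by (rule mult_left_mono)
      finally have "cmod (G z) / cmod (cos z) \<le> 6 * M" using cpos by (simp add: field_simps)
      hence "cmod (G z) / cmod (cos z) / (pi * N)\<^sup>2 \<le> 6 * M / (pi * N)\<^sup>2"
        by (rule divide_right_mono) simp
      thus ?thesis by (simp add: f_def norm_divide norm_mult norm_power zn mult.commute)
    qed
  qed (use M piN in auto)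
  hence "2 * pi * cmod (deriv G 0 - (\<Sum>\<xi>\<in>X. G \<xi> / (\<xi>\<^sup>2 * sin \<xi>))) \<le> (6 * M / (pi * N)\<^sup>2) * (2 * pi * (pi * N))"
    unfolding CI by (simp add: norm_mult)
  hence "2 * pi * cmod (deriv G 0 - (\<Sum>\<xi>\<in>X. G \<xi> / (\<xi>\<^sup>2 * sin \<xi>))) \<le> 2 * pi * (6 * M / (pi * N))"
    using piN N by (simp add: power2_eq_square field_simps)
  thus ?thesis unfolding X_def by (rule mult_left_le_imp_le) simp
qed

text \<open>At the nodes, which are real, the exponential factor is 1 and the sine has modulus 1.
  Thus the sum is at most \<open>M\<close> times the total weight, and only the remainder feels the
  growth off the axis. Total weight and remainder each contribute an error
  \<open>6 / (pi * N)\<close>.\<close>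

lemma local_bernstein:
  fixes N :: nat
  assumes N: "N \<ge> 1" and R: "R > pi * N" and hol: "G holomorphic_on ball 0 R"
    and bound: "\<And>z. z \<in> ball 0 R \<Longrightarrow> cmod (G z) \<le> M * exp \<bar>Im z\<bar>" 
  shows "cmod (deriv G 0) \<le> M * (1 + 12 / (pi * N))"
proof -
  have piN: "pi * N > 0" using N by simp
  have Mpos: "M \<ge> 0" using bound[of 0] R piN by (auto intro: order.trans[OF norm_ge_zero])
  define X where "X = cos_zeros N"
  have X: "\<exists>x::real. \<xi> = of_real x \<and> \<bar>sin x\<bar> = 1 \<and> \<bar>x\<bar> < R \<and> x \<noteq> 0" if xX: "\<xi> \<in> X" for \<xi>
  proof -
    obtain k :: int where k: "- int N \<le> k" "k < int N" "\<xi> = of_real (of_int k * pi + pi/2)"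
      using xX unfolding X_def cos_zeros_def by (auto simp del: of_real_add of_real_mult)
    define x where "x = of_int k * pi + pi/2"
    have k1: "real_of_int k \<le> real N - 1" using k(2) by linarith
    have k2: "real_of_int k \<ge> - real N" using k(1) by linarith
    have "real_of_int k * pi \<le> (real N - 1) * pi" "real_of_int k * pi \<ge> (- real N) * pi" 
      using k1 k2 by (intro mult_right_mono; simp)+
    hence "\<bar>x\<bar> < pi * N"
      by (simp only: x_def abs_less_iff algebra_simps) (intro conjI; use pi_gt_zero in linarith)
    moreover have "sin (of_int k * pi) = 0" by (auto simp: sin_zero_iff_int2)
    hence "cos x = 0" by (simp add: cos_add x_def)
    hence "\<bar>sin x\<bar> = 1" using sin_cos_squared_add[of x] by (auto simp: power2_eq_1_iff)
    moreover have "x \<noteq> 0" using \<open>cos x = 0\<close> by auto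
    ultimately show ?thesis using R k(3) unfolding x_def[symmetric] by (intro exI[of _ x]) auto
  qed
  \<comment> \<open>Applying the formula to \<open>sin\<close>, the extremal function, evaluates the sum of the weights.\<close>
  have sumX: "(\<Sum>\<xi>\<in>X. 1 / (cmod \<xi>)\<^sup>2) \<le> 1 + 6 / (pi * N)"
  proof -
    have "cmod (deriv sin 0 - (\<Sum>\<xi>\<in>X. sin \<xi> / (\<xi>\<^sup>2 * sin \<xi>))) \<le> 6 * 1 / (pi * N)"
      unfolding X_def
    proof (rule interpolation_residues[OF N R])
      show "cmod (sin z) \<le> 1 * exp \<bar>Im z\<bar>" for z
      proof -
        have "cmod (exp (\<i> * z) - exp (- (\<i> * z))) \<le> exp \<bar>Im z\<bar> + exp \<bar>Im z\<bar>"
          by (rule order.trans[OF norm_triangle_ineq4], rule add_mono) auto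
        thus ?thesis by (simp add: sin_exp_eq norm_divide norm_mult)
      qed
    qed (auto intro!: holomorphic_intros)
    moreover have "deriv sin (0::complex) = 1" using DERIV_sin[of "0::complex"] by (simp add: DERIV_imp_deriv)
    moreover have "(\<Sum>\<xi>\<in>X. sin \<xi> / (\<xi>\<^sup>2 * sin \<xi>)) = of_real (\<Sum>\<xi>\<in>X. 1 / (cmod \<xi>)\<^sup>2)"
      unfolding of_real_sum
    proof (rule sum.cong[OF refl])
      fix \<xi> assume "\<xi> \<in> X"
      then obtain x where x: "\<xi> = of_real x" "\<bar>sin x\<bar> = 1" using X by blast
      have "sin \<xi> = of_real (sin x)" using x by (simp add: sin_of_real)
      hence "sin \<xi> \<noteq> 0" using x by auto
      thus "sin \<xi> / (\<xi>\<^sup>2 * sin \<xi>) = of_real (1 / (cmod \<xi>)\<^sup>2)" using x by simp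
    qed
    ultimately have "cmod (of_real (1 - (\<Sum>\<xi>\<in>X. 1 / (cmod \<xi>)\<^sup>2))) \<le> 6 / (pi * N)" by simp
    hence "\<bar>1 - (\<Sum>\<xi>\<in>X. 1 / (cmod \<xi>)\<^sup>2)\<bar> \<le> 6 / (pi * N)" unfolding norm_of_real .
    thus ?thesis by linarith
  qed
  have "cmod (deriv G 0 - (\<Sum>\<xi>\<in>X. G \<xi> / (\<xi>\<^sup>2 * sin \<xi>))) \<le> 6 * M / (pi * N)"
    unfolding X_def
    by (rule interpolation_residues[OF N R hol _ Mpos]) (use bound R in auto)
  moreover have "cmod (\<Sum>\<xi>\<in>X. G \<xi> / (\<xi>\<^sup>2 * sin \<xi>)) \<le> (\<Sum>\<xi>\<in>X. M * (1 / (cmod \<xi>)\<^sup>2))"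
  proof (rule sum_norm_le)
    fix \<xi> assume "\<xi> \<in> X"
    then obtain x where x: "\<xi> = of_real x" "\<bar>sin x\<bar> = 1" "\<bar>x\<bar> < R" using X by blast
    have "cmod (sin \<xi>) = 1" using x by (simp add: sin_of_real)
    moreover have "cmod (G \<xi>) \<le> M" using bound[of \<xi>] x by simp
    ultimately show "cmod (G \<xi> / (\<xi>\<^sup>2 * sin \<xi>)) \<le> M * (1 / (cmod \<xi>)\<^sup>2)"
      by (simp add: norm_divide norm_mult norm_power divide_right_mono)
  qed
  moreover have "(\<Sum>\<xi>\<in>X. M * (1 / (cmod \<xi>)\<^sup>2)) \<le> M * (1 + 6 / (pi * N))"
    using mult_left_mono[OF sumX Mpos] by (simp add: sum_distrib_left)
  ultimately have "cmod (deriv G 0) \<le> M * (1 + 6 / (pi * N)) + 6 * M / (pi * N)"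
    using norm_triangle_sub[of "deriv G 0" "\<Sum>\<xi>\<in>X. G \<xi> / (\<xi>\<^sup>2 * sin \<xi>)"] by linarith
  also have "\<dots> = M * (1 + 12 / (pi * N))" using piN by (simp add: field_simps)
  finally show ?thesis .
qed

section \<open>Green functions through a Riemann map\<close>

lemma harmonic_on_neg_ln_cmod:
  assumes "open S" and hol: "h holomorphic_on S" and nz: "\<And>z. z \<in> S \<Longrightarrow> h z \<noteq> 0"
  shows "harmonic_on (\<lambda>z. - ln (cmod (h z))) S"
  unfolding harmonic_on_def
proof
  fix z assume "z \<in> S"
  then obtain r where r: "r > 0" "ball z r \<subseteq> S" using \<open>open S\<close> openE by blast
  obtain L where L: "L holomorphic_on ball z r" "\<And>x. x \<in> ball z r \<Longrightarrow> exp (L x) = h x"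
    by (rule holomorphic_logarithm_exists[of "ball z r" h z])
       (use r nz in \<open>auto intro: holomorphic_on_subset[OF hol]\<close>)
  have "- ln (cmod (h w)) = Re (- L w)" if "w \<in> ball z r" for w
    using L(2)[OF that, symmetric] by simp
  thus "\<exists>r>0. \<exists>k. k holomorphic_on ball z r \<and> (\<forall>w\<in>ball z r. - ln (cmod (h w)) = Re (k w))"
    using r L by (intro exI[of _ r] exI[of _ "\<lambda>w. - L w"]) (auto intro!: holomorphic_intros)
qed

lemma harmonic_on_imp_continuous_on:
  assumes "harmonic_on g S" shows "continuous_on S g"
proof (rule continuous_at_imp_continuous_on, rule ballI)
  fix z assume "z \<in> S"
  then obtain r h where r: "r > 0" "h holomorphic_on ball z r" "\<And>w. w \<in> ball z r \<Longrightarrow> g w = Re (h w)"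
    using assms by (auto simp: harmonic_on_def)
  have "continuous_on (ball z r) (\<lambda>w. Re (h w))"
    using r by (intro continuous_intros holomorphic_on_imp_continuous_on)
  hence "continuous_on (ball z r) g" using r by (metis continuous_on_cong)
  thus "isCont g z" using r by (simp add: continuous_on_eq_continuous_at)
qed

lemma harmonic_on_cong:
  assumes "open S" "harmonic_on g S" "\<And>z. z \<in> S \<Longrightarrow> f z = g z"
  shows "harmonic_on f S"
  unfolding harmonic_on_def
proof
  fix z assume z: "z \<in> S"
  then obtain r h where r: "r > 0" "h holomorphic_on ball z r" "\<And>w. w \<in> ball z r \<Longrightarrow> g w = Re (h w)"
    using assms(2) by (auto simp: harmonic_on_def)
  obtain s where s: "s > 0" "ball z s \<subseteq> S" using z assms(1) openE by blast
  show "\<exists>r>0. \<exists>h. h holomorphic_on ball z r \<and> (\<forall>w\<in>ball z r. f w = Re (h w))"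
  proof (intro exI conjI ballI)
    show "min r s > 0" using r s by simp
    show "h holomorphic_on ball z (min r s)" using r by (auto intro: holomorphic_on_subset)
    fix w assume "w \<in> ball z (min r s)"
    thus "f w = Re (h w)" using r(3)[of w] s assms(3)[of w] by auto
  qed
qed

text \<open>Injectivity makes the zero at \<open>c\<close> simple and the only one, so the
  difference quotient \<open>k\<close> is zero-free and the harmonic part is
  \<open>- ln (cmod (k z))\<close>.\<close>

lemma neg_ln_simple_zero:
  assumes r: "r > 0" and hol: "F holomorphic_on ball c r" and inj: "inj_on F (ball c r)" and F0: "F c = 0"
  shows "\<exists>h. harmonic_on h (ball c r) \<and> (\<forall>z\<in>ball c r - {c}. - ln (cmod (F z)) = h z - ln (cmod (z - c)))"
proof -
  define k where "k = (\<lambda>z. if z = c then deriv F c else (F z - F c) / (z - c))"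
  have hk: "k holomorphic_on ball c r" unfolding k_def by (rule pole_lemma_open[OF hol]) simp
  have knz: "k z \<noteq> 0" if "z \<in> ball c r" for z
  proof (cases "z = c")
    case True
    thus ?thesis using holomorphic_injective_imp_regular[OF hol _ inj, of c] r by (simp add: k_def)
  next
    case False
    hence "F z \<noteq> F c" using inj that r by (auto dest: inj_onD)
    thus ?thesis using False by (simp add: k_def)
  qed
  have "- ln (cmod (F z)) = - ln (cmod (k z)) - ln (cmod (z - c))" if "z \<in> ball c r - {c}" for z
  proof -
    have "F z = k z * (z - c)" using that F0 by (simp add: k_def)
    thus ?thesis using knz[of z] that by (simp add: norm_mult ln_mult)
  qed
  thus ?thesis using harmonic_on_neg_ln_cmod[OF open_ball hk knz] by blast
qed

text \<open>Boundedness of \<open>K\<close> keeps the set at distance at least \<open>1 / R\<close>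
  from the origin, the only discontinuity of the inversion. The origin is excluded by hand, as
  \<open>1 / 0 = 0\<close> would send it to \<open>c\<close>.\<close>

lemma closed_inversion_preimage:
  fixes K :: "complex set"
  assumes "compact K"
  shows "closed {w. w \<noteq> 0 \<and> c + 1 / w \<in> K}"
proof -
  obtain R where R: "R > 0" "\<And>z. z \<in> K \<Longrightarrow> cmod (z - c) \<le> R"
  proof -
    have "bounded ((\<lambda>z. z - c) ` K)" using assms bounded_translation_minus compact_imp_bounded by blast
    thus ?thesis using that by (auto simp: bounded_pos)
  qed
  have "closed ({w. 1 / R \<le> cmod w} \<inter> (\<lambda>w. c + 1 / w) -` K)"
  proof (rule continuous_closed_preimage)
    show "continuous_on {w. 1 / R \<le> cmod w} (\<lambda>w. c + 1 / w)" 
      using R by (intro continuous_intros) (auto simp: field_simps)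
    show "closed {w::complex. 1 / R \<le> cmod w}" by (intro closed_Collect_le continuous_intros)
  qed (use assms in \<open>auto simp: compact_imp_closed\<close>)
  moreover have "{w. w \<noteq> 0 \<and> c + 1 / w \<in> K} = {w. 1 / R \<le> cmod w} \<inter> (\<lambda>w. c + 1 / w) -` K"
  proof (intro equalityI subsetI)
    fix w assume "w \<in> {w. w \<noteq> 0 \<and> c + 1 / w \<in> K}"
    thus "w \<in> {w. 1 / R \<le> cmod w} \<inter> (\<lambda>w. c + 1 / w) -` K"
      using R(2)[of "c + 1 / w"] R(1) by (auto simp: norm_divide field_simps)
  qed (use R in \<open>auto simp: field_simps\<close>)
  ultimately show ?thesis by simp
qed

text \<open>The coordinate is \<open>w = 1 / (z - a)\<close>. Infinity becomes the ordinary point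
  \<open>w = 0\<close>, whence that disjunct in \<open>\<Omega>_eq\<close>, and \<open>a\<close>
  disappears to infinity; so finite and infinite poles are treated alike. \<open>\<phi>\<close> is a
  Riemann map of \<open>\<Omega>\<close> with inverse \<open>\<psi>\<close>, without normalization
  at any point.\<close>

locale riemann_coordinate =
  fixes \<Gamma> :: "complex set" and a :: complex and \<Omega> :: "complex set" and \<phi> \<psi> :: "complex \<Rightarrow> complex"
  assumes compact_\<Gamma>: "compact \<Gamma>" and a_in: "a \<in> \<Gamma>"
    and \<Omega>_eq: "\<Omega> = {w. w = 0 \<or> a + 1 / w \<notin> \<Gamma>}"
    and \<phi>_hol: "\<phi> holomorphic_on \<Omega>" and \<psi>_hol: "\<psi> holomorphic_on ball 0 1"
    and \<phi>_in: "\<And>w. w \<in> \<Omega> \<Longrightarrow> \<phi> w \<in> ball 0 1" and \<psi>_\<phi>: "\<And>w. w \<in> \<Omega> \<Longrightarrow> \<psi> (\<phi> w) = w"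
    and \<psi>_in: "\<And>x. x \<in> ball 0 1 \<Longrightarrow> \<psi> x \<in> \<Omega>" and \<phi>_\<psi>: "\<And>x. x \<in> ball 0 1 \<Longrightarrow> \<phi> (\<psi> x) = x"
begin

section \<open>Blaschke factors in the inverted coordinate and the candidate Green function\<close>

lemma open_\<Omega>: "open \<Omega>"
proof -
  have "closed {w. w \<noteq> 0 \<and> a + 1 / w \<in> \<Gamma>}" by (rule closed_inversion_preimage[OF compact_\<Gamma>])
  moreover have "{w. w \<noteq> 0 \<and> a + 1 / w \<in> \<Gamma>} = - \<Omega>" by (auto simp: \<Omega>_eq)
  ultimately show ?thesis by (simp add: open_closed)
qed

lemma connected_\<Omega>: "connected \<Omega>"
proof -
  have "\<Omega> = \<psi> ` ball 0 1" using \<psi>_in \<psi>_\<phi> \<phi>_in by (force simp: image_iff)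
  thus ?thesis using \<psi>_hol by (metis connected_ball connected_continuous_image holomorphic_on_imp_continuous_on)
qed

lemma zero_in_\<Omega>: "0 \<in> \<Omega>" by (simp add: \<Omega>_eq)

lemma inv_in_\<Omega>: "z \<notin> \<Gamma> \<Longrightarrow> 1 / (z - a) \<in> \<Omega>"
  using a_in by (auto simp: \<Omega>_eq)

lemma \<phi>_inj: "inj_on \<phi> \<Omega>" using \<psi>_\<phi> by (metis inj_on_inverseI)

definition pt :: "complex option \<Rightarrow> complex" where
  "pt \<beta> = (case \<beta> of None \<Rightarrow> 0 | Some b \<Rightarrow> 1 / (b - a))"

definition off :: "complex option \<Rightarrow> bool" where
  "off \<beta> \<longleftrightarrow> (\<forall>z\<in>\<Gamma>. \<beta> \<noteq> Some z)"

definition blaschke :: "complex option \<Rightarrow> complex \<Rightarrow> complex" where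
  "blaschke \<beta> w = (\<phi> w - \<phi> (pt \<beta>)) / (1 - cnj (\<phi> (pt \<beta>)) * \<phi> w)"

text \<open>The value 0 at a finite pole follows the convention of \<open>is_green\<close>, so that
  \<open>gr\<close> can agree with \<open>green\<close> as a function on the whole plane.\<close>

definition gr :: "complex option \<Rightarrow> complex \<Rightarrow> real" where
  "gr \<beta> z = (if z \<in> \<Gamma> \<or> \<beta> = Some z then 0 else - ln (cmod (blaschke \<beta> (1 / (z - a)))))"

lemma pt_in: "off \<beta> \<Longrightarrow> pt \<beta> \<in> \<Omega>"
  by (cases \<beta>) (auto simp: pt_def off_def zero_in_\<Omega> intro!: inv_in_\<Omega>)

lemma blaschke_denom: 
  assumes "off \<beta>" "w \<in> \<Omega>" shows "1 - cnj (\<phi> (pt \<beta>)) * \<phi> w \<noteq> 0"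
proof
  assume "1 - cnj (\<phi> (pt \<beta>)) * \<phi> w = 0"
  hence "cmod (\<phi> (pt \<beta>)) * cmod (\<phi> w) = 1" by (metis complex_mod_cnj eq_iff_diff_eq_0 norm_mult norm_one)
  moreover have "cmod (\<phi> (pt \<beta>)) < 1" "cmod (\<phi> w) < 1" using \<phi>_in assms pt_in by auto
  ultimately show False by (metis mult.right_neutral mult_le_cancel_left_pos not_le norm_ge_zero mult_less_cancel_right2 less_le mult_zero_left zero_neq_one)
qed

lemma blaschke_hol: "off \<beta> \<Longrightarrow> blaschke \<beta> holomorphic_on \<Omega>"
  unfolding blaschke_def using blaschke_denom by (intro holomorphic_intros \<phi>_hol) auto

lemma norm_diff_lt:
  fixes p x :: complex assumes "cmod p < 1" "cmod x < 1"
  shows "cmod (x - p) < cmod (1 - cnj p * x)"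
proof -
  have "(cmod (1 - cnj p * x))\<^sup>2 - (cmod (x - p))\<^sup>2 = (1 - (cmod p)\<^sup>2) * (1 - (cmod x)\<^sup>2)"
    unfolding cmod_power2 by (simp add: power2_eq_square algebra_simps)
  moreover have "(cmod p)\<^sup>2 < 1" "(cmod x)\<^sup>2 < 1" using assms by (auto simp: abs_square_less_1)
  hence "(1 - (cmod p)\<^sup>2) * (1 - (cmod x)\<^sup>2) > 0" by (intro mult_pos_pos) auto
  ultimately have "(cmod (x - p))\<^sup>2 < (cmod (1 - cnj p * x))\<^sup>2" by linarith
  thus ?thesis by (rule power2_less_imp_less) simp
qed

lemma blaschke_lt_1: "off \<beta> \<Longrightarrow> w \<in> \<Omega> \<Longrightarrow> cmod (blaschke \<beta> w) < 1"
  using norm_diff_lt[of "\<phi> (pt \<beta>)" "\<phi> w"] \<phi>_in[of w] \<phi>_in[of "pt \<beta>"] pt_in[of \<beta>] blaschke_denom[of \<beta> w]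
  by (simp add: blaschke_def norm_divide divide_simps)

lemma blaschke_eq_0_iff: "off \<beta> \<Longrightarrow> w \<in> \<Omega> \<Longrightarrow> blaschke \<beta> w = 0 \<longleftrightarrow> w = pt \<beta>"
  using blaschke_denom[of \<beta> w] inj_onD[OF \<phi>_inj, of w "pt \<beta>"] pt_in[of \<beta>] by (auto simp: blaschke_def)

lemma blaschke_inj:
  assumes "off \<beta>" shows "inj_on (blaschke \<beta>) \<Omega>"
proof (rule inj_onI)
  fix w v assume wv: "w \<in> \<Omega>" "v \<in> \<Omega>" and eq: "blaschke \<beta> w = blaschke \<beta> v"
  define p where "p = \<phi> (pt \<beta>)"
  have "cmod p < 1" using \<phi>_in pt_in assms by (auto simp: p_def)
  hence "(cmod p)\<^sup>2 < 1" by (auto simp: abs_square_less_1)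
  hence "complex_of_real (1 - (cmod p)\<^sup>2) \<noteq> 0" by (subst of_real_eq_0_iff) linarith
  hence nz: "1 - p * cnj p \<noteq> 0" using complex_norm_square[of p] by simp
  have "(\<phi> w - p) * (1 - cnj p * \<phi> v) = (\<phi> v - p) * (1 - cnj p * \<phi> w)"
    using eq blaschke_denom[OF assms wv(1)] blaschke_denom[OF assms wv(2)]
    by (simp add: blaschke_def p_def frac_eq_eq)
  hence "(\<phi> w - \<phi> v) * (1 - p * cnj p) = 0" by (simp add: algebra_simps)
  hence "\<phi> w = \<phi> v" using nz by simp
  thus "w = v" using \<phi>_inj wv by (auto dest: inj_onD)
qed

text \<open>A neighbourhood of the arc becomes the complement of a compact subset of
  \<open>\<Omega>\<close>, the form of boundary control that
  \<open>maximum_principle_local_norm\<close> expects. The set is bounded because a disc about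
  \<open>a\<close> lies in \<open>V\<close>.\<close>

lemma compact_outside:
  assumes V: "open V" "\<Gamma> \<subseteq> V"
  shows "compact {w. w = 0 \<or> a + 1 / w \<notin> V}" "{w. w = 0 \<or> a + 1 / w \<notin> V} \<subseteq> \<Omega>"
proof -
  obtain d where d: "d > 0" "ball a d \<subseteq> V" using V a_in openE by blast
  have "open ((- {0}) \<inter> (\<lambda>w. a + 1 / w) -` V)"
    by (rule continuous_open_preimage) (auto intro!: continuous_intros V)
  moreover have "{w. w = 0 \<or> a + 1 / w \<notin> V} = - ((- {0}) \<inter> (\<lambda>w. a + 1 / w) -` V)" by auto
  ultimately have "closed {w. w = 0 \<or> a + 1 / w \<notin> V}" by (metis closed_Compl)
  moreover have "cmod w \<le> 1 / d" if "w = 0 \<or> a + 1 / w \<notin> V" for w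
  proof (cases "w = 0")
    case False
    hence "a + 1 / w \<notin> ball a d" using that d by blast
    thus ?thesis using False d by (simp add: dist_norm norm_divide field_simps)
  qed (use d in auto)
  hence "bounded {w. w = 0 \<or> a + 1 / w \<notin> V}" unfolding bounded_iff by blast
  ultimately show "compact {w. w = 0 \<or> a + 1 / w \<notin> V}" by (simp add: compact_eq_bounded_closed)
  show "{w. w = 0 \<or> a + 1 / w \<notin> V} \<subseteq> \<Omega>" using V by (auto simp: \<Omega>_eq)
qed

lemma gr_nonneg:
  assumes "off \<beta>" shows "gr \<beta> z \<ge> 0"
proof (cases "z \<in> \<Gamma> \<or> \<beta> = Some z")
  case False
  hence w: "1 / (z - a) \<in> \<Omega>" using inv_in_\<Omega> by blast
  have "cmod (blaschke \<beta> (1 / (z - a))) < 1" by (rule blaschke_lt_1[OF assms w])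
  thus ?thesis using False by (cases "cmod (blaschke \<beta> (1 / (z - a))) = 0") (auto simp: gr_def)
qed (auto simp: gr_def)

lemma pt_eq_iff: "z \<notin> \<Gamma> \<Longrightarrow> off \<beta> \<Longrightarrow> 1 / (z - a) = pt \<beta> \<longleftrightarrow> \<beta> = Some z"
  using a_in by (cases \<beta>) (auto simp: pt_def off_def)

text \<open>A Blaschke factor has modulus 1 on the unit circle, so the corresponding set in the
  closed disc stays away from the circle, and \<open>\<psi>\<close> carries it to a compact set.
  This yields boundary values of \<open>gr\<close> without any boundary behaviour of the Riemann
  map.\<close>

lemma blaschke_sublevel_compact:
  assumes off: "off \<beta>" and \<rho>: "\<rho> < 1"
  shows "compact {w\<in>\<Omega>. cmod (blaschke \<beta> w) \<le> \<rho>}"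
proof -
  define p where "p = \<phi> (pt \<beta>)"
  have p: "cmod p < 1" using \<phi>_in pt_in off by (auto simp: p_def)
  define E where "E = {x. cmod x \<le> 1 \<and> cmod (x - p) \<le> \<rho> * cmod (1 - cnj p * x)}"
  have "E = cball 0 1 \<inter> {x. cmod (x - p) \<le> \<rho> * cmod (1 - cnj p * x)}" by (auto simp: E_def)
  hence compE: "compact E"
    by (simp, intro compact_Int_closed compact_cball closed_Collect_le continuous_intros)
  have Esub: "E \<subseteq> ball 0 1"
  proof
    fix x assume x: "x \<in> E"
    have "cmod x \<noteq> 1"
    proof
      assume x1: "cmod x = 1"
      hence "(cmod (1 - cnj p * x))\<^sup>2 - (cmod (x - p))\<^sup>2 = 0"
        using cmod_power2[of x] unfolding cmod_power2[of "1 - cnj p * x"] cmod_power2[of "x - p"]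
        by (simp add: power2_eq_square algebra_simps) algebra
      hence eq: "cmod (1 - cnj p * x) = cmod (x - p)" by (simp add: power2_eq_iff_nonneg)
      have "x \<noteq> p" using x1 p by auto
      hence pos: "cmod (x - p) > 0" by simp
      have "cmod (x - p) \<le> \<rho> * cmod (x - p)" using x eq by (simp add: E_def)
      thus False using pos \<rho> by (simp add: mult_le_cancel_right1)
    qed
    thus "x \<in> ball 0 1" using x by (simp add: E_def)
  qed
  have "{w\<in>\<Omega>. cmod (blaschke \<beta> w) \<le> \<rho>} = \<psi> ` E"
  proof (intro equalityI subsetI)
    fix w assume w: "w \<in> {w\<in>\<Omega>. cmod (blaschke \<beta> w) \<le> \<rho>}"
    hence "\<phi> w \<in> E" using \<phi>_in[of w] blaschke_denom[OF off, of w]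
      by (auto simp: E_def blaschke_def p_def norm_divide field_simps)
    thus "w \<in> \<psi> ` E" using w \<psi>_\<phi>[of w] by force
  next
    fix w assume "w \<in> \<psi> ` E"
    then obtain x where x: "x \<in> E" "w = \<psi> x" by auto
    hence xb: "x \<in> ball 0 1" using Esub by blast
    hence w: "w \<in> \<Omega>" "\<phi> w = x" using \<psi>_in \<phi>_\<psi> x by auto
    thus "w \<in> {w\<in>\<Omega>. cmod (blaschke \<beta> w) \<le> \<rho>}" using x blaschke_denom[OF off, of w]
      by (auto simp: E_def blaschke_def p_def norm_divide field_simps)
  qed
  moreover have "compact (\<psi> ` E)"
    by (rule compact_continuous_image[OF _ compE])
       (rule continuous_on_subset[OF holomorphic_on_imp_continuous_on[OF \<psi>_hol] Esub])
  ultimately show ?thesis by simp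
qed

lemma gr_harmonic:
  assumes off: "off \<beta>" shows "harmonic_on (gr \<beta>) (UNIV - \<Gamma> - fin_part \<beta>)"
proof -
  define S where "S = UNIV - \<Gamma> - fin_part \<beta>"
  have S: "open S" unfolding S_def using compact_\<Gamma>
    by (intro open_Diff) (auto simp: fin_part_def compact_imp_closed split: option.splits)
  have inS: "z \<notin> \<Gamma>" "\<beta> \<noteq> Some z" if "z \<in> S" for z
    using that by (auto simp: S_def fin_part_def)
  have "(blaschke \<beta> \<circ> (\<lambda>z. 1 / (z - a))) holomorphic_on S"
    using inS inv_in_\<Omega> a_in
    by (intro holomorphic_on_compose_gen[OF _ blaschke_hol[OF off]] holomorphic_intros) auto
  hence "harmonic_on (\<lambda>z. - ln (cmod (blaschke \<beta> (1 / (z - a))))) S"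
    using inS inv_in_\<Omega> pt_eq_iff off
    by (intro harmonic_on_neg_ln_cmod[OF S]) (auto simp: o_def blaschke_eq_0_iff)
  thus ?thesis unfolding S_def[symmetric]
    by (rule harmonic_on_cong[OF S]) (use inS in \<open>auto simp: gr_def\<close>)
qed

text \<open>Only points of the arc are in doubt. There, \<open>gr\<close> can be at least
  \<open>e\<close> only on the part of the plane coming from a compact subset of
  \<open>\<Omega>\<close>, which the arc does not meet.\<close>

lemma gr_continuous:
  assumes off: "off \<beta>" shows "continuous_on (UNIV - fin_part \<beta>) (gr \<beta>)"
proof -
  have op: "open (UNIV - fin_part \<beta>)" "open (UNIV - \<Gamma> - fin_part \<beta>)" using compact_\<Gamma>
    by (auto intro!: open_Diff simp: fin_part_def compact_imp_closed split: option.splits)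
  have "isCont (gr \<beta>) z" if z: "z \<in> UNIV - fin_part \<beta>" for z
  proof (cases "z \<in> \<Gamma>")
    case False
    thus ?thesis using harmonic_on_imp_continuous_on[OF gr_harmonic[OF off]] op z
      by (auto simp: continuous_on_eq_continuous_at)
  next
    case True
    show ?thesis unfolding continuous_at_eps_delta
    proof (intro allI impI)
      fix e :: real assume e: "e > 0"
      define K where "K = {w\<in>\<Omega>. cmod (blaschke \<beta> w) \<le> exp (- e)}"
      have K: "compact K" unfolding K_def by (rule blaschke_sublevel_compact[OF off]) (use e in auto)
      \<comment> \<open>\<open>K\<close> moved back to the \<open>z\<close> plane.
        \<open>closed_inversion_preimage\<close> is used in the opposite direction, with
        \<open>z - a\<close> in the role of its variable.\<close>
      define T where "T = (\<lambda>x. a + x) ` {w. w \<noteq> 0 \<and> 0 + 1 / w \<in> K}"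
      have "closed T" unfolding T_def by (intro closed_translation closed_inversion_preimage K)
      moreover have "z \<notin> T" using True by (auto simp: T_def K_def \<Omega>_eq)
      ultimately obtain d where d: "d > 0" "ball z d \<subseteq> - T" by (metis ComplI open_Compl openE)
      have "\<bar>gr \<beta> x\<bar> < e" if "dist x z < d" for x
      proof (cases "x \<in> \<Gamma> \<or> \<beta> = Some x")
        case True
        thus ?thesis using e by (auto simp: gr_def)
      next
        case False
        hence w: "1 / (x - a) \<in> \<Omega>" using inv_in_\<Omega> by blast
        have "x \<in> ball z d" using that by (simp add: dist_commute)
        hence "x \<notin> T" using d by blast
        hence "1 / (x - a) \<notin> K" using False a_in by (auto simp: T_def image_iff dest: spec[of _ "x - a"])
        hence gt: "cmod (blaschke \<beta> (1 / (x - a))) > exp (- e)" using w by (auto simp: K_def)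
        hence "ln (exp (- e)) < ln (cmod (blaschke \<beta> (1 / (x - a))))"
          by (subst ln_less_cancel_iff) (auto intro: less_trans[OF exp_gt_zero])
        hence "gr \<beta> x < e" using False by (simp add: gr_def)
        thus ?thesis using gr_nonneg[OF off, of x] by simp
      qed
      moreover have "gr \<beta> z = 0" using True by (simp add: gr_def)
      ultimately show "\<exists>d>0. \<forall>x. dist x z < d \<longrightarrow> dist (gr \<beta> x) (gr \<beta> z) < e"
        using d(1) by (auto simp: dist_real_def)
    qed
  qed
  thus ?thesis using continuous_at_imp_continuous_on by blast
qed

end

context riemann_coordinate
begin

section \<open>Behaviour of the candidate at infinity and at its pole\<close>

lemma inversion_coordinate:
  fixes x :: complex assumes "x \<noteq> 0" shows "1 / (1 / x - a) = x / (1 - a * x)"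
proof -
  have "1 / x - a = (1 - a * x) / x" using assms by (simp add: field_simps)
  thus ?thesis by simp
qed

text \<open>\<open>is_green\<close> describes infinity by \<open>x = 1 / z\<close>, for which
  \<open>w = x / (1 - a * x)\<close>. Near \<open>x = 0\<close> this is a regular change of
  coordinate fixing 0.\<close>

lemma infinity_chart:
  obtains r where "r > 0" "\<And>x. x \<in> ball 0 r \<Longrightarrow> 1 - a * x \<noteq> 0"
    "\<And>x. x \<in> ball 0 r \<Longrightarrow> x / (1 - a * x) \<in> \<Omega>" "\<And>x. x \<in> ball 0 r \<Longrightarrow> x \<noteq> 0 \<Longrightarrow> 1 / x \<notin> \<Gamma>"
proof -
  define W where "W = {x. 1 - a * x \<noteq> 0} \<inter> (\<lambda>x. x / (1 - a * x)) -` \<Omega>"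
  have "open {x. 1 - a * x \<noteq> 0}" by (intro open_Collect_neq continuous_intros)
  hence "open W" unfolding W_def
    by (intro continuous_open_preimage open_\<Omega>) (auto intro!: continuous_intros)
  moreover have "0 \<in> W" by (simp add: W_def zero_in_\<Omega>)
  ultimately obtain r where r: "r > 0" "ball 0 r \<subseteq> W" using openE by blast
  show ?thesis
  proof (rule that[OF r(1)])
    fix x :: complex assume x: "x \<in> ball 0 r"
    hence xW: "x \<in> W" using r by blast
    show 1: "1 - a * x \<noteq> 0" "x / (1 - a * x) \<in> \<Omega>" using xW by (auto simp: W_def)
    assume x0: "x \<noteq> 0"
    have "a + 1 / (x / (1 - a * x)) = 1 / x" using x0 1 by (simp add: field_simps)
    moreover have "x / (1 - a * x) \<noteq> 0" using x0 1 by simp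
    ultimately show "1 / x \<notin> \<Gamma>" using 1(2) by (auto simp: \<Omega>_eq)
  qed
qed

lemma gr_infinity:
  assumes off: "off \<beta>"
  shows "\<exists>r>0. \<exists>h. harmonic_on h (ball 0 r) \<and>
    (\<forall>w\<in>ball 0 r - {0}. gr \<beta> (1 / w) = (if \<beta> = None then h w - ln (cmod w) else h w))"
proof -
  obtain r where r: "r > 0" "\<And>x. x \<in> ball 0 r \<Longrightarrow> 1 - a * x \<noteq> 0"
    "\<And>x. x \<in> ball 0 r \<Longrightarrow> x / (1 - a * x) \<in> \<Omega>" "\<And>x. x \<in> ball 0 r \<Longrightarrow> x \<noteq> 0 \<Longrightarrow> 1 / x \<notin> \<Gamma>"
    using infinity_chart by metis
  define F where "F = (\<lambda>x. blaschke \<beta> (x / (1 - a * x)))"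
  have "(blaschke \<beta> \<circ> (\<lambda>x. x / (1 - a * x))) holomorphic_on ball 0 r"
    using r by (intro holomorphic_on_compose_gen[OF _ blaschke_hol[OF off]] holomorphic_intros) auto
  hence holF: "F holomorphic_on ball 0 r" by (simp add: F_def o_def)
  have inj: "x = y" if "x \<in> ball 0 r" "y \<in> ball 0 r" "x / (1 - a * x) = y / (1 - a * y)" for x y
  proof -
    have "x * (1 - a * y) = y * (1 - a * x)" using that r(2) by (simp add: frac_eq_eq)
    thus ?thesis by (simp add: algebra_simps)
  qed
  have injF: "inj_on F (ball 0 r)"
  proof (rule inj_onI)
    fix x y assume xy: "x \<in> ball 0 r" "y \<in> ball 0 r" "F x = F y"
    hence "x / (1 - a * x) = y / (1 - a * y)"
      using inj_onD[OF blaschke_inj[OF off]] r(3) unfolding F_def by blast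
    thus "x = y" by (rule inj[OF xy(1,2)])
  qed
  have grF: "gr \<beta> (1 / x) = - ln (cmod (F x))" if "x \<in> ball 0 r - {0}" "\<beta> \<noteq> Some (1 / x)" for x
    using that r(4)[of x] by (simp add: gr_def F_def inversion_coordinate)
  show ?thesis
  proof (cases \<beta>)
    case None
    have "F 0 = 0" using None by (simp add: F_def blaschke_def pt_def)
    from neg_ln_simple_zero[OF r(1) holF injF this]
    obtain h where h: "harmonic_on h (ball 0 r)" "\<And>z. z \<in> ball 0 r - {0} \<Longrightarrow> - ln (cmod (F z)) = h z - ln (cmod (z - 0))"
      by blast
    show ?thesis using h grF None r(1) by (intro exI[of _ r] exI[of _ h]) auto
  next
    case (Some b)
    \<comment> \<open>Shrinks the chart so that the finite pole \<open>b\<close> is not of the form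
      \<open>1 / x\<close> in it; for \<open>b = 0\<close> that holds for every nonzero
      \<open>x\<close>.\<close>
    define s where "s = (if b = 0 then r else min r (1 / cmod b))"
    have s: "s > 0" "s \<le> r" using r by (auto simp: s_def)
    have nb: "Some (1 / x) \<noteq> \<beta>" if "x \<in> ball 0 s" "x \<noteq> 0" for x
      using that Some by (auto simp: s_def norm_divide split: if_splits)
    have "harmonic_on (\<lambda>x. - ln (cmod (F x))) (ball 0 s)"
    proof (rule harmonic_on_neg_ln_cmod)
      show "F holomorphic_on ball 0 s" using s by (intro holomorphic_on_subset[OF holF]) auto
      fix x :: complex assume x: "x \<in> ball 0 s"
      hence xr: "x \<in> ball 0 r" using s by auto
      show "F x \<noteq> 0"
      proof
        assume "F x = 0"
        hence eq: "x / (1 - a * x) = pt \<beta>" using blaschke_eq_0_iff[OF off r(3)[OF xr]] by (simp add: F_def)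
        show False
        proof (cases "x = 0")
          case True
          thus ?thesis using eq Some off a_in by (auto simp: pt_def off_def)
        next
          case False
          hence "1 / (1 / x - a) = pt \<beta>" using eq inversion_coordinate by simp
          hence "\<beta> = Some (1 / x)" using pt_eq_iff[OF r(4)[OF xr False] off] by simp
          thus ?thesis using nb[OF x False] by simp
        qed
      qed
    qed simp
    moreover have "gr \<beta> (1 / x) = - ln (cmod (F x))" if "x \<in> ball 0 s - {0}" for x
      using that s nb[of x] by (intro grF) auto
    ultimately show ?thesis using s(1) Some by (intro exI[of _ s] exI[of _ "\<lambda>x. - ln (cmod (F x))"]) auto
  qed
qed

lemma gr_finite_pole:
  assumes off: "off (Some b)"
  shows "\<exists>r>0. \<exists>h. harmonic_on h (ball b r) \<and> (\<forall>z\<in>ball b r - {b}. gr (Some b) z = h z - ln (cmod (z - b)))"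
proof -
  have b: "b \<notin> \<Gamma>" using off by (auto simp: off_def)
  then obtain r where r: "r > 0" "ball b r \<subseteq> - \<Gamma>"
    using compact_\<Gamma> by (metis ComplI compact_imp_closed open_Compl openE)
  define F where "F = (\<lambda>z. blaschke (Some b) (1 / (z - a)))"
  have za: "z \<noteq> a" if "z \<in> ball b r" for z using that r a_in by auto
  have zO: "1 / (z - a) \<in> \<Omega>" if "z \<in> ball b r" for z using that r inv_in_\<Omega> by auto
  have "(blaschke (Some b) \<circ> (\<lambda>z. 1 / (z - a))) holomorphic_on ball b r"
    using za zO by (intro holomorphic_on_compose_gen[OF _ blaschke_hol[OF off]] holomorphic_intros) auto
  hence holF: "F holomorphic_on ball b r" by (simp add: F_def o_def)
  have injF: "inj_on F (ball b r)"
  proof (rule inj_onI)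
    fix x y assume xy: "x \<in> ball b r" "y \<in> ball b r" "F x = F y"
    hence "1 / (x - a) = 1 / (y - a)"
      using inj_onD[OF blaschke_inj[OF off]] zO unfolding F_def by blast
    thus "x = y" using za xy by (simp add: frac_eq_eq)
  qed
  have "F b = 0" by (simp add: F_def blaschke_def pt_def)
  from neg_ln_simple_zero[OF r(1) holF injF this]
  obtain h where h: "harmonic_on h (ball b r)" "\<And>z. z \<in> ball b r - {b} \<Longrightarrow> - ln (cmod (F z)) = h z - ln (cmod (z - b))"
    by blast
  moreover have "gr (Some b) z = - ln (cmod (F z))" if "z \<in> ball b r - {b}" for z
    using that r by (auto simp: gr_def F_def)
  ultimately show ?thesis using r by (intro exI[of _ r] exI[of _ h]) auto
qed

lemma gr_is_green:
  assumes off: "off \<beta>" shows "is_green \<Gamma> \<beta> (gr \<beta>)"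
proof -
  have 1: "\<forall>z\<in>\<Gamma>. gr \<beta> z = 0" by (simp add: gr_def)
  show ?thesis
  proof (cases \<beta>)
    case None
    show ?thesis using 1 gr_continuous[OF off] gr_harmonic[OF off] gr_infinity[OF off]
      by (simp add: is_green_def None)
  next
    case (Some b)
    have "gr \<beta> b = 0" by (simp add: gr_def Some)
    thus ?thesis using 1 gr_continuous[OF off] gr_harmonic[OF off] gr_infinity[OF off] gr_finite_pole[of b] off
      by (simp add: is_green_def Some)
  qed
qed

section \<open>Uniqueness of the Green function\<close>

definition punctured_harmonic :: "(complex \<Rightarrow> real) \<Rightarrow> complex \<Rightarrow> bool" where
  "punctured_harmonic u c \<longleftrightarrow> (\<exists>r>0. \<exists>L. L holomorphic_on ball c r \<and> (\<forall>x\<in>ball c r - {c}. u x = Re (L x)))"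

lemma punctured_harmonicI:
  assumes "r > 0" "harmonic_on h1 (ball c r)" "harmonic_on h2 (ball c r)"
    and eq: "\<And>x. x \<in> ball c r - {c} \<Longrightarrow> u x = h1 x - h2 x"
  shows "punctured_harmonic u c"
proof -
  have c: "c \<in> ball c r" using assms by simp
  obtain r1 L1 where 1: "r1 > 0" "L1 holomorphic_on ball c r1" "\<And>w. w \<in> ball c r1 \<Longrightarrow> h1 w = Re (L1 w)"
    using assms(2) c unfolding harmonic_on_def by blast
  obtain r2 L2 where 2: "r2 > 0" "L2 holomorphic_on ball c r2" "\<And>w. w \<in> ball c r2 \<Longrightarrow> h2 w = Re (L2 w)"
    using assms(3) c unfolding harmonic_on_def by blast
  define s where "s = min r (min r1 r2)"
  have "(\<lambda>x. L1 x - L2 x) holomorphic_on ball c s"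
    by (intro holomorphic_intros holomorphic_on_subset[OF 1(2)] holomorphic_on_subset[OF 2(2)]) (auto simp: s_def)
  moreover have "u x = Re (L1 x - L2 x)" if "x \<in> ball c s - {c}" for x
    using that eq[of x] 1(3)[of x] 2(3)[of x] by (auto simp: s_def)
  moreover have "s > 0" using 1 2 assms by (simp add: s_def)
  ultimately show ?thesis unfolding punctured_harmonic_def by blast
qed

lemma punctured_harmonic_compose:
  assumes u: "punctured_harmonic u (m c)" and S: "open S" "c \<in> S" and m: "m holomorphic_on S"
    and ne: "\<And>x. x \<in> S \<Longrightarrow> x \<noteq> c \<Longrightarrow> m x \<noteq> m c"
    and eq: "\<And>x. x \<in> S \<Longrightarrow> x \<noteq> c \<Longrightarrow> v x = u (m x)"
  shows "punctured_harmonic v c"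
proof -
  obtain r L where r: "r > 0" "L holomorphic_on ball (m c) r" "\<And>x. x \<in> ball (m c) r - {m c} \<Longrightarrow> u x = Re (L x)"
    using u by (auto simp: punctured_harmonic_def)
  have "open (S \<inter> m -` ball (m c) r)"
    using m S by (intro continuous_open_preimage holomorphic_on_imp_continuous_on) auto
  then obtain s where s: "s > 0" "ball c s \<subseteq> S \<inter> m -` ball (m c) r"
    using S r(1) by (meson IntI centre_in_ball openE vimageI)
  have "(L \<circ> m) holomorphic_on ball c s"
    by (rule holomorphic_on_compose_gen[OF holomorphic_on_subset[OF m] r(2)]) (use s in auto)
  moreover have "v x = Re ((L \<circ> m) x)" if "x \<in> ball c s - {c}" for x
  proof -
    have x: "x \<in> S" "m x \<in> ball (m c) r" "x \<noteq> c" using that s by auto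
    thus ?thesis using eq[of x] ne[of x] r(3)[of "m x"] by simp
  qed
  ultimately show ?thesis using s unfolding punctured_harmonic_def by blast
qed

text \<open>The logarithmic poles cancel in the difference, which tends to 0 at the arc, so the
  maximum principle bounds its exponential by 1. Exchanging \<open>g1\<close> and \<open>g2\<close>
  gives uniqueness, which the definite description in \<open>green\<close> requires. At
  \<open>w = 0\<close> and at the image of a finite pole the values of \<open>v\<close> are mere
  conventions; hence harmonicity is tracked on punctured discs only.\<close>

lemma is_green_le:
  assumes off: "off \<beta>" and g1: "is_green \<Gamma> \<beta> g1" and g2: "is_green \<Gamma> \<beta> g2"
    and z: "z \<notin> \<Gamma>" "\<beta> \<noteq> Some z"
  shows "g1 z \<le> g2 z"
proof -
  define u where "u = (\<lambda>z. g1 z - g2 z)"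
  define v where "v = (\<lambda>w. u (a + 1 / w))"
  \<comment> \<open>The limit removes the singularities at \<open>0\<close> and at the image of the pole.\<close>
  define V where "V = (\<lambda>w. exp (Lim (at w) v))"
  have Lim_eq: "\<exists>r>0. \<exists>H. H holomorphic_on ball c r \<and> (\<forall>x\<in>ball c r. V x = cmod (H x))"
    if "punctured_harmonic v c" for c
  proof -
    obtain r L where r: "r > 0" "L holomorphic_on ball c r" "\<And>x. x \<in> ball c r - {c} \<Longrightarrow> v x = Re (L x)"
      using \<open>punctured_harmonic v c\<close> by (auto simp: punctured_harmonic_def)
    have "V x = cmod (exp (L x))" if x: "x \<in> ball c r" for x
    proof -
      have "isCont L x" using r(2) x by (metis continuous_on_eq_continuous_at holomorphic_on_imp_continuous_on open_ball)
      hence "((\<lambda>x. Re (L x)) \<longlongrightarrow> Re (L x)) (at x)" by (intro tendsto_intros) (simp add: isCont_def)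
      moreover have "\<forall>\<^sub>F y in at x. Re (L y) = v y"
      proof -
        have "\<forall>\<^sub>F y in at x. y \<in> ball c r - {c}"
        proof (cases "x = c")
          case True
          thus ?thesis using eventually_at_in_open[of "ball c r" c] r by simp
        next
          case False
          thus ?thesis using x by (intro eventually_at_in_open') auto
        qed
        thus ?thesis by eventually_elim (use r in simp)
      qed
      ultimately have "(v \<longlongrightarrow> Re (L x)) (at x)" by (rule Lim_transform_eventually)
      hence "Lim (at x) v = Re (L x)" by (intro tendsto_Lim) auto
      thus ?thesis by (simp add: V_def)
    qed
    thus ?thesis using r by (intro exI[of _ r] exI[of _ "\<lambda>x. exp (L x)"]) (auto intro!: holomorphic_intros)
  qed
  have cont: "continuous_on (UNIV - fin_part \<beta>) u"
    using g1 g2 unfolding u_def is_green_def by (intro continuous_intros) auto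
  have op: "open (UNIV - fin_part \<beta>)" by (auto simp: fin_part_def split: option.splits)
  have V_eq: "V w = exp (u (a + 1 / w))" if w: "w \<noteq> 0" "\<beta> \<noteq> Some (a + 1 / w)" for w
  proof -
    have "a + 1 / w \<in> UNIV - fin_part \<beta>" using w by (auto simp: fin_part_def split: option.splits)
    hence "isCont u (a + 1 / w)" using cont op by (simp add: continuous_on_eq_continuous_at)
    hence "isCont v w" unfolding v_def using w(1)
      by (intro isCont_o2[where f = "\<lambda>w. a + 1 / w" and g = u]) (auto intro!: continuous_intros)
    hence "(v \<longlongrightarrow> v w) (at w)" by (simp add: isCont_def)
    hence "Lim (at w) v = v w" by (intro tendsto_Lim) auto
    thus ?thesis by (simp add: V_def v_def)
  qed
  have "punctured_harmonic v c" if c: "c \<in> \<Omega>" for c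
  proof (cases "c = 0")
    case True
    have "punctured_harmonic (\<lambda>x. u (1 / x)) 0"
    proof (cases \<beta>)
      case None
      obtain r1 h1 r2 h2 where h: "r1 > 0" "harmonic_on h1 (ball 0 r1)" "\<And>w. w \<in> ball 0 r1 - {0} \<Longrightarrow> g1 (1 / w) = h1 w - ln (cmod w)"
        "r2 > 0" "harmonic_on h2 (ball 0 r2)" "\<And>w. w \<in> ball 0 r2 - {0} \<Longrightarrow> g2 (1 / w) = h2 w - ln (cmod w)"
        using g1 g2 None unfolding is_green_def by auto
      show ?thesis
        by (rule punctured_harmonicI[of "min r1 r2" h1 _ h2]) (use h in \<open>auto simp: u_def harmonic_on_def\<close>)
    next
      case (Some b)
      obtain r1 h1 r2 h2 where h: "r1 > 0" "harmonic_on h1 (ball 0 r1)" "\<And>w. w \<in> ball 0 r1 - {0} \<Longrightarrow> g1 (1 / w) = h1 w"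
        "r2 > 0" "harmonic_on h2 (ball 0 r2)" "\<And>w. w \<in> ball 0 r2 - {0} \<Longrightarrow> g2 (1 / w) = h2 w"
        using g1 g2 Some unfolding is_green_def by auto
      show ?thesis
        by (rule punctured_harmonicI[of "min r1 r2" h1 _ h2]) (use h in \<open>auto simp: u_def harmonic_on_def\<close>)
    qed
    \<comment> \<open>The chart at infinity in \<open>is_green\<close> has the coordinate
      \<open>1 / z\<close>, which equals \<open>w / (1 + a * w)\<close>.\<close>
    hence p: "punctured_harmonic (\<lambda>x. u (1 / x)) ((\<lambda>w. w / (1 + a * w)) 0)" by simp
    have "open {w. 1 + a * w \<noteq> 0}" by (intro open_Collect_neq continuous_intros)
    thus ?thesis unfolding True
    proof (rule punctured_harmonic_compose[where m = "\<lambda>w. w / (1 + a * w)" and u = "\<lambda>x. u (1 / x)", OF p])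
      show "v x = u (1 / (x / (1 + a * x)))" if "x \<in> {w. 1 + a * w \<noteq> 0}" "x \<noteq> 0" for x
      proof -
        have "1 / (x / (1 + a * x)) = a + 1 / x" using that by (simp add: field_simps)
        thus ?thesis by (simp add: v_def)
      qed
    qed (auto intro!: holomorphic_intros)
  next
    case False
    hence cG: "a + 1 / c \<notin> \<Gamma>" using c by (simp add: \<Omega>_eq)
    have p: "punctured_harmonic u ((\<lambda>w. a + 1 / w) c)"
    proof (cases "\<beta> = Some (a + 1 / c)")
      case True
      define b where "b = a + 1 / c"
      obtain r1 h1 r2 h2 where h: "r1 > 0" "harmonic_on h1 (ball b r1)" "\<And>z. z \<in> ball b r1 - {b} \<Longrightarrow> g1 z = h1 z - ln (cmod (z - b))"
        "r2 > 0" "harmonic_on h2 (ball b r2)" "\<And>z. z \<in> ball b r2 - {b} \<Longrightarrow> g2 z = h2 z - ln (cmod (z - b))"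
        using g1 g2 True unfolding is_green_def b_def[symmetric] by auto
      show ?thesis unfolding b_def[symmetric]
        by (rule punctured_harmonicI[of "min r1 r2" h1 _ h2]) (use h in \<open>auto simp: u_def harmonic_on_def\<close>)
    next
      case False
      define b where "b = a + 1 / c"
      have "b \<in> UNIV - \<Gamma> - fin_part \<beta>" using cG False by (auto simp: b_def fin_part_def split: option.splits)
      moreover have "open (UNIV - \<Gamma> - fin_part \<beta>)" using compact_\<Gamma>
        by (intro open_Diff) (auto simp: fin_part_def compact_imp_closed split: option.splits)
      ultimately obtain r where r: "r > 0" "ball b r \<subseteq> UNIV - \<Gamma> - fin_part \<beta>" using openE by blast
      have "harmonic_on g1 (UNIV - \<Gamma> - fin_part \<beta>)" "harmonic_on g2 (UNIV - \<Gamma> - fin_part \<beta>)"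
        using g1 g2 by (auto simp: is_green_def)
      hence "harmonic_on g1 (ball b r)" "harmonic_on g2 (ball b r)"
        using r(2) by (auto simp: harmonic_on_def subset_iff)
      thus ?thesis unfolding b_def[symmetric]
        by (rule punctured_harmonicI[OF r(1)]) (auto simp: u_def)
    qed
    show ?thesis
      by (rule punctured_harmonic_compose[where m = "\<lambda>w. a + 1 / w" and u = u and S = "- {0}", OF p]) (use False in \<open>auto simp: v_def intro!: holomorphic_intros\<close>)
  qed
  note loc = Lim_eq[OF this]
  have w: "1 / (z - a) \<in> \<Omega>" using inv_in_\<Omega> z by blast
  have "V (1 / (z - a)) \<le> 1"
  proof (rule maximum_principle_local_norm[OF open_\<Omega> connected_\<Omega> loc _ w])
    fix e :: real assume e: "e > 0"
    define W where "W = (UNIV - fin_part \<beta>) \<inter> (\<lambda>z. exp (u z)) -` {..<1+e}"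
    have W: "open W" unfolding W_def
      by (rule continuous_open_preimage) (auto intro!: continuous_intros cont op)
    have "u z = 0" if "z \<in> \<Gamma>" for z using that g1 g2 by (auto simp: is_green_def u_def)
    moreover have "z \<notin> fin_part \<beta>" if "z \<in> \<Gamma>" for z using that off by (auto simp: off_def fin_part_def split: option.splits)
    ultimately have GW: "\<Gamma> \<subseteq> W" using e by (auto simp: W_def)
    have "V w \<le> 1 + e" if "w \<in> \<Omega> - {w. w = 0 \<or> a + 1 / w \<notin> W}" for w
    proof -
      have "w \<noteq> 0" "a + 1 / w \<in> W" using that by auto
      thus ?thesis using V_eq[of w] by (cases \<beta>) (auto simp: W_def fin_part_def)
    qed
    thus "\<exists>K. compact K \<and> K \<subseteq> \<Omega> \<and> (\<forall>w\<in>\<Omega> - K. V w \<le> 1 + e)"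
      using compact_outside[OF W GW] by blast
  qed
  moreover have "a + 1 / (1 / (z - a)) = z" by simp
  moreover have "z \<noteq> a" using z a_in by auto
  ultimately show ?thesis using V_eq[of "1 / (z - a)"] z by (simp add: u_def)
qed

lemma green_eq_gr:
  assumes off: "off \<beta>" shows "green \<Gamma> \<beta> = gr \<beta>"
  unfolding green_def
proof (rule the_equality)
  show "is_green \<Gamma> \<beta> (gr \<beta>)" by (rule gr_is_green[OF off])
  fix g assume g: "is_green \<Gamma> \<beta> g"
  show "g = gr \<beta>"
  proof
    fix z
    show "g z = gr \<beta> z"
    proof (cases "z \<in> \<Gamma> \<or> \<beta> = Some z")
      case True
      thus ?thesis using g by (auto simp: is_green_def gr_def)
    next
      case False
      thus ?thesis using is_green_le[OF off g gr_is_green[OF off], of z] is_green_le[OF off gr_is_green[OF off] g, of z] by auto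
    qed
  qed
qed

end

section \<open>The Bernstein--Walsh inequality\<close>

lemma sum_order_roots:
  fixes q :: "complex poly" assumes q: "q \<noteq> 0"
  shows "(\<Sum>b | poly q b = 0. order b q) = degree q"
proof -
  have "degree q = degree (smult (lead_coeff q) (\<Prod>b | poly q b = 0. [:- b, 1:] ^ order b q))"
    by (subst complex_poly_decompose) simp
  also have "\<dots> = (\<Sum>b | poly q b = 0. degree ([:- b, 1:] ^ order b q))"
    using q by (simp add: degree_prod_eq_sum_degree)
  also have "\<dots> = (\<Sum>b | poly q b = 0. order b q)" by (simp add: degree_power_eq)
  finally show ?thesis by simp
qed

lemma rational_le_sup_norm:
  fixes p q :: "complex poly"
  assumes "compact S" "\<And>z. z \<in> S \<Longrightarrow> poly q z \<noteq> 0" "z \<in> S"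
  shows "cmod (poly p z / poly q z) \<le> sup_norm (\<lambda>z. poly p z / poly q z) S"
proof -
  have "continuous_on S (\<lambda>z. cmod (poly p z / poly q z))" using assms by (intro continuous_intros) auto
  hence "bdd_above ((\<lambda>z. cmod (poly p z / poly q z)) ` S)"
    using assms(1) by (intro bounded_imp_bdd_above compact_imp_bounded compact_continuous_image)
  thus ?thesis unfolding sup_norm_def using assms(3) by (intro cSUP_upper)
qed

lemma pole_sum_mono:
  assumes "poles_in p q Z" "\<And>\<beta>. \<beta> \<in> Z \<Longrightarrow> D \<beta> \<le> E \<beta>"
  shows "pole_sum p q D \<le> pole_sum p q E"
  unfolding pole_sum_def
proof (intro add_mono sum_mono)
  show "real (degree p - degree q) * D None \<le> real (degree p - degree q) * E None"
    using assms by (cases "degree q < degree p") (auto simp: poles_in_def intro!: mult_left_mono)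
qed (use assms in \<open>auto simp: poles_in_def intro!: mult_left_mono\<close>)

lemma pole_sum_mult_right: "pole_sum p q (\<lambda>\<beta>. D \<beta> * k) = pole_sum p q D * k"
  by (simp add: pole_sum_def sum_distrib_right distrib_right mult.assoc)

text \<open>The finite orders add up to \<open>degree q\<close>, and the truncated difference
  \<open>degree p - degree q\<close> completes this to the maximum of the degrees.\<close>

lemma pole_sum_const:
  assumes "q \<noteq> 0" shows "pole_sum p q (\<lambda>_. c) = real (rat_deg p q) * c"
proof -
  have "pole_sum p q (\<lambda>_. c) = (real (\<Sum>b | poly q b = 0. order b q) + real (degree p - degree q)) * c"
    by (simp add: pole_sum_def sum_distrib_right distrib_right)
  also have "\<dots> = real (rat_deg p q) * c"
    unfolding sum_order_roots[OF assms] by (simp add: rat_deg_def max_def)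
  finally show ?thesis .
qed

context riemann_coordinate
begin

text \<open>The Blaschke factor with its zero divided out and the gap filled. Building
  \<open>F\<close> in \<open>bernstein_walsh\<close> from these factors makes it holomorphic at the
  poles of \<open>f\<close> by construction.\<close>

definition blaschke_quot :: "complex option \<Rightarrow> complex \<Rightarrow> complex" where
  "blaschke_quot \<beta> w = (if w = pt \<beta> then deriv (blaschke \<beta>) (pt \<beta>)
     else (blaschke \<beta> w - blaschke \<beta> (pt \<beta>)) / (w - pt \<beta>))"

lemma blaschke_quot_hol: "off \<beta> \<Longrightarrow> blaschke_quot \<beta> holomorphic_on \<Omega>"
  unfolding blaschke_quot_def by (rule pole_lemma_open[OF blaschke_hol open_\<Omega>])

lemma blaschke_eq_quot: "blaschke \<beta> w = (w - pt \<beta>) * blaschke_quot \<beta> w"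
proof -
  have "blaschke \<beta> (pt \<beta>) = 0" by (simp add: blaschke_def)
  thus ?thesis by (auto simp: blaschke_quot_def)
qed

lemma exp_neg_gr:
  assumes "off \<beta>" "z \<notin> \<Gamma>" "\<beta> \<noteq> Some z"
  shows "exp (- gr \<beta> z) = cmod (blaschke \<beta> (1 / (z - a)))"
proof -
  have "blaschke \<beta> (1 / (z - a)) \<noteq> 0"
    using blaschke_eq_0_iff[OF assms(1) inv_in_\<Omega>[OF assms(2)]] pt_eq_iff[OF assms(2,1)] assms(3) by simp
  thus ?thesis using assms by (simp add: gr_def)
qed

text \<open>Multiplying \<open>f\<close> by the Blaschke factors of its poles, with multiplicity,
  removes all poles. The factors have modulus below 1 and so do not raise the bound \<open>M\<close>
  near the arc. At \<open>z\<close> their product has modulus the exponential of minus the sum of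
  the Green functions.\<close>

lemma bernstein_walsh:
  fixes p q :: "complex poly"
  assumes q: "q \<noteq> 0" and offq: "\<And>b. poly q b = 0 \<Longrightarrow> off (Some b)"
    and z: "z \<notin> \<Gamma>" "poly q z \<noteq> 0"
  shows "cmod (poly p z / poly q z) \<le> sup_norm (\<lambda>z. poly p z / poly q z) \<Gamma> * exp (pole_sum p q (\<lambda>\<beta>. gr \<beta> z))"
proof -
  define f where "f = (\<lambda>z. poly p z / poly q z)"
  define M where "M = sup_norm f \<Gamma>"
  have qG: "poly q z \<noteq> 0" if "z \<in> \<Gamma>" for z using offq that by (auto simp: off_def)
  have fM: "cmod (f z) \<le> M" if "z \<in> \<Gamma>" for z
    unfolding f_def M_def by (rule rational_le_sup_norm[OF compact_\<Gamma> qG that])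
  define Zs where "Zs = {b. poly q b = 0}"
  have finZ: "finite Zs" unfolding Zs_def using q by (rule poly_roots_finite)
  define m where "m = (\<lambda>b. order b q)"
  define d where "d = degree p - degree q"
  define lc where "lc = lead_coeff q"
  have lc: "lc \<noteq> 0" using q by (simp add: lc_def)
  have q_eq: "poly q x = lc * (\<Prod>b\<in>Zs. (x - b) ^ m b)" for x
  proof -
    have "poly q x = poly (smult lc (\<Prod>b\<in>Zs. [:- b, 1:] ^ m b)) x"
      unfolding lc_def Zs_def m_def by (subst complex_poly_decompose) simp
    thus ?thesis by (simp add: poly_prod poly_power)
  qed
  have degq: "(\<Sum>b\<in>Zs. m b) = degree q" unfolding Zs_def m_def by (rule sum_order_roots[OF q])
  \<comment> \<open>The larger of the two degrees, hence \<open>w ^ n * poly p (a + 1 / w)\<close>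
    is a polynomial in \<open>w\<close>, realized by \<open>P\<close>.\<close>
  define n where "n = degree q + d"
  have n: "degree p \<le> n" by (simp add: n_def d_def)
  define ps where "ps = pcompose p [:a, 1:]"
  have degps: "degree ps = degree p" by (simp add: ps_def degree_pcompose)
  define P where "P = (\<lambda>w. w ^ (n - degree p) * poly (reflect_poly ps) w)"
  have P_eq: "P w = w ^ n * poly p (a + 1 / w)" if "w \<noteq> 0" for w
  proof -
    have "P w = w ^ (n - degree p) * (w ^ degree ps * poly ps (inverse w))"
      using that by (simp add: P_def poly_reflect_poly_nz)
    also have "\<dots> = (w ^ (n - degree p) * w ^ degree p) * poly p (a + 1 / w)"
      unfolding degps by (simp add: ps_def poly_pcompose inverse_eq_divide)
    also have "w ^ (n - degree p) * w ^ degree p = w ^ n" using n by (simp flip: power_add)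
    finally show ?thesis .
  qed
  \<comment> \<open>The cancellation is carried out in advance: with \<open>x = a + 1 / w\<close>,
    the difference \<open>x - b\<close> is \<open>- (w - pt (Some b)) / (w * pt (Some b))\<close>.
    This explains the minus signs in \<open>F_eq\<close>, which do not affect the modulus.\<close>
  define F where "F = (\<lambda>w. P w * (\<Prod>b\<in>Zs. (pt (Some b) * blaschke_quot (Some b) w) ^ m b) * blaschke_quot None w ^ d / lc)"
  have offN: "off None" by (simp add: off_def)
  have offZ: "off (Some b)" if "b \<in> Zs" for b using that offq by (auto simp: Zs_def)
  have holF: "F holomorphic_on \<Omega>" unfolding F_def P_def
    using lc by (intro holomorphic_intros blaschke_quot_hol offN offZ) auto
  have F_eq: "F w = f (a + 1 / w) * (\<Prod>b\<in>Zs. (- blaschke (Some b) w) ^ m b) * blaschke None w ^ d"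
    if w: "w \<noteq> 0" "poly q (a + 1 / w) \<noteq> 0" for w
  proof -
    define x where "x = a + 1 / w"
    have fac: "- blaschke (Some b) w = (x - b) * (w * (pt (Some b) * blaschke_quot (Some b) w))" if b: "b \<in> Zs" for b
    proof -
      have "b \<noteq> a" using offZ[OF b] a_in by (auto simp: off_def)
      hence pb: "pt (Some b) = 1 / (b - a)" "b - a \<noteq> 0" by (auto simp: pt_def)
      have "(x - b) * (w * pt (Some b)) = - (w - pt (Some b))"
        using pb(2) w(1) by (simp add: x_def pb(1) field_simps)
      thus ?thesis by (simp only: blaschke_eq_quot[of "Some b" w] mult.assoc[symmetric] minus_mult_left)
    qed
    have "(\<Prod>b\<in>Zs. (- blaschke (Some b) w) ^ m b)
        = (\<Prod>b\<in>Zs. (x - b) ^ m b) * (\<Prod>b\<in>Zs. w ^ m b) * (\<Prod>b\<in>Zs. (pt (Some b) * blaschke_quot (Some b) w) ^ m b)"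
      unfolding prod.distrib[symmetric] by (intro prod.cong refl) (simp add: fac power_mult_distrib mult_ac)
    also have "(\<Prod>b\<in>Zs. w ^ m b) = w ^ degree q" by (simp add: degq flip: power_sum)
    also have "(\<Prod>b\<in>Zs. (x - b) ^ m b) = poly q x / lc" using q_eq[of x] lc by simp
    finally have 1: "(\<Prod>b\<in>Zs. (- blaschke (Some b) w) ^ m b)
        = poly q x / lc * w ^ degree q * (\<Prod>b\<in>Zs. (pt (Some b) * blaschke_quot (Some b) w) ^ m b)" .
    have 2: "blaschke None w ^ d = w ^ d * blaschke_quot None w ^ d"
      using blaschke_eq_quot[of None w] by (simp add: pt_def power_mult_distrib)
    have "P w = w ^ degree q * w ^ d * poly p x" using P_eq[OF w(1)] by (simp add: x_def n_def power_add)
    thus ?thesis using w(2) unfolding F_def 1 2 x_def[symmetric] f_def by (simp add: field_simps)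
  qed
  have w: "1 / (z - a) \<in> \<Omega>" using inv_in_\<Omega> z by blast
  have za: "z \<noteq> a" using z a_in by auto
  have "cmod (F (1 / (z - a))) \<le> M"
  proof (rule maximum_principle_local_norm[OF open_\<Omega> connected_\<Omega> _ _ w, of "\<lambda>w. cmod (F w)"])
    fix w assume "w \<in> \<Omega>"
    then obtain r where "r > 0" "ball w r \<subseteq> \<Omega>" using open_\<Omega> openE by blast
    thus "\<exists>r>0. \<exists>H. H holomorphic_on ball w r \<and> (\<forall>x\<in>ball w r. cmod (F x) = cmod (H x))"
      using holomorphic_on_subset[OF holF] by blast
  next
    fix e :: real assume e: "e > 0"
    define W where "W = {z. poly q z \<noteq> 0} \<inter> (\<lambda>z. cmod (f z)) -` {..<M+e}"
    have "open {z. poly q z \<noteq> 0}" by (intro open_Collect_neq continuous_intros)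
    hence W: "open W" unfolding W_def f_def
      by (intro continuous_open_preimage) (auto intro!: continuous_intros)
    have GW: "\<Gamma> \<subseteq> W" using e fM qG by (force simp: W_def)
    have "cmod (F w) \<le> M + e" if "w \<in> \<Omega> - {w. w = 0 \<or> a + 1 / w \<notin> W}" for w
    proof -
      have w: "w \<in> \<Omega>" "w \<noteq> 0" "poly q (a + 1 / w) \<noteq> 0" "cmod (f (a + 1 / w)) < M + e"
        using that by (auto simp: W_def)
      have "cmod (F w) = cmod (f (a + 1 / w)) * (\<Prod>b\<in>Zs. cmod (blaschke (Some b) w) ^ m b) * cmod (blaschke None w) ^ d"
        by (simp add: F_eq[OF w(2,3)] norm_mult norm_power prod_norm[symmetric])
      also have "\<dots> \<le> cmod (f (a + 1 / w)) * 1 * 1"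
        using blaschke_lt_1[OF offN w(1)] blaschke_lt_1[OF offZ w(1)]
        by (intro mult_mono prod_le_1 power_le_one prod_nonneg mult_nonneg_nonneg) (auto simp: power_le_one less_imp_le)
      finally show ?thesis using w(4) by simp
    qed
    thus "\<exists>K. compact K \<and> K \<subseteq> \<Omega> \<and> (\<forall>w\<in>\<Omega> - K. cmod (F w) \<le> M + e)"
      using compact_outside[OF W GW] by blast
  qed
  also have "cmod (F (1 / (z - a))) = cmod (f z) * exp (- pole_sum p q (\<lambda>\<beta>. gr \<beta> z))"
  proof -
    have "F (1 / (z - a)) = f z * (\<Prod>b\<in>Zs. (- blaschke (Some b) (1 / (z - a))) ^ m b) * blaschke None (1 / (z - a)) ^ d"
      using F_eq[of "1 / (z - a)"] za z by simp
    hence "cmod (F (1 / (z - a))) = cmod (f z) * (\<Prod>b\<in>Zs. cmod (blaschke (Some b) (1 / (z - a))) ^ m b) * cmod (blaschke None (1 / (z - a))) ^ d"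
      by (simp add: norm_mult norm_power prod_norm[symmetric])
    also have "(\<Prod>b\<in>Zs. cmod (blaschke (Some b) (1 / (z - a))) ^ m b) = (\<Prod>b\<in>Zs. exp (- (real (m b) * gr (Some b) z)))"
    proof (rule prod.cong[OF refl])
      fix b assume b: "b \<in> Zs"
      hence "Some b \<noteq> Some z" using z by (auto simp: Zs_def)
      from exp_neg_gr[OF offZ[OF b] z(1) this]
      show "cmod (blaschke (Some b) (1 / (z - a))) ^ m b = exp (- (real (m b) * gr (Some b) z))"
        using exp_of_nat_mult[of "m b" "- gr (Some b) z"] by simp
    qed
    also have "\<dots> = exp (- (\<Sum>b\<in>Zs. real (m b) * gr (Some b) z))"
      using finZ by (simp add: exp_sum flip: sum_negf)
    also have "cmod (blaschke None (1 / (z - a))) ^ d = exp (- (real d * gr None z))"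
      using exp_neg_gr[OF offN z(1)] exp_of_nat_mult[of d "- gr None z"] by simp
    finally show ?thesis
      by (simp add: pole_sum_def Zs_def m_def d_def mult.assoc flip: exp_add)
  qed
  finally show ?thesis by (simp add: exp_minus field_simps M_def f_def)
qed

text \<open>Here the pole varies and \<open>z\<close> is fixed. All poles in \<open>Z\<close> have
  their images in one compact \<open>K\<close>, and \<open>exp (- gr \<beta> z)\<close> is the value
  at the image of a continuous function \<open>B\<close> that is below 1 on \<open>K\<close>, hence
  bounded away from 1.\<close>

lemma gr_lower_bound:
  assumes Z: "closed {z. Some z \<in> Z}" and off: "\<And>\<beta>. \<beta> \<in> Z \<Longrightarrow> off \<beta>"
    and z: "z \<notin> \<Gamma>" "Some z \<notin> Z"
  obtains c where "c > 0" "\<And>\<beta>. \<beta> \<in> Z \<Longrightarrow> gr \<beta> z \<ge> c"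
proof -
  define W where "W = - {z. Some z \<in> Z}"
  define K where "K = {w. w = 0 \<or> a + 1 / w \<notin> W}"
  have W: "open W" "\<Gamma> \<subseteq> W" using Z off by (auto simp: W_def off_def open_Compl)
  note K = compact_outside[OF W, folded K_def]
  have ptK: "pt \<beta> \<in> K" if "\<beta> \<in> Z" for \<beta>
  proof (cases \<beta>)
    case None thus ?thesis by (simp add: pt_def K_def)
  next
    case (Some b) thus ?thesis using that by (simp add: pt_def K_def W_def)
  qed
  define x where "x = \<phi> (1 / (z - a))"
  have x: "cmod x < 1" using \<phi>_in inv_in_\<Omega> z by (simp add: x_def)
  define B where "B = (\<lambda>w. cmod (x - \<phi> w) / cmod (1 - cnj (\<phi> w) * x))"
  have lt: "cmod (x - \<phi> w) < cmod (1 - cnj (\<phi> w) * x)" if "w \<in> K" for w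
    using norm_diff_lt[of "\<phi> w" x] x \<phi>_in[of w] K(2) that by auto
  have nz: "1 - cnj (\<phi> w) * x \<noteq> 0" if "w \<in> K" for w
    using lt[OF that] by (metis norm_ge_zero norm_zero not_less)
  have "continuous_on K \<phi>" using K(2) \<phi>_hol by (meson continuous_on_subset holomorphic_on_imp_continuous_on)
  hence "continuous_on K B" unfolding B_def using nz by (intro continuous_intros) auto
  moreover have "0 \<in> K" by (simp add: K_def)
  ultimately obtain w0 where w0: "w0 \<in> K" "\<And>w. w \<in> K \<Longrightarrow> B w \<le> B w0"
    using continuous_attains_sup[OF K(1)] by (metis empty_iff)
  \<comment> \<open>The lower limit 1/2 keeps the argument of \<open>ln\<close> positive even if
    \<open>B\<close> vanishes on \<open>K\<close>.\<close>
  define \<rho> where "\<rho> = max (B w0) (1/2)"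
  have "B w0 < 1" using lt[OF w0(1)] nz[OF w0(1)] by (simp add: B_def)
  hence \<rho>: "0 < \<rho>" "\<rho> < 1" by (auto simp: \<rho>_def)
  show ?thesis
  proof (rule that[of "- ln \<rho>"])
    show "- ln \<rho> > 0" using \<rho> by simp
    fix \<beta> assume b: "\<beta> \<in> Z"
    hence ne: "\<beta> \<noteq> Some z" using z by auto
    have "exp (- gr \<beta> z) = B (pt \<beta>)"
      unfolding exp_neg_gr[OF off[OF b] z(1) ne] by (simp add: blaschke_def B_def x_def norm_divide)
    also have "\<dots> \<le> \<rho>" using w0(2)[OF ptK[OF b]] by (simp add: \<rho>_def)
    finally have "- gr \<beta> z \<le> ln \<rho>" using \<rho> by (simp add: ln_ge_iff)
    thus "- ln \<rho> \<le> gr \<beta> z" by simp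
  qed
qed

end

section \<open>Riemann map of the complement of an analytic arc\<close>

text \<open>With \<open>a\<close> an endpoint, the complement of \<open>\<Omega>\<close> is the
  continuous image of a half-open interval, so it is connected, and it is unbounded near the removed
  end. A connected open set with only unbounded complementary components is simply connected.
  Connectedness of \<open>\<Omega>\<close> comes from an arc not separating the plane, the point
  \<open>w = 0\<close> being added as a limit point.\<close>

lemma arc_riemann_coordinate:
  assumes "analytic_arc_param \<gamma> U"
  obtains a \<Omega> \<phi> \<psi> where "riemann_coordinate (arc_of \<gamma>) a \<Omega> \<phi> \<psi>"
proof -
  have U: "open U" "complex_of_real ` {-1..1} \<subseteq> U" "\<gamma> holomorphic_on U" "inj_on \<gamma> U"
    using assms by (auto simp: analytic_arc_param_def)
  have cont: "continuous_on U \<gamma>" using U by (simp add: holomorphic_on_imp_continuous_on)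
  define \<Gamma> where "\<Gamma> = arc_of \<gamma>"
  define c where "c = (\<lambda>t::real. \<gamma> (of_real (2 * t - 1)))"
  have inU: "complex_of_real (2 * t - 1) \<in> U" if "t \<in> {0..1}" for t
    using that U(2) by (auto simp del: of_real_diff of_real_mult)
  have contc: "continuous_on {0..1} c" unfolding c_def
    by (rule continuous_on_compose2[OF cont]) (use inU in \<open>auto intro!: continuous_intros\<close>)
  have injc: "inj_on c {0..1}"
  proof (rule inj_onI)
    fix s t :: real assume "s \<in> {0..1}" "t \<in> {0..1}" "c s = c t"
    hence "complex_of_real (2 * s - 1) = complex_of_real (2 * t - 1)"
      using inj_onD[OF U(4)] inU unfolding c_def by blast
    thus "s = t" unfolding of_real_eq_iff by simp
  qed
  have arc: "arc c" using contc injc by (simp add: arc_def path_def)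
  have img: "path_image c = \<Gamma>"
  proof -
    have "(\<lambda>t::real. 2 * t - 1) ` {0..1} = {-1..1}"
    proof (intro equalityI subsetI)
      fix x :: real assume "x \<in> {-1..1}"
      thus "x \<in> (\<lambda>t. 2 * t - 1) ` {0..1}" by (intro image_eqI[of _ _ "(x + 1) / 2"]) (auto simp: field_simps)
    qed auto
    hence "\<Gamma> = \<gamma> ` complex_of_real ` (\<lambda>t::real. 2 * t - 1) ` {0..1}" by (simp add: \<Gamma>_def arc_of_def)
    thus ?thesis by (simp only: path_image_def c_def image_image)
  qed
  have conn: "connected (- \<Gamma>)" using connected_arc_complement[OF arc] img by simp
  have comp: "compact \<Gamma>" using arc img compact_path_image arc_imp_path by metis
  define a where "a = c 0"
  have a: "a \<in> \<Gamma>" unfolding a_def img[symmetric] path_image_def by auto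
  have ca: "c t \<noteq> a" if "t \<in> {0<..1}" for t
    using that inj_onD[OF injc, of t 0] by (auto simp: a_def)
  define \<Omega> where "\<Omega> = {w. w = 0 \<or> a + 1 / w \<notin> \<Gamma>}"
  have "- \<Omega> = {w. w \<noteq> 0 \<and> a + 1 / w \<in> \<Gamma>}" by (auto simp: \<Omega>_def)
  hence op: "open \<Omega>" using closed_inversion_preimage[OF comp] by (metis open_closed)
  have 0: "0 \<in> \<Omega>" by (simp add: \<Omega>_def)
  have "\<Omega> - {0} = (\<lambda>z. 1 / (z - a)) ` (- \<Gamma>)"
  proof (intro equalityI subsetI)
    fix w assume "w \<in> \<Omega> - {0}"
    thus "w \<in> (\<lambda>z. 1 / (z - a)) ` (- \<Gamma>)" by (intro image_eqI[of _ _ "a + 1 / w"]) (auto simp: \<Omega>_def)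
  qed (use a in \<open>auto simp: \<Omega>_def\<close>)
  moreover have "continuous_on (- \<Gamma>) (\<lambda>z. 1 / (z - a))" using a by (intro continuous_intros) auto
  ultimately have "connected (\<Omega> - {0})" using conn connected_continuous_image by metis
  moreover have "\<Omega> \<subseteq> closure (\<Omega> - {0})"
  proof -
    have "0 islimpt \<Omega>" using op 0 interior_limit_point interior_open by blast
    hence "0 islimpt (\<Omega> - {0})" by (simp add: islimpt_punctured[symmetric])
    hence "0 \<in> closure (\<Omega> - {0})" by (simp add: closure_def)
    moreover have "\<Omega> - {0} \<subseteq> closure (\<Omega> - {0})" by (rule closure_subset)
    ultimately show ?thesis by blast
  qed
  ultimately have conO: "connected \<Omega>" by (metis Diff_subset connected_intermediate_closure)
  define e where "e = (\<lambda>t. 1 / (c t - a))"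
  have compl: "- \<Omega> = e ` {0<..1}"
  proof (intro equalityI subsetI)
    fix w assume w: "w \<in> - \<Omega>"
    hence w0: "w \<noteq> 0" "a + 1 / w \<in> \<Gamma>" by (auto simp: \<Omega>_def)
    then obtain t where t: "t \<in> {0..1}" "a + 1 / w = c t" by (auto simp: img[symmetric] path_image_def)
    have "t \<noteq> 0" using t w0 by (auto simp: a_def)
    moreover have "w = e t" using w0 by (simp add: e_def flip: t(2))
    ultimately show "w \<in> e ` {0<..1}" using t by auto
  next
    fix w assume "w \<in> e ` {0<..1}"
    then obtain t where t: "t \<in> {0<..1}" "w = e t" by auto
    have "c t \<in> \<Gamma>" using t by (auto simp: img[symmetric] path_image_def)
    thus "w \<in> - \<Omega>" using ca[OF t(1)] t by (auto simp: \<Omega>_def e_def)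
  qed
  have cone: "connected (- \<Omega>)" unfolding compl
  proof (rule connected_continuous_image)
    show "continuous_on {0<..1} e" unfolding e_def
      using ca by (intro continuous_intros continuous_on_subset[OF contc]) auto
  qed auto
  have unb: "\<not> bounded (- \<Omega>)"
  proof
    assume "bounded (- \<Omega>)"
    then obtain R where R: "R > 0" "\<And>w. w \<in> - \<Omega> \<Longrightarrow> cmod w \<le> R" by (auto simp: bounded_pos)
    have "(c \<longlongrightarrow> c 0) (at 0 within {0..1})" using contc by (auto simp: continuous_on_def)
    hence "(c \<longlongrightarrow> c 0) (at_right 0)" by (simp add: at_within_Icc_at_right)
    hence "\<forall>\<^sub>F t in at_right 0. dist (c t) (c 0) < 1 / R" using R by (intro tendstoD) auto
    moreover have "\<forall>\<^sub>F t in at_right (0::real). t \<in> {0<..1}"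
      unfolding eventually_at_right_field by (intro exI[of _ 1]) auto
    ultimately have "\<forall>\<^sub>F t in at_right (0::real). False"
    proof eventually_elim
      case (elim t)
      have "cmod (e t) \<le> R" using elim R(2)[of "e t"] compl by auto
      thus False using elim R(1) ca[of t] by (simp add: e_def norm_divide a_def dist_norm field_simps)
    qed
    thus False by simp
  qed
  have "- \<Omega> \<noteq> {}" using compl by auto
  hence "components (- \<Omega>) = {- \<Omega>}" using cone by (simp add: components_eq_sing_iff)
  hence "simply_connected \<Omega>" using conO unb by (simp add: simply_connected_eq_unbounded_complement_components[OF op])
  moreover have "\<Omega> \<noteq> UNIV" "\<Omega> \<noteq> {}" using \<open>- \<Omega> \<noteq> {}\<close> 0 by auto
  ultimately obtain f g where fg: "f holomorphic_on \<Omega>" "g holomorphic_on ball 0 1"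
           "\<forall>z \<in> \<Omega>. f z \<in> ball 0 1 \<and> g(f z) = z"
           "\<forall>z \<in> ball 0 1. g z \<in> \<Omega> \<and> f(g z) = z"
    using Riemann_mapping_theorem[of \<Omega>] op by blast
  have "riemann_coordinate \<Gamma> a \<Omega> f g"
    by unfold_locales (use comp a fg in \<open>auto simp: \<Omega>_def\<close>)
  thus ?thesis using that by (simp add: \<Gamma>_def)
qed

section \<open>Growth of Green functions near an interior point of the arc\<close>

context riemann_coordinate
begin

text \<open>The parameter straightens the arc to a real segment and the normal \<open>n\<close> to
  the direction \<open>\<i>\<close>. The reflected function \<open>F\<close> then has derivative
  \<open>A\<close> at 0, equal to the normal derivative times the speed \<open>cmod d\<close>.
  Reflection halves the radius, so the constants 3/16 and 160 become 3/32 and 320.\<close>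

lemma one_sided_growth:
  assumes G: "\<Gamma> = arc_of \<gamma>" and arc: "analytic_arc_param \<gamma> U"
    and r: "r > 0" "cball (complex_of_real t0) r \<subseteq> U" "{t0 - r..t0 + r} \<subseteq> {-1..1}"
    and off: "off \<beta>" and np: "\<And>x. x \<in> cball (of_real t0) r \<Longrightarrow> \<beta> \<noteq> Some (\<gamma> x)"
    and n: "n = \<i> * deriv \<gamma> (of_real t0) / of_real (cmod (deriv \<gamma> (of_real t0)))"
    and x: "cmod x \<le> r * (3/32)" "Im x \<ge> 0"
  shows "gr \<beta> (\<gamma> (of_real t0 + x)) \<le>
    normal_deriv (gr \<beta>) (\<gamma> (of_real t0)) n * cmod (deriv \<gamma> (of_real t0)) * Im x * (1 + 320 * cmod x / r)"
proof -
  define T where "T = complex_of_real t0"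
  define u where "u = (\<lambda>x. gr \<beta> (\<gamma> (T + x)))"
  have U: "open U" "complex_of_real ` {-1..1} \<subseteq> U" "\<gamma> holomorphic_on U" "inj_on \<gamma> U"
    using arc by (auto simp: analytic_arc_param_def)
  have inU: "T + x \<in> U" "T + x \<in> cball T r" if "x \<in> cball 0 r" for x
  proof -
    show "T + x \<in> cball T r" using that by (simp add: dist_norm)
    thus "T + x \<in> U" using r(2) by (auto simp: T_def)
  qed
  have real_in: "\<gamma> (T + x) \<in> \<Gamma>" if "x \<in> cball 0 r" "Im x = 0" for x
  proof -
    have "\<bar>Re x\<bar> \<le> r" using that abs_Re_le_cmod[of x] by simp
    hence "t0 + Re x \<in> {-1..1}" using r(3) by (intro subsetD[OF r(3)]) auto
    moreover have "T + x = of_real (t0 + Re x)" using that by (simp add: T_def complex_eq_iff)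
    ultimately show ?thesis by (auto simp: G arc_of_def simp del: of_real_add)
  qed
  \<comment> \<open>Injectivity of \<open>\<gamma>\<close> on all of \<open>U\<close> keeps points
    off the real axis away from the arc, so each half disc lies on one side.\<close>
  have notin: "\<gamma> (T + x) \<notin> \<Gamma>" if "x \<in> cball 0 r" "Im x \<noteq> 0" for x
  proof
    assume "\<gamma> (T + x) \<in> \<Gamma>"
    then obtain t where t: "t \<in> {-1..1}" "\<gamma> (T + x) = \<gamma> (complex_of_real t)" by (auto simp: G arc_of_def)
    hence "T + x = of_real t" using inj_onD[OF U(4)] inU(1)[OF that(1)] U(2) by blast
    hence "Im (T + x) = 0" by simp
    thus False using that by (simp add: T_def)
  qed
  have holg: "(\<lambda>x. \<gamma> (T + x)) holomorphic_on ball 0 r"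
  proof -
    have "(\<gamma> \<circ> (\<lambda>x. T + x)) holomorphic_on ball 0 r"
    proof (rule holomorphic_on_compose_gen[OF _ U(3)])
      show "(\<lambda>x. T + x) ` ball 0 r \<subseteq> U" by (rule image_subsetI, rule inU(1)) simp
    qed (auto intro!: holomorphic_intros)
    thus ?thesis by (simp add: o_def)
  qed
  have contg: "continuous_on (cball 0 r) (\<lambda>x. \<gamma> (T + x))"
  proof (rule continuous_on_compose2[OF holomorphic_on_imp_continuous_on[OF U(3)]])
    show "(\<lambda>x. T + x) ` cball 0 r \<subseteq> U" by (rule image_subsetI, rule inU(1))
  qed (auto intro!: continuous_intros)
  have contu: "continuous_on (cball 0 r \<inter> {z. 0 \<le> Im z}) u"
    unfolding u_def
  proof (rule continuous_on_compose2[OF gr_continuous[OF off]])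
    show "continuous_on (cball 0 r \<inter> {z. 0 \<le> Im z}) (\<lambda>x. \<gamma> (T + x))"
      by (rule continuous_on_subset[OF contg]) auto
    show "(\<lambda>x. \<gamma> (T + x)) ` (cball 0 r \<inter> {z. 0 \<le> Im z}) \<subseteq> UNIV - fin_part \<beta>"
    proof (rule image_subsetI)
      fix x assume "x \<in> cball 0 r \<inter> {z. 0 \<le> Im z}"
      hence "\<beta> \<noteq> Some (\<gamma> (T + x))" using np inU(2)[of x] unfolding T_def by blast
      thus "\<gamma> (T + x) \<in> UNIV - fin_part \<beta>" by (cases \<beta>) (auto simp: fin_part_def)
    qed
  qed
  define D where "D = ball (0::complex) r \<inter> {z. 0 < Im z}"
  have D: "open D" "convex D"
    unfolding D_def using open_halfspace_Im_gt convex_halfspace_Im_gt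
    by (auto intro!: convex_Int open_Int)
  define B where "B = (\<lambda>x. blaschke \<beta> (1 / (\<gamma> (T + x) - a)))"
  have DG: "\<gamma> (T + x) \<notin> \<Gamma>" "\<beta> \<noteq> Some (\<gamma> (T + x))" if "x \<in> D" for x
  proof -
    have x: "x \<in> cball 0 r" "Im x \<noteq> 0" using that by (auto simp: D_def)
    show "\<gamma> (T + x) \<notin> \<Gamma>" by (rule notin[OF x])
    show "\<beta> \<noteq> Some (\<gamma> (T + x))" using np inU(2)[OF x(1)] unfolding T_def by blast
  qed
  have "(blaschke \<beta> \<circ> (\<lambda>x. 1 / (\<gamma> (T + x) - a))) holomorphic_on D"
  proof (rule holomorphic_on_compose_gen[OF _ blaschke_hol[OF off]])
    show "(\<lambda>x. 1 / (\<gamma> (T + x) - a)) holomorphic_on D"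
      using DG a_in by (intro holomorphic_intros holomorphic_on_subset[OF holg]) (auto simp: D_def)
  qed (use DG inv_in_\<Omega> in auto)
  hence holB: "B holomorphic_on D" by (simp add: B_def o_def)
  have Bnz: "B x \<noteq> 0" and Blt: "cmod (B x) < 1" if "x \<in> D" for x
  proof -
    show "B x \<noteq> 0" using blaschke_eq_0_iff[OF off inv_in_\<Omega>] pt_eq_iff[OF _ off] DG[OF that] by (auto simp: B_def)
    show "cmod (B x) < 1" using blaschke_lt_1[OF off inv_in_\<Omega>] DG[OF that] by (auto simp: B_def)
  qed
  have uB: "u x = - ln (cmod (B x))" if "x \<in> D" for x
    using DG[OF that] by (auto simp: u_def gr_def B_def)
  have "\<i> * of_real (r/2) \<in> D" using r by (simp add: D_def norm_mult)
  then obtain L where L: "L holomorphic_on D" "\<And>x. x \<in> D \<Longrightarrow> exp (L x) = B x"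
    using holomorphic_logarithm_exists[OF D(2,1) holB Bnz] by metis
  define H where "H = (\<lambda>x. - \<i> * L x)"
  have holH: "H holomorphic_on ball 0 r \<inter> {z. 0 < Im z}"
    unfolding H_def using L(1) by (intro holomorphic_intros) (simp add: D_def)
  have uH: "u x = Im (H x)" if "x \<in> ball 0 r" "0 < Im x" for x
  proof -
    have "x \<in> D" using that by (simp add: D_def)
    from uB[OF this] L(2)[OF this, symmetric] show ?thesis by (simp add: H_def)
  qed
  have upos: "u x > 0" if "x \<in> ball 0 r" "0 < Im x" for x
  proof -
    have "x \<in> D" using that by (simp add: D_def)
    from uB[OF this] Blt[OF this] Bnz[OF this] show ?thesis by simp
  qed
  have u0: "u x = 0" if "x \<in> cball 0 r" "Im x = 0" for x
    using real_in[OF that] by (simp add: u_def gr_def)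
  obtain F where F: "F holomorphic_on ball 0 (r/2)" "\<And>z. z \<in> ball 0 (r/2) \<Longrightarrow> F (cnj z) = cnj (F z)"
    "\<And>z. z \<in> ball 0 (r/2) \<Longrightarrow> 0 \<le> Im z \<Longrightarrow> Im (F z) = u z"
    by (rule half_disc_reflection[OF r(1) contu holH])
       (rule uH, assumption+, rule upos, assumption+, rule u0, assumption+, rule that, assumption+)
  define A where "A = Re (deriv F 0)"
  define d where "d = deriv \<gamma> T"
  have growth: "u x \<le> A * Im x * (1 + 160 * cmod x / (r/2))"
  proof -
    have "Im (F x) \<le> A * Im x * (1 + 160 * cmod x / (r/2))" unfolding A_def
      by (rule typically_real_growth[OF _ F(1,2)])
         (use r x F(3) gr_nonneg[OF off] in \<open>auto simp: u_def\<close>)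
    thus ?thesis using F(3)[of x] x r by simp
  qed
  have TU: "T \<in> U" using inU(1)[of 0] r by simp
  have dnz: "d \<noteq> 0" unfolding d_def by (rule holomorphic_injective_imp_regular[OF U(3,1,4) TU])
  define V where "V = ball T (r/2)"
  have VU: "V \<subseteq> U" using r(1,2) by (auto simp: V_def T_def subset_iff)
  obtain g where g: "g holomorphic_on (\<gamma> ` V)" "\<And>z. z \<in> V \<Longrightarrow> deriv \<gamma> z * deriv g (\<gamma> z) = 1"
      "\<And>z. z \<in> V \<Longrightarrow> g (\<gamma> z) = z"
    using holomorphic_has_inverse[OF holomorphic_on_subset[OF U(3) VU]] U(4) VU
    by (metis V_def inj_on_subset open_ball)
  have opV: "open (\<gamma> ` V)"
    by (rule open_mapping_thm3[OF holomorphic_on_subset[OF U(3) VU]]) (use U(4) VU in \<open>auto simp: V_def intro: inj_on_subset\<close>)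
  have TV: "T \<in> V" using r by (simp add: V_def)
  define z0 where "z0 = \<gamma> T"
  have z0V: "z0 \<in> \<gamma> ` V" using TV by (simp add: z0_def)
  \<comment> \<open>The normal ray seen in the parameter plane: a curve, in general not straight,
    leaving 0 with velocity \<open>\<i> / cmod d\<close>.\<close>
  define k where "k = (\<lambda>t::complex. g (z0 + t * n) - T)"
  have dg: "(g has_field_derivative 1 / d) (at z0)"
  proof -
    have "deriv g z0 = 1 / d" using g(2)[OF TV] dnz by (simp add: d_def z0_def field_simps)
    thus ?thesis using holomorphic_derivI[OF g(1) opV z0V] by simp
  qed
  have nd: "n / d = \<i> / of_real (cmod d)" using dnz by (simp add: n d_def T_def)
  have dk: "(k has_field_derivative \<i> / of_real (cmod d)) (at 0)"
  proof -
    have "((\<lambda>t. g (z0 + t * n)) has_field_derivative (1 / d) * n) (at 0)"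
      by (rule DERIV_chain2[where f = g]) (use dg in \<open>auto intro!: derivative_eq_intros\<close>)
    hence "(k has_field_derivative (1 / d) * n - 0) (at 0)" unfolding k_def by (intro derivative_intros)
    thus ?thesis using nd by simp
  qed
  have k0: "k 0 = 0" using g(3)[OF TV] by (simp add: k_def z0_def)
  have dF: "(F has_field_derivative deriv F 0) (at 0)" by (rule holomorphic_derivI[OF F(1)]) (use r in auto)
  have dFk: "((\<lambda>t. F (k t)) has_field_derivative deriv F 0 * (\<i> / of_real (cmod d))) (at 0)"
    by (rule DERIV_chain2[where f = F]) (use dF dk k0 in auto)
  have lim_real: "filterlim complex_of_real (at 0) (at_right 0)"
    unfolding filterlim_at by (auto intro!: tendsto_eq_intros simp: eventually_at_right_field intro: exI[of _ 1])
  have quot: "((\<lambda>t. h (of_real t) / of_real t) \<longlongrightarrow> h') (at_right 0)"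
    if h: "(h has_field_derivative h') (at 0)" "h 0 = 0" for h' and h :: "complex \<Rightarrow> complex"
  proof -
    have "((\<lambda>t. h t / t) \<longlongrightarrow> h') (at 0)" using h by (simp add: DERIV_def)
    thus ?thesis by (rule filterlim_compose[OF _ lim_real])
  qed
  \<comment> \<open>The velocity points upwards, so the curve enters the upper half disc, where the
    imaginary part of \<open>F\<close> is \<open>u\<close>.\<close>
  have evk: "\<forall>\<^sub>F t in at_right 0. Im (k (of_real t)) > 0"
  proof -
    have "((\<lambda>t. Im (k (of_real t) / of_real t)) \<longlongrightarrow> Im (\<i> / of_real (cmod d))) (at_right 0)"
      by (intro tendsto_Im quot[OF dk k0])
    moreover have "Im (\<i> / of_real (cmod d)) > 0" using dnz by simp
    ultimately have "\<forall>\<^sub>F t in at_right 0. Im (k (of_real t) / of_real t) > 0" by (rule order_tendstoD(1))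
    moreover have "\<forall>\<^sub>F t in at_right (0::real). t > 0" by (rule eventually_at_right_less)
    ultimately show ?thesis by eventually_elim (simp add: zero_less_divide_iff)
  qed
  have evV: "\<forall>\<^sub>F t in at_right 0. z0 + of_real t * n \<in> \<gamma> ` V"
  proof -
    have "((\<lambda>t. z0 + of_real t * n) \<longlongrightarrow> z0 + of_real 0 * n) (at_right 0)" by (intro tendsto_intros)
    thus ?thesis using topological_tendstoD[OF _ opV] z0V by simp
  qed
  have ev: "\<forall>\<^sub>F t in at_right 0. Im ((F (k (of_real t)) - F 0) / of_real t) = gr \<beta> (z0 + of_real t * n) / t"
    using evk evV
  proof eventually_elim
    case (elim t)
    then obtain y where y: "y \<in> V" "z0 + of_real t * n = \<gamma> y" by auto
    have ky: "k (of_real t) = y - T" using g(3)[OF y(1)] by (simp add: k_def y(2))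
    have "k (of_real t) \<in> ball 0 (r/2)" unfolding ky using y(1) by (simp add: V_def dist_norm norm_minus_commute)
    hence "Im (F (k (of_real t))) = u (k (of_real t))" using F(3) elim by simp
    also have "\<dots> = gr \<beta> (z0 + of_real t * n)" by (simp add: u_def ky y(2))
    finally show ?case using F(3)[of 0] u0[of 0] r by simp
  qed
  have "((\<lambda>t. Im ((F (k (of_real t)) - F 0) / of_real t)) \<longlongrightarrow> Im (deriv F 0 * (\<i> / of_real (cmod d)))) (at_right 0)"
  proof (intro tendsto_Im quot[where h = "\<lambda>t. F (k t) - F 0"])
    have "((\<lambda>t. F (k t) - F 0) has_field_derivative deriv F 0 * (\<i> / of_real (cmod d)) - 0) (at 0)"
      by (intro derivative_intros dFk)
    thus "((\<lambda>t. F (k t) - F 0) has_field_derivative deriv F 0 * (\<i> / of_real (cmod d))) (at 0)" by simp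
  qed (simp add: k0)
  hence "((\<lambda>t. gr \<beta> (z0 + of_real t * n) / t) \<longlongrightarrow> Im (deriv F 0 * (\<i> / of_real (cmod d)))) (at_right 0)"
    using ev by (rule Lim_transform_eventually)
  hence "normal_deriv (gr \<beta>) z0 n = Im (deriv F 0 * (\<i> / of_real (cmod d)))"
    unfolding normal_deriv_def by (intro tendsto_Lim) auto
  also have "\<dots> = A / cmod d" by (simp add: A_def)
  finally have "A = normal_deriv (gr \<beta>) z0 n * cmod d" using dnz by simp
  thus ?thesis using growth by (simp add: u_def z0_def d_def T_def)
qed

text \<open>For the lower half disc the arc is traversed backwards: \<open>\<gamma> (- x)\<close>
  parametrizes the same arc, exchanges the half planes and reverses the normal.\<close>

lemma two_sided_growth:
  assumes G: "\<Gamma> = arc_of \<gamma>" and arc: "analytic_arc_param \<gamma> U"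
    and r: "r > 0" "cball (complex_of_real t0) r \<subseteq> U" "{t0 - r..t0 + r} \<subseteq> {-1..1}"
    and off: "off \<beta>" and np: "\<And>x. x \<in> cball (of_real t0) r \<Longrightarrow> \<beta> \<noteq> Some (\<gamma> x)"
    and n: "n = \<i> * deriv \<gamma> (of_real t0) / of_real (cmod (deriv \<gamma> (of_real t0)))"
    and x: "cmod x \<le> r * (3/32)"
  shows "gr \<beta> (\<gamma> (of_real t0 + x)) \<le>
    normal_deriv (gr \<beta>) (\<gamma> (of_real t0)) (if Im x \<ge> 0 then n else - n) * cmod (deriv \<gamma> (of_real t0)) * \<bar>Im x\<bar> * (1 + 320 * cmod x / r)"
proof (cases "Im x \<ge> 0")
  case True
  thus ?thesis using one_sided_growth[OF assms(1-8) x True] by simp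
next
  case False
  define \<eta> where "\<eta> = (\<lambda>x. \<gamma> (- x))"
  have U: "open U" "complex_of_real ` {-1..1} \<subseteq> U" "\<gamma> holomorphic_on U" "inj_on \<gamma> U"
    using arc by (auto simp: analytic_arc_param_def)
  have sym: "uminus ` complex_of_real ` {-1..1} = complex_of_real ` {-1..1}"
  proof (intro equalityI subsetI)
    fix x assume "x \<in> complex_of_real ` {-1..1}"
    then obtain t where "t \<in> {-1..1}" "x = of_real t" by auto
    thus "x \<in> uminus ` complex_of_real ` {-1..1}" by (intro image_eqI[of _ _ "of_real (- t)"] imageI) auto
  next
    fix x assume "x \<in> uminus ` complex_of_real ` {-1..1}"
    then obtain t where t: "t \<in> {-1..1}" "x = - of_real t" by auto
    thus "x \<in> complex_of_real ` {-1..1}" by (intro image_eqI[of _ _ "- t"]) auto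
  qed
  have G': "\<Gamma> = arc_of \<eta>"
  proof -
    have "arc_of \<eta> = \<gamma> ` uminus ` complex_of_real ` {-1..1}" by (simp add: arc_of_def \<eta>_def image_image)
    thus ?thesis by (simp only: sym G arc_of_def)
  qed
  have arc': "analytic_arc_param \<eta> (uminus ` U)" unfolding analytic_arc_param_def
  proof (intro conjI)
    show "open (uminus ` U)" using U(1) by (rule open_negations)
    show "complex_of_real ` {-1..1} \<subseteq> uminus ` U" using U(2) sym by blast
    have "(\<gamma> \<circ> uminus) holomorphic_on uminus ` U"
      by (rule holomorphic_on_compose_gen[OF _ U(3)]) (auto intro!: holomorphic_intros)
    thus "\<eta> holomorphic_on uminus ` U" by (simp add: \<eta>_def o_def)
    show "inj_on \<eta> (uminus ` U)" using U(4) by (auto simp: inj_on_def \<eta>_def)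
  qed
  have TU: "complex_of_real t0 \<in> U" using r by (auto simp: subset_iff)
  have "(\<gamma> has_field_derivative deriv \<gamma> (of_real t0)) (at (of_real t0))"
    by (rule holomorphic_derivI[OF U(3,1) TU])
  hence "(\<eta> has_field_derivative deriv \<gamma> (of_real t0) * (- 1)) (at (of_real (- t0)))"
    unfolding \<eta>_def by (intro DERIV_chain2[where f = \<gamma>]) (auto intro!: derivative_eq_intros)
  hence d: "deriv \<eta> (of_real (- t0)) = - deriv \<gamma> (of_real t0)" by (simp add: DERIV_imp_deriv)
  have "gr \<beta> (\<eta> (of_real (- t0) + (- x))) \<le>
    normal_deriv (gr \<beta>) (\<eta> (of_real (- t0))) (- n) * cmod (deriv \<eta> (of_real (- t0))) * Im (- x) * (1 + 320 * cmod (- x) / r)"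
  proof (rule one_sided_growth[OF G' arc' r(1) _ _ off])
    have "dist (complex_of_real (- t0)) y = dist (complex_of_real t0) (- y)" for y
      by (simp add: dist_norm norm_minus_commute add.commute)
    hence cb: "- y \<in> cball (of_real t0) r" if "y \<in> cball (complex_of_real (- t0)) r" for y
      using that by simp
    thus "cball (complex_of_real (- t0)) r \<subseteq> uminus ` U"
      using r(2) by (metis (no_types, lifting) image_eqI in_mono minus_minus subsetI)
    show "{- t0 - r..- t0 + r} \<subseteq> {- 1..1}" using r(1,3) by auto
    show "\<beta> \<noteq> Some (\<eta> y)" if "y \<in> cball (complex_of_real (- t0)) r" for y
      using np[OF cb[OF that]] by (simp add: \<eta>_def)
    show "- n = \<i> * deriv \<eta> (of_real (- t0)) / of_real (cmod (deriv \<eta> (of_real (- t0))))"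
      by (simp only: d n) simp
  qed (use x False in auto)
  thus ?thesis using False unfolding d by (simp add: \<eta>_def add.commute)
qed

end

section \<open>Local radius, scaling and the final estimate\<close>

lemma arc_local_radius:
  assumes arc: "analytic_arc_param \<gamma> U" and t0: "-1 < t0" "t0 < 1"
    and Z: "closed {z. Some z \<in> Z}" and ZG: "\<forall>z\<in>arc_of \<gamma>. Some z \<notin> Z"
  obtains r where "r > 0" "cball (complex_of_real t0) r \<subseteq> U" "{t0 - r..t0 + r} \<subseteq> {-1..1}"
    "\<And>x. x \<in> cball (complex_of_real t0) r \<Longrightarrow> Some (\<gamma> x) \<notin> Z"
proof -
  have U: "open U" "complex_of_real ` {-1..1} \<subseteq> U" "\<gamma> holomorphic_on U"
    using arc by (auto simp: analytic_arc_param_def)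
  have "open (U \<inter> \<gamma> -` (- {z. Some z \<in> Z}))"
    using U Z by (intro continuous_open_preimage holomorphic_on_imp_continuous_on) auto
  moreover have "complex_of_real t0 \<in> U \<inter> \<gamma> -` (- {z. Some z \<in> Z})"
    using U(2) t0 ZG by (auto simp: arc_of_def)
  ultimately obtain r1 where r1: "r1 > 0" "cball (complex_of_real t0) r1 \<subseteq> U \<inter> \<gamma> -` (- {z. Some z \<in> Z})"
    using open_contains_cball by metis
  define r where "r = min r1 (1 - \<bar>t0\<bar>)"
  have r: "r > 0" "r \<le> r1" "r \<le> 1 - \<bar>t0\<bar>" using r1 t0 by (auto simp: r_def)
  have sub: "cball (complex_of_real t0) r \<subseteq> cball (complex_of_real t0) r1" using r by auto
  show ?thesis
  proof (rule that[OF r(1)])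
    show "{t0 - r..t0 + r} \<subseteq> {-1..1}" using r(3) by auto
  qed (use r1(2) sub in auto)
qed

lemma deriv_scaled_composition:
  assumes "(f has_field_derivative f') (at (\<gamma> T))" "(\<gamma> has_field_derivative \<gamma>') (at T)"
  shows "deriv (\<lambda>x. f (\<gamma> (T + x / s))) 0 = f' * \<gamma>' / s"
proof -
  have "((\<lambda>x. T + x / s) has_field_derivative 0 + 1 / s) (at 0)"
    by (intro DERIV_add DERIV_const DERIV_cdivide DERIV_ident)
  hence "((\<lambda>x. \<gamma> (T + x / s)) has_field_derivative \<gamma>' * (1 / s)) (at 0)"
    by (intro DERIV_chain2[where f = \<gamma>]) (use assms(2) in auto)
  hence "((\<lambda>x. f (\<gamma> (T + x / s))) has_field_derivative f' * (\<gamma>' * (1 / s))) (at 0)"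
    by (intro DERIV_chain2[where f = f]) (use assms(1) in auto)
  thus ?thesis by (simp add: DERIV_imp_deriv)
qed

theorem theorem2:
  fixes \<gamma> :: "complex \<Rightarrow> complex" and U :: "complex set" and t0 :: real
    and Z :: "complex option set"
  assumes arc: "analytic_arc_param \<gamma> U"
    and t0: "-1 < t0" "t0 < 1"
    and Zclosed: "closed_ext Z"
    and ZG: "\<forall>z\<in>arc_of \<gamma>. Some z \<notin> Z"
  shows "\<forall>\<epsilon>>0. \<exists>N::nat. \<forall>p q :: complex poly.
           q \<noteq> 0 \<longrightarrow> coprime p q \<longrightarrow> poles_in p q Z \<longrightarrow> N \<le> rat_deg p q \<longrightarrow>
           (let z0 = \<gamma> (complex_of_real t0);
                n1 = \<i> * deriv \<gamma> (complex_of_real t0) / complex_of_real (cmod (deriv \<gamma> (complex_of_real t0)));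
                n2 = - n1;
                f = (\<lambda>z. poly p z / poly q z)
            in cmod (deriv f z0) \<le> (1 + \<epsilon>) * sup_norm f (arc_of \<gamma>) *
                 max (pole_sum p q (\<lambda>\<beta>. normal_deriv (green (arc_of \<gamma>) \<beta>) z0 n1))
                     (pole_sum p q (\<lambda>\<beta>. normal_deriv (green (arc_of \<gamma>) \<beta>) z0 n2)))"
proof (intro allI impI)
  fix \<epsilon> :: real assume eps: "\<epsilon> > 0"
  define \<Gamma> where "\<Gamma> = arc_of \<gamma>"
  obtain a \<Omega> \<phi> \<psi> where "riemann_coordinate (arc_of \<gamma>) a \<Omega> \<phi> \<psi>"
    using arc_riemann_coordinate[OF arc] .
  then interpret riemann_coordinate \<Gamma> a \<Omega> \<phi> \<psi> by (simp add: \<Gamma>_def)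
  have U: "open U" "complex_of_real ` {-1..1} \<subseteq> U" "\<gamma> holomorphic_on U" "inj_on \<gamma> U"
    using arc by (auto simp: analytic_arc_param_def)
  have Zc: "closed {z. Some z \<in> Z}" using Zclosed by (simp add: closed_ext_def)
  obtain r where r: "r > 0" "cball (complex_of_real t0) r \<subseteq> U" "{t0 - r..t0 + r} \<subseteq> {-1..1}"
    "\<And>x. x \<in> cball (complex_of_real t0) r \<Longrightarrow> Some (\<gamma> x) \<notin> Z"
    using arc_local_radius[OF arc t0 Zc ZG] by metis
  define T where "T = complex_of_real t0"
  define z0 where "z0 = \<gamma> T"
  define g' where "g' = deriv \<gamma> T"
  define n1 where "n1 = \<i> * g' / of_real (cmod g')"
  define n2 where "n2 = - n1"
  have TU: "T \<in> U" using r(1,2) by (auto simp: T_def)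
  have dnz: "g' \<noteq> 0" unfolding g'_def by (rule holomorphic_injective_imp_regular[OF U(3,1,4) TU])
  have offZ: "off \<beta>" if "\<beta> \<in> Z" for \<beta> unfolding off_def using that ZG by (auto simp: \<Gamma>_def)
  define D1 where "D1 = (\<lambda>\<beta>. normal_deriv (green \<Gamma> \<beta>) z0 n1)"
  define D2 where "D2 = (\<lambda>\<beta>. normal_deriv (green \<Gamma> \<beta>) z0 n2)"
  have growth: "gr \<beta> (\<gamma> (T + x)) \<le> (if Im x \<ge> 0 then D1 \<beta> else D2 \<beta>) * (cmod g' * \<bar>Im x\<bar> * (1 + 320 * cmod x / r))"
    if b: "\<beta> \<in> Z" and x: "cmod x \<le> r * (3/32)" for \<beta> x
  proof -
    have "gr \<beta> (\<gamma> (of_real t0 + x)) \<le>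
      normal_deriv (gr \<beta>) (\<gamma> (of_real t0)) (if Im x \<ge> 0 then n1 else - n1) * cmod (deriv \<gamma> (of_real t0)) * \<bar>Im x\<bar> * (1 + 320 * cmod x / r)"
      by (rule two_sided_growth[OF \<Gamma>_def arc r(1-3) offZ[OF b] _ _ x])
         (use r(4) b in \<open>auto simp: n1_def g'_def T_def\<close>)
    thus ?thesis by (simp add: D1_def D2_def green_eq_gr[OF offZ[OF b]] T_def z0_def g'_def n2_def mult.assoc split: if_splits)
  qed
  \<comment> \<open>A test point at the limit of the range of \<open>growth\<close>. Its image is
    off the arc and off \<open>Z\<close>, so the lower bound for the Green functions there becomes
    one for the normal derivatives.\<close>
  define x1 where "x1 = \<i> * of_real (r * (3/32))"
  have x1: "cmod x1 = r * (3/32)" "Im x1 = r * (3/32)" using r by (auto simp: x1_def norm_mult)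
  have x1cb: "T + x1 \<in> cball T r" using x1 r by (simp add: dist_norm)
  have "\<gamma> (T + x1) \<notin> \<Gamma>"
  proof
    assume "\<gamma> (T + x1) \<in> \<Gamma>"
    then obtain t where t: "t \<in> {-1..1}" "\<gamma> (T + x1) = \<gamma> (complex_of_real t)" by (auto simp: \<Gamma>_def arc_of_def)
    hence "T + x1 = of_real t" using inj_onD[OF U(4)] x1cb r(2) U(2) unfolding T_def by blast
    hence "Im (T + x1) = 0" by simp
    thus False using x1 r by (simp add: T_def)
  qed
  moreover have "Some (\<gamma> (T + x1)) \<notin> Z" using r(4) x1cb by (simp add: T_def)
  ultimately obtain c' where c': "c' > 0" "\<And>\<beta>. \<beta> \<in> Z \<Longrightarrow> gr \<beta> (\<gamma> (T + x1)) \<ge> c'"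
    using gr_lower_bound[OF Zc offZ] by metis
  \<comment> \<open>The factor 31 is \<open>1 + 320 * (3/32)\<close>, the value of the correction at
    \<open>x1\<close>.\<close>
  define C where "C = cmod g' * (r * (3/32)) * 31"
  have C: "C > 0" using dnz r by (simp add: C_def)
  define c where "c = c' / C"
  have c: "c > 0" using c' C by (simp add: c_def)
  \<comment> \<open>One side is enough, because the larger of the two sums is what has to grow with
    the degree.\<close>
  have D1c: "D1 \<beta> \<ge> c" if "\<beta> \<in> Z" for \<beta>
  proof -
    have "c' \<le> D1 \<beta> * C" using c'(2)[OF that] growth[OF that, of x1] x1 r by (simp add: C_def mult.assoc)
    thus ?thesis using C by (simp add: c_def field_simps)
  qed
  \<comment> \<open>One factor \<open>1 + \<eta>\<close> is spent on the growth of the Green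
    functions, another on the interpolation remainder; for \<open>\<eta> \<le> 1\<close> their
    product is at most \<open>1 + 3 * \<eta>\<close>.\<close>
  define \<eta> where "\<eta> = min 1 (\<epsilon> / 3)"
  have eta: "0 < \<eta>" "\<eta> \<le> 1" "3 * \<eta> \<le> \<epsilon>" using eps by (auto simp: \<eta>_def)
  define \<delta> where "\<delta> = min (r * (3/32)) (\<eta> * r / 320)"
  have delta: "\<delta> > 0" "\<delta> \<le> r * (3/32)" "320 * \<delta> / r \<le> \<eta>" 
    using r eta by (auto simp: \<delta>_def min_def field_simps)
  obtain N0 :: nat where N0: "N0 \<ge> 1" "12 / (pi * N0) \<le> \<eta>"
  proof -
    obtain k :: nat where k: "real k > 12 / \<eta>" using reals_Archimedean2 by blast
    have k0: "k \<ge> 1" using k eta by (metis One_nat_def Suc_leI divide_pos_pos gr0I less_asym' of_nat_0 zero_less_numeral)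
    have "real k \<le> pi * k" using pi_gt3 k0 by simp
    hence "12 / (pi * k) \<le> 12 / real k" using k0 by (intro divide_left_mono) auto
    also have "\<dots> \<le> \<eta>" using k eta k0 by (simp add: field_simps)
    finally show ?thesis using k0 that by blast
  qed
  \<comment> \<open>\<open>N0\<close> is fixed first by the tolerated remainder. Then
    \<open>N\<close> makes the scaled radius \<open>s * \<delta>\<close> exceed
    \<open>pi * N0\<close>, with a choice that depends on \<open>c\<close> and the arc but not on
    \<open>p\<close> or \<open>q\<close>.\<close>
  obtain N :: nat where N: "real N * (cmod g' * c * \<delta>) > pi * N0"
    using reals_Archimedean3[of "cmod g' * c * \<delta>"] dnz c delta by auto
  show "\<exists>N::nat. \<forall>p q :: complex poly.
           q \<noteq> 0 \<longrightarrow> coprime p q \<longrightarrow> poles_in p q Z \<longrightarrow> N \<le> rat_deg p q \<longrightarrow>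
           (let z0 = \<gamma> (complex_of_real t0);
                n1 = \<i> * deriv \<gamma> (complex_of_real t0) / complex_of_real (cmod (deriv \<gamma> (complex_of_real t0)));
                n2 = - n1;
                f = (\<lambda>z. poly p z / poly q z)
            in cmod (deriv f z0) \<le> (1 + \<epsilon>) * sup_norm f (arc_of \<gamma>) *
                 max (pole_sum p q (\<lambda>\<beta>. normal_deriv (green (arc_of \<gamma>) \<beta>) z0 n1))
                     (pole_sum p q (\<lambda>\<beta>. normal_deriv (green (arc_of \<gamma>) \<beta>) z0 n2)))"
    unfolding Let_def T_def[symmetric] z0_def[symmetric] g'_def[symmetric] n1_def[symmetric] n2_def[symmetric]
      \<Gamma>_def[symmetric] D1_def[symmetric] D2_def[symmetric]
  proof (intro exI[of _ N] allI impI)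
    fix p q :: "complex poly"
    assume q: "q \<noteq> 0" and poles: "poles_in p q Z" and deg: "N \<le> rat_deg p q"
    define f where "f = (\<lambda>z. poly p z / poly q z)"
    define M where "M = sup_norm f \<Gamma>"
    define S where "S = max (pole_sum p q D1) (pole_sum p q D2)"
    have qZ: "Some b \<in> Z" if "poly q b = 0" for b using poles that by (auto simp: poles_in_def)
    have qG: "poly q z \<noteq> 0" if "z \<in> \<Gamma>" for z using qZ[of z] ZG that by (auto simp: \<Gamma>_def)
    have fM: "cmod (f z) \<le> M" if "z \<in> \<Gamma>" for z
      unfolding f_def M_def by (rule rational_le_sup_norm[OF compact_\<Gamma> qG that])
    have z0G: "z0 \<in> \<Gamma>" using t0 by (auto simp: z0_def T_def \<Gamma>_def arc_of_def)
    have M0: "M \<ge> 0" using fM[OF z0G] norm_ge_zero order_trans by blast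
    have "real N * c \<le> real (rat_deg p q) * c" using deg c by simp
    also have "\<dots> = pole_sum p q (\<lambda>_. c)" by (simp add: pole_sum_const[OF q])
    also have "\<dots> \<le> pole_sum p q D1" by (rule pole_sum_mono[OF poles D1c])
    also have "\<dots> \<le> S" by (simp add: S_def)
    finally have SN: "real N * c \<le> S" .
    \<comment> \<open>The exponential type of \<open>f\<close> along the arc in the parameter;
      division by \<open>s\<close> in \<open>G\<close> below reduces it to 1.\<close>
    define s where "s = (1 + \<eta>) * cmod g' * S"
    have R: "s * \<delta> > pi * N0"
    proof -
      have "pi * N0 < real N * c * (cmod g' * \<delta>)" using N by (simp add: mult_ac)
      also have "\<dots> \<le> S * (cmod g' * \<delta>)" using SN delta by (intro mult_right_mono) auto
      finally have 1: "pi * N0 < S * (cmod g' * \<delta>)" .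
      moreover have "pi * N0 > 0" using N0 by simp
      ultimately have "1 * (S * (cmod g' * \<delta>)) \<le> (1 + \<eta>) * (S * (cmod g' * \<delta>))"
        using eta by (intro mult_right_mono) auto
      thus ?thesis using 1 by (simp add: s_def mult_ac)
    qed
    have s0: "s > 0" using R delta N0
      by (metis mult_pos_pos of_nat_0_less_iff order_less_trans pi_gt_zero zero_less_mult_pos2 less_le_trans zero_less_one)
    have "(1 + \<eta>) * cmod g' > 0" using dnz eta by simp
    hence S0: "S > 0" using s0 unfolding s_def by (rule zero_less_mult_pos[rotated])
    define G where "G = (\<lambda>x. f (\<gamma> (T + x / of_real s)))"
    have inb: "cmod (x / of_real s) < \<delta>" if "x \<in> ball 0 (s * \<delta>)" for x
      using that s0 by (simp add: norm_divide field_simps)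
    have inc: "T + x / of_real s \<in> cball T r" if "x \<in> ball 0 (s * \<delta>)" for x
    proof -
      have "cmod (x / of_real s) \<le> r" using inb[OF that] delta(2) r(1) by linarith
      thus ?thesis by (simp add: dist_norm)
    qed
    have qnz: "poly q (\<gamma> (T + x / of_real s)) \<noteq> 0" if "x \<in> ball 0 (s * \<delta>)" for x
      using r(4) inc[OF that] qZ unfolding T_def by blast
    have "(\<gamma> \<circ> (\<lambda>x. T + x / of_real s)) holomorphic_on ball 0 (s * \<delta>)"
      by (rule holomorphic_on_compose_gen[OF _ U(3)])
         (use inc r(2) s0 in \<open>auto simp: T_def intro!: holomorphic_intros\<close>)
    hence hg: "(\<lambda>x. \<gamma> (T + x / of_real s)) holomorphic_on ball 0 (s * \<delta>)" by (simp add: o_def)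
    have holG: "G holomorphic_on ball 0 (s * \<delta>)"
      unfolding G_def f_def poly_altdef using qnz
      by (intro holomorphic_intros hg) (auto simp: poly_altdef)
    \<comment> \<open>\<open>bernstein_walsh\<close> speaks of points off the arc, so points on it,
      in particular those with real \<open>x\<close>, use the norm directly. Off the arc all Green
      functions are evaluated on the same side, so one of the two sums appears as a whole.\<close>
    have bound: "cmod (G x) \<le> M * exp \<bar>Im x\<bar>" if x: "x \<in> ball 0 (s * \<delta>)" for x
    proof (cases "\<gamma> (T + x / of_real s) \<in> \<Gamma>")
      case True
      have "cmod (G x) \<le> M * 1" using fM[OF True] by (simp add: G_def)
      also have "\<dots> \<le> M * exp \<bar>Im x\<bar>" using M0 by (intro mult_left_mono) auto
      finally show ?thesis .
    next
      case False
      define y where "y = x / of_real s"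
      define h where "h = cmod g' * \<bar>Im y\<bar> * (1 + 320 * cmod y / r)"
      have y: "cmod y < \<delta>" using inb[OF x] by (simp add: y_def)
      have "cmod (f (\<gamma> (T + y))) \<le> M * exp (pole_sum p q (\<lambda>\<beta>. gr \<beta> (\<gamma> (T + y))))"
        unfolding f_def M_def
        by (rule bernstein_walsh[OF q]) (use qZ offZ False qnz[OF x] in \<open>auto simp: y_def\<close>)
      also have "pole_sum p q (\<lambda>\<beta>. gr \<beta> (\<gamma> (T + y))) \<le> pole_sum p q (\<lambda>\<beta>. (if Im y \<ge> 0 then D1 \<beta> else D2 \<beta>) * h)"
        unfolding h_def by (rule pole_sum_mono[OF poles growth]) (use y delta in auto)
      also have "\<dots> = pole_sum p q (\<lambda>\<beta>. if Im y \<ge> 0 then D1 \<beta> else D2 \<beta>) * h"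
        by (rule pole_sum_mult_right)
      also have "\<dots> \<le> S * h"
      proof (rule mult_right_mono)
        show "pole_sum p q (\<lambda>\<beta>. if Im y \<ge> 0 then D1 \<beta> else D2 \<beta>) \<le> S"
          by (cases "Im y \<ge> 0") (auto simp: S_def)
        show "h \<ge> 0" using r(1) unfolding h_def by (intro mult_nonneg_nonneg) auto
      qed
      also have "\<dots> \<le> S * (cmod g' * \<bar>Im y\<bar> * (1 + \<eta>))"
      proof -
        have "320 * cmod y / r \<le> 320 * \<delta> / r" using y r by (intro divide_right_mono) auto
        hence "1 + 320 * cmod y / r \<le> 1 + \<eta>" using delta by linarith
        thus ?thesis unfolding h_def using S0 by (intro mult_left_mono) auto
      qed
      also have "\<dots> = s * \<bar>Im y\<bar>" by (simp add: s_def mult_ac)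
      also have "\<dots> = \<bar>Im x\<bar>" using s0 by (simp add: y_def abs_divide)
      finally show ?thesis using M0 by (simp add: G_def y_def mult_left_mono)
    qed
    have "cmod (deriv G 0) \<le> M * (1 + 12 / (pi * N0))"
      by (rule local_bernstein[OF N0(1) R holG bound])
    also have "\<dots> \<le> M * (1 + \<eta>)" using N0 M0 by (intro mult_left_mono) auto
    \<comment> \<open>The speed \<open>cmod g'\<close> occurs here and also in \<open>s\<close>, so
      it cancels and the bound does not depend on the parametrization.\<close>
    also have "deriv G 0 = deriv f z0 * g' / of_real s"
      unfolding G_def
    proof (rule deriv_scaled_composition[where f = f and \<gamma> = \<gamma>])
      have "f field_differentiable at z0" unfolding f_def
        using qG[OF z0G] by (intro field_differentiable_divide) (auto intro: poly_DERIV simp: field_differentiable_def)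
      thus "(f has_field_derivative deriv f z0) (at (\<gamma> T))"
        by (simp add: z0_def field_differentiable_derivI)
      show "(\<gamma> has_field_derivative g') (at T)"
        unfolding g'_def by (rule holomorphic_derivI[OF U(3,1) TU])
    qed
    finally have "cmod (deriv f z0) * cmod g' / s \<le> M * (1 + \<eta>)"
      using s0 by (simp add: norm_mult norm_divide)
    hence "cmod (deriv f z0) * cmod g' \<le> (M * (1 + \<eta>) * (1 + \<eta>) * S) * cmod g'"
      unfolding pos_divide_le_eq[OF s0] by (simp add: s_def mult_ac)
    hence "cmod (deriv f z0) \<le> M * (1 + \<eta>) * (1 + \<eta>) * S" using dnz by simp
    also have "\<dots> = (1 + \<eta>)\<^sup>2 * (M * S)" by (simp add: power2_eq_square mult_ac)
    also have "\<dots> \<le> (1 + \<epsilon>) * (M * S)"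
    proof (rule mult_right_mono)
      have "\<eta> * \<eta> \<le> \<eta> * 1" using eta by (intro mult_left_mono) auto
      moreover have "(1 + \<eta>)\<^sup>2 = 1 + 2 * \<eta> + \<eta> * \<eta>" by (simp add: power2_eq_square algebra_simps)
      ultimately show "(1 + \<eta>)\<^sup>2 \<le> 1 + \<epsilon>" using eta by linarith
    qed (use M0 S0 in simp)
    finally show "cmod (deriv (\<lambda>z. poly p z / poly q z) z0) \<le> (1 + \<epsilon>) * sup_norm (\<lambda>z. poly p z / poly q z) \<Gamma> * max (pole_sum p q D1) (pole_sum p q D2)"
      by (simp add: f_def M_def S_def mult_ac)
  qed
qed

end
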